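(* Fix $\theta\in(\underline\theta,\bar\theta)$ and start the process from its stationary distribution $\underline\mu_\theta$. For every $V\in\mathbb R$, $$\lim_{t\to\infty}\frac{J^{(V)}(t)}{t}=\mathbf E_\theta\big(r(\omega_0,\omega_1)\big)-V\,\mathbf E_\theta(\omega_0)\qquad\text{almost surely.}$$
   Context: Model. Let $-\infty\le\omega^{\min}\le 0$ and $1\le\omega^{\max}\le\infty$ be (possibly infinite valued) integers, $I=\{z\in\mathbb Z:\omega^{\min}-1<z<\omega^{\max}+1\}$ and $\Omega=I^{\mathbb Z}$, with elements $\underline\omega=(\omega_i)_{i\in\mathbb Z}$. Let $r:I\times I\to[0,\infty)$ satisfy: $r(\omega^{\min},\cdot)\equiv0$ if $\omega^{\min}$ is finite, $r(\cdot,\omega^{\max})\equiv0$ if $\omega^{\max}$ is finite, and $r$ is non-zero in all other cases; $r(z+1,y)\ge r(z,y)$ and $r(y,z+1)\le r(y,z)$ for $y,z,z+1\in I$; $r(x,y)+r(y,z)+r(z,x)=r(x,z)+r(z,y)+r(y,x)$ for $x,y,z\in I$; and $r(x,y-1)\,r(y,z-1)\,r(z,x-1)=r(x,z-1)\,r(z,y-1)\,r(y,x-1)$ for $\omega^{\min}<x,y,z<\omega^{\max}+1$. The process $\underline\omega(t)$ is the Markov process on $\Omega$ with formal generator $(L\varphi)(\underline\omega)=\sum_{i\in\mathbb Z}r(\omega_i,\omega_{i+1})[\varphi(\dots,\omega_i-1,\omega_{i+1}+1,\dots)-\varphi(\underline\omega)]$ on finite cylinder functions $\varphi$. Heights $h_i(t)$,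 $i\in\mathbb Z$, satisfy $\omega_i(t)=h_{i-1}(t)-h_i(t)$, and $h_i$ increases by one exactly when the jump $(\omega_i,\omega_{i+1})\to(\omega_i-1,\omega_{i+1}+1)$ occurs. Standing assumption: the dynamics exists on a set of tempered configurations $\widetilde\Omega\subset\Omega$ which has full measure w.r.t. all the measures $\underline\mu_\theta$ below. Stationary measures. Fix $f(1)>0$, put $f(z)=\frac{r(z,0)}{r(1,z-1)}f(1)$ for $\omega^{\min}<z<\omega^{\max}+1$ (a nondecreasing positive function), $f(z)!=\prod_{y=1}^zf(y)$ for $I\ni z>0$, $f(0)!=1$, $f(z)!=1/\prod_{y=z+1}^0f(y)$ for $I\ni z<0$. Let $\bar\theta=\lim_{z\to\infty}\log f(z)$ if $\omega^{\max}=\infty$ and $\bar\theta=\infty$ otherwise; $\underline\theta=\lim_{z\to\infty}\log f(-z)$ if $\omega^{\min}=-\infty$ and $\underline\theta=-\infty$ otherwise; assume $\underline\theta<\bar\theta$. For $\theta\in(\underline\theta,\bar\theta)$ let $\mu_\theta(z)=\frac1{Z(\theta)}\frac{e^{\theta z}}{f(z)!}$, $z\in I$, with $Z(\theta)=\sum_{z\in I}e^{\theta z}/f(z)!$, and let $\underline\mu_\theta$ be the product measure on $\Omega$ with all marginals $\mu_\theta$; it is stationary for the process. $\mathbf P_\theta,\mathbf E_\theta$ refer to the process started from $\underline\mu_\theta$. Growth. $J^{(V)}(t)=h_{\lfloor Vt\rfloor}(t)-h_0(0)$ for $V>0$, $J^{(V)}(t)=h_{\lceil Vt\rceil}(t)-h_0(0)$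 for $V<0$, and $J^{(0)}(t)=h_0(t)-h_0(0)$. *)

theory Defs
  imports "HOL-Probability.Probability" "HOL-Library.Extended"
begin

(* Pinf, Minf and Fin belong to int extended; PInfty and MInfty to ereal. *)

type_synonym config = "int \<Rightarrow> int"

definition spins :: "int extended \<Rightarrow> int extended \<Rightarrow> int set" where
  "spins wmin wmax = {z. wmin \<le> Fin z \<and> Fin z \<le> wmax}"

definition configs :: "int extended \<Rightarrow> int extended \<Rightarrow> config set" where
  "configs wmin wmax = {\<omega>. \<forall>i. \<omega> i \<in> spins wmin wmax}"

(* Only the values of r on spins x spins are constrained, and only they matter. *)
definition deposition_rates ::
    "int extended \<Rightarrow> int extended \<Rightarrow> (int \<Rightarrow> int \<Rightarrow> real) \<Rightarrow> bool" where
  "deposition_rates wmin wmax r \<longleftrightarrow>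
    (let I = spins wmin wmax; J = {z \<in> I. wmin < Fin z} in
      (\<forall>x\<in>I. \<forall>y\<in>I. 0 \<le> r x y) \<and>
      (\<forall>x\<in>I. \<forall>y\<in>I. r x y = 0 \<longleftrightarrow> Fin x = wmin \<or> Fin y = wmax) \<and>
      (\<forall>y\<in>I. \<forall>z\<in>I. z + 1 \<in> I \<longrightarrow> r z y \<le> r (z + 1) y \<and> r y (z + 1) \<le> r y z) \<and>
      (\<forall>x\<in>I. \<forall>y\<in>I. \<forall>z\<in>I. r x y + r y z + r z x = r x z + r z y + r y x) \<and>
      (\<forall>x\<in>J. \<forall>y\<in>J. \<forall>z\<in>J.
         r x (y - 1) * r y (z - 1) * r z (x - 1) = r x (z - 1) * r z (y - 1) * r y (x - 1)))"


section \<open>The product measures\<close>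

(* f1 is the free normalising value f(1) > 0. *)
definition f_rate :: "(int \<Rightarrow> int \<Rightarrow> real) \<Rightarrow> real \<Rightarrow> int \<Rightarrow> real" where
  "f_rate r f1 z = r z 0 / r 1 (z - 1) * f1"

definition f_fact :: "(int \<Rightarrow> int \<Rightarrow> real) \<Rightarrow> real \<Rightarrow> int \<Rightarrow> real" where
  "f_fact r f1 z =
    (if 0 \<le> z then \<Prod>y\<in>{1..z}. f_rate r f1 y else 1 / (\<Prod>y\<in>{z + 1..0}. f_rate r f1 y))"

(* The limits exist in the extended reals, because f_rate is positive and nondecreasing. *)
definition theta_upper :: "int extended \<Rightarrow> (int \<Rightarrow> int \<Rightarrow> real) \<Rightarrow> real \<Rightarrow> ereal" where
  "theta_upper wmax r f1 =
    (if wmax = Pinf then lim (\<lambda>n. ereal (ln (f_rate r f1 (int n)))) else PInfty)"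

definition theta_lower :: "int extended \<Rightarrow> (int \<Rightarrow> int \<Rightarrow> real) \<Rightarrow> real \<Rightarrow> ereal" where
  "theta_lower wmin r f1 =
    (if wmin = Minf then lim (\<lambda>n. ereal (ln (f_rate r f1 (- int n)))) else MInfty)"

definition weight :: "(int \<Rightarrow> int \<Rightarrow> real) \<Rightarrow> real \<Rightarrow> real \<Rightarrow> int \<Rightarrow> real" where
  "weight r f1 \<theta> z = exp (\<theta> * of_int z) / f_fact r f1 z"

definition partition_fn ::
    "int extended \<Rightarrow> int extended \<Rightarrow> (int \<Rightarrow> int \<Rightarrow> real) \<Rightarrow> real \<Rightarrow> real \<Rightarrow> real" where
  "partition_fn wmin wmax r f1 \<theta> = (\<Sum>\<^sub>\<infinity>z\<in>spins wmin wmax. weight r f1 \<theta> z)"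

definition marginal ::
    "int extended \<Rightarrow> int extended \<Rightarrow> (int \<Rightarrow> int \<Rightarrow> real) \<Rightarrow> real \<Rightarrow> real \<Rightarrow> int measure" where
  "marginal wmin wmax r f1 \<theta> =
    density (count_space UNIV)
      (\<lambda>z. if z \<in> spins wmin wmax
           then ennreal (weight r f1 \<theta> z / partition_fn wmin wmax r f1 \<theta>) else 0)"

definition product_law ::
    "int extended \<Rightarrow> int extended \<Rightarrow> (int \<Rightarrow> int \<Rightarrow> real) \<Rightarrow> real \<Rightarrow> real \<Rightarrow> config measure" where
  "product_law wmin wmax r f1 \<theta> = PiM UNIV (\<lambda>_. marginal wmin wmax r f1 \<theta>)"


section \<open>The dynamics\<close>

definition config_space :: "config measure" where
  "config_space = PiM UNIV (\<lambda>_. count_space UNIV)"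

definition tempered_space :: "config set \<Rightarrow> config measure" where
  "tempered_space T = restrict_space config_space T"

definition jump :: "int \<Rightarrow> config \<Rightarrow> config" where
  "jump i \<omega> =
    (\<lambda>j. if j = i then \<omega> j - 1 else if j = i + 1 then \<omega> j + 1 else \<omega> j)"

definition cylinder :: "(config \<Rightarrow> real) \<Rightarrow> bool" where
  "cylinder \<phi> \<longleftrightarrow> (\<exists>A. finite A \<and> (\<forall>\<omega> \<eta>. (\<forall>i\<in>A. \<omega> i = \<eta> i) \<longrightarrow> \<phi> \<omega> = \<phi> \<eta>))"

(* For a cylinder function only finitely many summands are nonzero. *)
definition generator :: "(int \<Rightarrow> int \<Rightarrow> real) \<Rightarrow> (config \<Rightarrow> real) \<Rightarrow> config \<Rightarrow> real" where
  "generator r \<phi> \<omega> = (\<Sum>\<^sub>\<infinity>i\<in>UNIV. r (\<omega> i) (\<omega> (i + 1)) * (\<phi> (jump i \<omega>) - \<phi> \<omega>))"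

definition markov_semigroup :: "config set \<Rightarrow> (real \<Rightarrow> config \<Rightarrow> config measure) \<Rightarrow> bool" where
  "markov_semigroup T K \<longleftrightarrow>
    (\<lambda>(t, \<omega>). K t \<omega>) \<in>
      restrict_space borel {0..} \<Otimes>\<^sub>M tempered_space T \<rightarrow>\<^sub>M prob_algebra (tempered_space T) \<and>
    (\<forall>\<omega>\<in>T. K 0 \<omega> = return (tempered_space T) \<omega>) \<and>
    (\<forall>s\<ge>0. \<forall>t\<ge>0. \<forall>\<omega>\<in>T. K (s + t) \<omega> = K s \<omega> \<bind> K t)"

(* K has formal generator L: Dynkin's formula for bounded cylinder functions, from every tempered
   initial state. The first conjunct (finite expected number of jumps over a bond in bounded time)
   makes the integrals in the second one converge. *)
definition has_generator ::
    "(int \<Rightarrow> int \<Rightarrow> real) \<Rightarrow> config set \<Rightarrow> (real \<Rightarrow> config \<Rightarrow> config measure) \<Rightarrow> bool" where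
  "has_generator r T K \<longleftrightarrow>
    (\<forall>\<omega>\<in>T. \<forall>t\<ge>0. \<forall>i.
      (\<integral>\<^sup>+ s\<in>{0..t}. (\<integral>\<^sup>+ \<eta>. ennreal (r (\<eta> i) (\<eta> (i + 1))) \<partial>K s \<omega>) \<partial>lborel) < top) \<and>
    (\<forall>\<omega>\<in>T. \<forall>t\<ge>0. \<forall>\<phi>. cylinder \<phi> \<and> bounded (range \<phi>) \<longrightarrow>
      (\<integral>\<eta>. \<phi> \<eta> \<partial>K t \<omega>) = \<phi> \<omega> + (LINT s:{0..t}|lborel. (\<integral>\<eta>. generator r \<phi> \<eta> \<partial>K s \<omega>)))"

(* The standing assumption: the dynamics exists on the set T of tempered configurations, which has
   full measure under every product measure; these measures are stationary. *)
definition tempered_dynamics ::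
    "int extended \<Rightarrow> int extended \<Rightarrow> (int \<Rightarrow> int \<Rightarrow> real) \<Rightarrow> real \<Rightarrow> config set \<Rightarrow>
     (real \<Rightarrow> config \<Rightarrow> config measure) \<Rightarrow> bool" where
  "tempered_dynamics wmin wmax r f1 T K \<longleftrightarrow>
    T \<in> sets config_space \<and> T \<subseteq> configs wmin wmax \<and>
    markov_semigroup T K \<and> has_generator r T K \<and>
    (\<forall>\<theta>. theta_lower wmin r f1 < ereal \<theta> \<and> ereal \<theta> < theta_upper wmax r f1 \<longrightarrow>
      emeasure (product_law wmin wmax r f1 \<theta>) T = 1 \<and>
      (\<forall>t\<ge>0. restrict_space (product_law wmin wmax r f1 \<theta>) T \<bind> K t =
              restrict_space (product_law wmin wmax r f1 \<theta>) T))"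


section \<open>The process and its heights\<close>

definition past ::
    "'w measure \<Rightarrow> config set \<Rightarrow> (real \<Rightarrow> 'w \<Rightarrow> config) \<Rightarrow> real \<Rightarrow> 'w measure" where
  "past M T X s =
    sigma (space M) (\<Union>u\<in>{0..s}. (\<lambda>A. X u -` A \<inter> space M) ` sets (tempered_space T))"

definition markov_process ::
    "config set \<Rightarrow> (real \<Rightarrow> config \<Rightarrow> config measure) \<Rightarrow> 'w measure \<Rightarrow>
     (real \<Rightarrow> 'w \<Rightarrow> config) \<Rightarrow> bool" where
  "markov_process T K M X \<longleftrightarrow>
    prob_space M \<and>
    (\<forall>t\<ge>0. X t \<in> M \<rightarrow>\<^sub>M tempered_space T) \<and>
    (\<forall>s\<ge>0. \<forall>t\<ge>0. \<forall>A\<in>sets (tempered_space T). AE w in M.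
      real_cond_exp M (past M T X s) (indicator (X (s + t) -` A \<inter> space M)) w
        = measure (K t (X s w)) A)"

(* The path x jumps over the bond (i, i+1) at time u; \<eta> is its (sitewise) left limit at u. *)
definition jumps_at :: "(real \<Rightarrow> config) \<Rightarrow> int \<Rightarrow> real \<Rightarrow> bool" where
  "jumps_at x i u \<longleftrightarrow>
    (\<exists>\<eta>. (\<forall>j. eventually (\<lambda>s. x s j = \<eta> j) (at_left u)) \<and> x u = jump i \<eta>)"

definition jump_times :: "(real \<Rightarrow> config) \<Rightarrow> int \<Rightarrow> real \<Rightarrow> real set" where
  "jump_times x i t = {u. 0 < u \<and> u \<le> t \<and> jumps_at x i u}"

(* The finiteness, together with the two equations, makes every coordinate of x a right-continuous
   step function with finitely many steps in bounded time, changed only by jumps over bonds. *)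
definition heights_of :: "(real \<Rightarrow> config) \<Rightarrow> (real \<Rightarrow> int \<Rightarrow> int) \<Rightarrow> bool" where
  "heights_of x h \<longleftrightarrow>
    (\<forall>t\<ge>0. \<forall>i.
      x t i = h t (i - 1) - h t i \<and>
      finite (jump_times x i t) \<and>
      h t i = h 0 i + int (card (jump_times x i t)))"

definition growth :: "real \<Rightarrow> (real \<Rightarrow> int \<Rightarrow> int) \<Rightarrow> real \<Rightarrow> int" where
  "growth V h t =
    (if 0 < V then h t \<lfloor>V * t\<rfloor> else if V < 0 then h t \<lceil>V * t\<rceil> else h t 0) - h 0 0"

end

theory Submission
  imports Defs
begin

text \<open>The heights at two sites differ by a sum of spins, so the currents through two fixed bonds differ by
  an amount bounded in \<open>L\<^sup>1\<close> uniformly in time, and the current through bond \<open>0\<close> may be replaced by its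
  average over \<open>N\<close> bonds. A current is a martingale of variance of order \<open>t\<close> plus the time integral of
  its jump rate, and by stationarity and the law of large numbers for the product measure the average
  of \<open>N\<close> rates is \<open>L\<^sup>1\<close>-close to its mean at every time. Letting first \<open>t\<close> and then \<open>N\<close> tend to
  infinity gives \<open>J\<^sup>(\<^sup>0\<^sup>)(t) / t \<longrightarrow> E r\<close> in \<open>L\<^sup>1\<close>.

  The increments of the current form a stationary sequence, and the maximal ergodic inequality for its
  block averages turns \<open>L\<^sup>1\<close> convergence to a constant into almost sure convergence; neither the
  ergodicity of the dynamics nor a second moment of the rates is needed. For \<open>V \<noteq> 0\<close> the spins between
  \<open>0\<close> and \<open>V t\<close> add a sum of independent terms of variance of order \<open>t\<close>, which is controlled
  at the times \<open>n\<^sup>2\<close>; between them the heights are monotone in time.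

  Only the semigroup is given, so the martingale is built on a time grid: a jump is detected by
  comparing the configurations at consecutive grid times, its probability given the past is a one-step
  transition probability, and Dynkin's formula compares this probability with the rate.\<close>

section \<open>The maximal ergodic inequality\<close>

text \<open>Dynkin's formula is available for bounded cylinder functions, and the current is not a
  function of the configuration. The test function is therefore the jump pattern
  \<open>bond_jump i \<eta>\<close> with the starting configuration frozen as a parameter: its
  generator at \<open>\<eta>\<close> is exactly the rate, and the comparison errs only where a
  window of four sites has changed. A unit of time holds \<open>1 / d\<close> grid steps, so the
  mean error per step must be \<open>o(d)\<close>; stationarity and right-continuity of the path at
  time \<open>0\<close> give this from a first moment of the rates. Averages run over even bonds
  because neighbouring bonds share a site, so that their rates are dependent. The space that carries
  the process has no time shift, hence the maximal inequality is applied on the sequence space of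
  current increments; these are not functions of the grid configurations, and their stationarity is
  inherited from grid counts as the mesh shrinks. At the times \<open>n\<close> the normalised
  fluctuations would have second moments of order \<open>1 / n\<close>, which is not summable; at
  the squares the order is \<open>1 / n\<^sup>2\<close>, while consecutive squares still have ratio
  tending to \<open>1\<close>.\<close>

fun garsia_max :: "('a \<Rightarrow> 'a) \<Rightarrow> ('a \<Rightarrow> real) \<Rightarrow> nat \<Rightarrow> 'a \<Rightarrow> real" where
  "garsia_max S g 0 x = 0"
| "garsia_max S g (Suc n) x = max 0 (g x + garsia_max S g n (S x))"

lemma garsia_max_nonneg: "0 \<le> garsia_max S g n x"
  by (cases n) auto

lemma garsia_max_mono: "garsia_max S g n x \<le> garsia_max S g (Suc n) x"
proof (induction n arbitrary: x)
  case (Suc n)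
  have "garsia_max S g n (S x) \<le> garsia_max S g (Suc n) (S x)"
    by (rule Suc)
  then show ?case
    unfolding garsia_max.simps(2)[of S g "Suc n" x] garsia_max.simps(2)[of S g n x] by (intro max.mono) auto
qed auto

text \<open>Unfolding the recursion shows \<open>garsia_max S g n x\<close> to be the largest
  Birkhoff sum of length \<open>0\<close> to \<open>n\<close>; the \<open>0\<close> in the maximum
  is the empty sum.\<close>

lemma sum_le_garsia_max: "(\<Sum>k<n. g ((S ^^ k) x)) \<le> garsia_max S g n x"
proof (induction n arbitrary: x)
  case (Suc n)
  have "(\<Sum>k<Suc n. g ((S ^^ k) x)) = g x + (\<Sum>k<n. g ((S ^^ k) (S x)))"
    by (simp add: sum.lessThan_Suc_shift funpow_swap1 del: sum.lessThan_Suc)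
  then show ?case
    using Suc[of "S x"] by simp
qed auto

locale measure_preserving_map = prob_space N for N :: "'a measure" +
  fixes S :: "'a \<Rightarrow> 'a"
  assumes map_measurable [measurable]: "S \<in> N \<rightarrow>\<^sub>M N"
    and distr_map: "distr N N S = N"
begin

lemma funpow_measurable: "(S ^^ k) \<in> N \<rightarrow>\<^sub>M N"
proof (induction k)
  case (Suc k)
  then show ?case
    by (simp add: measurable_comp[OF _ map_measurable])
qed (auto simp: id_def)

lemma distr_funpow: "distr N N (S ^^ k) = N"
proof (induction k)
  case 0
  then show ?case
    by (simp add: id_def distr_id)
next
  case (Suc k)
  have "distr N N (S ^^ Suc k) = distr (distr N N (S ^^ k)) N S"
    by (simp add: distr_distr comp_def funpow_measurable)
  then show ?case
    by (simp only: Suc distr_map)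
qed

lemma measure_preserving_map_funpow: "measure_preserving_map N (S ^^ k)"
  by unfold_locales (auto simp: distr_funpow funpow_measurable)

lemma integrable_funpow:
  fixes g :: "'a \<Rightarrow> real"
  assumes "integrable N g"
  shows "integrable N (\<lambda>x. g ((S ^^ k) x))"
  using assms funpow_measurable[of k] distr_funpow[of k] integrable_distr[of "S ^^ k" N N g] by simp

lemma integral_funpow:
  fixes g :: "'a \<Rightarrow> real"
  assumes [measurable]: "g \<in> borel_measurable N"
  shows "(\<integral>x. g ((S ^^ k) x) \<partial>N) = (\<integral>x. g x \<partial>N)"
  using funpow_measurable[of k] distr_funpow[of k] integral_distr[of "S ^^ k" N N g] by simp

lemma garsia_max_integrable:
  assumes "integrable N g"
  shows "integrable N (garsia_max S g n)"
proof (induction n)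
  case (Suc n)
  have "integrable N (\<lambda>x. garsia_max S g n ((S ^^ 1) x))"
    by (rule integrable_funpow[OF Suc])
  then show ?case
    using assms by auto
qed auto

text \<open>Garsia's argument. Where the maximum \<open>F\<close> is positive,
  \<open>F x \<le> garsia_max S g (Suc n) x = g x + F (S x)\<close>; elsewhere
  \<open>F x = 0\<close> and \<open>- F (S x) \<le> 0\<close>. Hence \<open>F - F \<circ> S\<close>
  is at most \<open>g\<close> on the set and at most \<open>0\<close> off it, and its integral
  vanishes by invariance.\<close>

lemma maximal_ergodic:
  assumes "integrable N g"
  shows "0 \<le> (\<integral>x. indicator {x \<in> space N. 0 < garsia_max S g n x} x * g x \<partial>N)"
proof -
  let ?F = "garsia_max S g n" and ?A = "{x \<in> space N. 0 < garsia_max S g n x}"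
  have F: "integrable N ?F" and FS: "integrable N (\<lambda>x. ?F (S x))"
    using garsia_max_integrable[OF assms, of n] integrable_funpow[OF garsia_max_integrable[OF assms, of n], of 1]
    by auto
  have A [measurable]: "?A \<in> sets N"
    using F by measurable
  have "(\<integral>x. ?F x - ?F (S x) \<partial>N) = 0"
    using F FS integral_funpow[of ?F 1] by auto
  moreover have "(\<integral>x. ?F x - ?F (S x) \<partial>N) \<le> (\<integral>x. indicator ?A x * g x \<partial>N)"
  proof (rule integral_mono)
    show "integrable N (\<lambda>x. indicator ?A x * g x)"
      using integrable_mult_indicator[OF A assms] by simp
    fix x assume "x \<in> space N"
    then show "?F x - ?F (S x) \<le> indicator ?A x * g x"
      using garsia_max_nonneg[of S g n x] garsia_max_nonneg[of S g n "S x"] garsia_max_mono[of S g n x]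
      by (auto simp: indicator_def)
  qed (use F FS in auto)
  ultimately show ?thesis
    by linarith
qed

text \<open>The previous inequality for \<open>g - l\<close>. The sets belonging to finite horizons
  increase to one that contains the event, and since \<open>g\<close> is nonnegative its integral
  over them is at most the full integral.\<close>

lemma maximal_inequality:
  fixes g :: "'a \<Rightarrow> real"
  assumes g: "integrable N g" and nn: "\<And>x. 0 \<le> g x" and l: "0 < l"
  shows "measure N {x \<in> space N. \<exists>n. l * real n < (\<Sum>k<n. g ((S ^^ k) x))} \<le> (\<integral>x. g x \<partial>N) / l"
proof -
  let ?G = "\<lambda>x. g x - l"
  define A where "A n = {x \<in> space N. 0 < garsia_max S ?G n x}" for n
  have iG: "integrable N ?G"
    using g by auto
  have A [measurable]: "A n \<in> sets N" for n
    unfolding A_def using garsia_max_integrable[OF iG, of n] by measurable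
  have bound: "measure N (A n) \<le> (\<integral>x. g x \<partial>N) / l" for n
  proof -
    have ig: "integrable N (\<lambda>x. indicator (A n) x * g x)"
      using integrable_mult_indicator[OF A g] by simp
    have "0 \<le> (\<integral>x. indicator (A n) x * ?G x \<partial>N)"
      using maximal_ergodic[OF iG] unfolding A_def .
    also have "\<dots> = (\<integral>x. indicator (A n) x * g x - l * indicator (A n) x \<partial>N)"
      by (simp add: algebra_simps)
    also have "\<dots> = (\<integral>x. indicator (A n) x * g x \<partial>N) - l * measure N (A n)"
      using ig by (subst Bochner_Integration.integral_diff) (auto simp: integrable_indicator_iff emeasure_eq_measure less_top)
    also have "(\<integral>x. indicator (A n) x * g x \<partial>N) \<le> (\<integral>x. g x \<partial>N)"
      using ig g nn by (intro integral_mono) (auto simp: indicator_def)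
    finally show ?thesis
      using l by (simp add: field_simps)
  qed
  have inc: "incseq A"
  proof (rule incseq_SucI)
    show "A n \<subseteq> A (Suc n)" for n
      unfolding A_def using less_le_trans[OF _ garsia_max_mono[of S ?G n]] by (auto simp del: garsia_max.simps)
  qed
  have "(\<lambda>n. measure N (A n)) \<longlonglongrightarrow> measure N (\<Union>n. A n)"
    using inc by (intro finite_Lim_measure_incseq) auto
  then have "measure N (\<Union>n. A n) \<le> (\<integral>x. g x \<partial>N) / l"
    using bound by (intro LIMSEQ_le_const2) auto
  moreover have "measure N {x \<in> space N. \<exists>n. l * real n < (\<Sum>k<n. g ((S ^^ k) x))} \<le> measure N (\<Union>n. A n)"
  proof (intro finite_measure_mono)
    show "{x \<in> space N. \<exists>n. l * real n < (\<Sum>k<n. g ((S ^^ k) x))} \<subseteq> (\<Union>n. A n)"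
    proof
    fix x assume "x \<in> {x \<in> space N. \<exists>n. l * real n < (\<Sum>k<n. g ((S ^^ k) x))}"
    then obtain n where "x \<in> space N" and "l * real n < (\<Sum>k<n. g ((S ^^ k) x))"
      by auto
    then have "0 < (\<Sum>k<n. ?G ((S ^^ k) x))"
      by (simp add: sum_subtractf algebra_simps)
    also have "\<dots> \<le> garsia_max S ?G n x"
      by (rule sum_le_garsia_max)
    finally show "x \<in> (\<Union>n. A n)"
      using \<open>x \<in> space N\<close> unfolding A_def by auto
  qed
  qed simp
  ultimately show ?thesis
    by linarith
qed

end

text \<open>Monotonicity traps \<open>s n\<close> between its values at the two neighbouring
  multiples of \<open>m\<close>. Passing to a multiple costs at most a constant times
  \<open>m\<close>, which is negligible against \<open>n\<close>.\<close>

lemma mono_average_tendsto: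
  fixes s :: "nat \<Rightarrow> real"
  assumes "mono s" "s 0 = 0"
    and "\<And>l. 0 < l \<Longrightarrow> \<exists>m>0. \<forall>j. \<bar>s (j * m) - c * real (j * m)\<bar> \<le> l * real (j * m)"
  shows "(\<lambda>n. s n / real n) \<longlonglongrightarrow> c"
proof (rule LIMSEQ_I)
  fix e :: real assume "0 < e"
  then obtain m where m: "m > 0" "\<And>j. \<bar>s (j * m) - c * real (j * m)\<bar> \<le> (e/4) * real (j * m)"
    using assms(3)[of "e/4"] by auto
  \<comment> \<open>Chosen so that the rounding cost \<open>(\<bar>c\<bar> + e) * m\<close> is below
    \<open>e * n / 4\<close> for \<open>n \<ge> n0\<close>; the \<open>+ 1\<close> makes
    \<open>n\<close> positive.\<close>
  obtain n0 :: nat where n0: "real n0 > (4 * (\<bar>c\<bar> + e) * real m) / e + 1"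
    using reals_Archimedean2 by blast
  have "norm (s n / real n - c) < e" if "n \<ge> n0" for n
  proof -
    define j where "j = n div m"
    have jm: "j * m \<le> n" "n < (Suc j) * m"
      using m(1) unfolding j_def by (auto simp: dividend_less_div_times)
    have npos: "real n > 0" and big: "e * real n > 4 * (\<bar>c\<bar> + e) * real m"
    proof -
      have "0 \<le> (4 * (\<bar>c\<bar> + e) * real m) / e"
        using \<open>0 < e\<close> by auto
      then have "real n0 > 1" using n0 by linarith
      then show "real n > 0" using that by linarith
      have "real n > (4 * (\<bar>c\<bar> + e) * real m) / e"
        using n0 that by linarith
      then show "e * real n > 4 * (\<bar>c\<bar> + e) * real m"
        using \<open>0 < e\<close> by (simp add: field_simps)
    qed
    have lo: "s (j * m) \<le> s n" and hi: "s n \<le> s (Suc j * m)"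
      using jm assms(1) by (auto intro: monoD)
    have r1: "real (j * m) \<le> real n" "real n \<le> real (j * m) + real m"
      using jm by (simp_all flip: of_nat_add of_nat_mult)
    have r2: "real (Suc j * m) = real (j * m) + real m"
      by simp
    have a1: "\<bar>s (j * m) - c * real (j * m)\<bar> \<le> (e/4) * real n"
    proof -
      have "(e/4) * real (j * m) \<le> (e/4) * real n"
        using r1 \<open>0 < e\<close> by (intro mult_left_mono) linarith+
      then show ?thesis using m(2)[of j] by linarith
    qed
    have a2: "\<bar>s (Suc j * m) - c * real (Suc j * m)\<bar> \<le> (e/4) * (real n + real m)"
    proof -
      have "(e/4) * real (Suc j * m) \<le> (e/4) * (real n + real m)"
        using r1 r2 \<open>0 < e\<close> by (intro mult_left_mono) linarith+
      then show ?thesis using m(2)[of "Suc j"] by linarith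
    qed
    have c1: "\<bar>c * real n - c * real (j * m)\<bar> \<le> \<bar>c\<bar> * real m"
      unfolding right_diff_distrib[symmetric] abs_mult using r1 by (intro mult_left_mono abs_leI) linarith+
    have c2: "\<bar>c * real (Suc j * m) - c * real n\<bar> \<le> \<bar>c\<bar> * real m"
      unfolding right_diff_distrib[symmetric] abs_mult using r1 r2 by (intro mult_left_mono abs_leI) linarith+
    have "\<bar>s n - c * real n\<bar> \<le> (e/4) * (real n + real m) + \<bar>c\<bar> * real m"
    proof -
      have "0 \<le> (e/4) * real m" "(e/4) * (real n + real m) = (e/4) * real n + (e/4) * real m"
        using \<open>0 < e\<close> by (auto simp: algebra_simps)
      then show ?thesis using a1 a2 c1 c2 lo hi by linarith
    qed
    also have "\<dots> \<le> (e/4) * real n + (\<bar>c\<bar> + e) * real m"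
      using \<open>0 < e\<close> by (simp add: algebra_simps)
    also have "\<dots> < e * real n"
    proof -
      have "0 < e * real n"
        using npos \<open>0 < e\<close> by simp
      then show ?thesis using big by linarith
    qed
    finally have "\<bar>s n - c * real n\<bar> / real n < e"
      using npos by (simp add: field_simps)
    moreover have "s n / real n - c = (s n - c * real n) / real n"
      using npos by (simp add: field_simps)
    ultimately show ?thesis
      using npos by (simp add: abs_divide)
  qed
  then show "\<exists>n0. \<forall>n\<ge>n0. norm (s n / real n - c) < e"
    by blast
qed

text \<open>The maximal inequality for the block averages bounds the upper limit of the deviation from
  \<^term>\<open>c\<close>; no limiting random variable has to be identified.\<close>

lemma (in measure_preserving_map) ergodic_averages_AE_tendsto:
  fixes g :: "'a \<Rightarrow> real"
  assumes g: "integrable N g" and nn: "\<And>x. 0 \<le> g x"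
    and L1: "(\<lambda>m. \<integral>x. \<bar>(\<Sum>k<m. g ((S ^^ k) x)) - c * real m\<bar> \<partial>N) \<in> o(\<lambda>m. real m)"
  shows "AE x in N. (\<lambda>n. (\<Sum>k<n. g ((S ^^ k) x)) / real n) \<longlonglongrightarrow> c"
proof -
  define D where "D m x = \<bar>(\<Sum>k<m. g ((S ^^ k) x)) - c * real m\<bar>" for m x
  \<comment> \<open>Bad for block length \<open>m\<close>: for some number of blocks, the average
    block deviation exceeds \<open>l\<close> per unit of time. The maximal inequality for
    \<open>S ^^ m\<close> bounds its measure by the mean of \<open>D m\<close> divided by
    \<open>l * m\<close>.\<close>
  define Bad where "Bad l m = {x \<in> space N. \<exists>n. (l * real m) * real n < (\<Sum>k<n. D m (((S ^^ m) ^^ k) x))}" for l m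
  have [measurable]: "g \<in> borel_measurable N"
    using g by auto
  have D: "integrable N (D m)" for m
    unfolding D_def using integrable_funpow[OF g] by auto
  have [measurable]: "D m \<in> borel_measurable N" for m
    using D by auto
  have DS [measurable]: "(\<lambda>x. D m (((S ^^ m) ^^ k) x)) \<in> borel_measurable N" for m k
    unfolding funpow_mult using integrable_funpow[OF D] by (rule borel_measurable_integrable)
  have Bad [measurable]: "Bad l m \<in> sets N" for l m
    unfolding Bad_def by measurable
  have bad: "measure N (Bad l m) \<le> (\<integral>x. D m x \<partial>N) / (l * real m)" if "0 < l" "0 < m" for l m
  proof -
    interpret B: measure_preserving_map N "S ^^ m"
      by (rule measure_preserving_map_funpow)
    show ?thesis
      unfolding Bad_def using that by (intro B.maximal_inequality D) (auto simp: D_def)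
  qed
  \<comment> \<open>By the \<open>L1\<close> hypothesis the bound for \<open>Bad l m\<close> becomes
    arbitrarily small for suitable \<open>m\<close>. So almost every point escapes some block
    length, and that block length may depend on the point.\<close>
  have null: "measure N (\<Inter>m\<in>{0<..}. Bad l m) = 0" if "0 < l" for l
  proof -
    have "measure N (\<Inter>m\<in>{0<..}. Bad l m) \<le> e" if "0 < e" for e
    proof -
      have "eventually (\<lambda>m. norm (\<integral>x. D m x \<partial>N) \<le> (e * l) * norm (real m)) at_top"
        using landau_o.smallD[OF L1, of "e * l"] that \<open>0 < l\<close> unfolding D_def by simp
      then have "eventually (\<lambda>m. 0 < m \<and> norm (\<integral>x. D m x \<partial>N) \<le> (e * l) * norm (real m)) at_top"
        by (intro eventually_conj eventually_gt_at_top)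
      then obtain m where m: "0 < m" "(\<integral>x. D m x \<partial>N) \<le> (e * l) * real m"
        by (auto simp: eventually_at_top_linorder)
      have "measure N (\<Inter>m\<in>{0<..}. Bad l m) \<le> measure N (Bad l m)"
        using m(1) by (intro finite_measure_mono) auto
      also have "\<dots> \<le> (\<integral>x. D m x \<partial>N) / (l * real m)"
        using bad m \<open>0 < l\<close> by auto
      also have "\<dots> \<le> e"
        using m \<open>0 < l\<close> by (simp add: divide_le_eq algebra_simps)
      finally show ?thesis .
    qed
    then show ?thesis
      by (intro antisym[OF field_le_epsilon measure_nonneg]) simp
  qed
  have "AE x in N. \<forall>j. x \<notin> (\<Inter>m\<in>{0<..}. Bad (1 / real (Suc j)) m)"
  proof (unfold AE_all_countable, rule allI)
    fix j
    have "(\<Inter>m\<in>{0<..}. Bad (1 / real (Suc j)) m) \<in> null_sets N"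
      using null[of "1 / real (Suc j)"] by (intro null_setsI) (auto simp: emeasure_eq_measure)
    then show "AE x in N. x \<notin> (\<Inter>m\<in>{0<..}. Bad (1 / real (Suc j)) m)"
      by (rule AE_not_in)
  qed
  then show ?thesis
  proof (rule AE_mp, intro AE_I2 impI)
    fix x assume x: "x \<in> space N" "\<forall>j. x \<notin> (\<Inter>m\<in>{0<..}. Bad (1 / real (Suc j)) m)"
    let ?s = "\<lambda>n. \<Sum>k<n. g ((S ^^ k) x)"
    have block: "\<bar>?s (j * m) - c * real (j * m)\<bar> \<le> (\<Sum>i<j. D m (((S ^^ m) ^^ i) x))" for j m
    proof -
      have "?s (j * m) = (\<Sum>i<j. \<Sum>k<m. g ((S ^^ k) (((S ^^ m) ^^ i) x)))"
      proof -
        have "?s (j * m) = (\<Sum>i<j. \<Sum>k\<in>{i * m..<i * m + m}. g ((S ^^ k) x))"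
          using sum.nat_group[of "\<lambda>k. g ((S ^^ k) x)" m j] by simp
        also have "\<dots> = (\<Sum>i<j. \<Sum>k<m. g ((S ^^ (k + i * m)) x))"
        proof (rule sum.cong[OF refl])
          fix i
          show "(\<Sum>k\<in>{i * m..<i * m + m}. g ((S ^^ k) x)) = (\<Sum>k<m. g ((S ^^ (k + i * m)) x))"
            using sum.shift_bounds_nat_ivl[of "\<lambda>k. g ((S ^^ k) x)" 0 "i * m" m]
            by (simp add: lessThan_atLeast0 add.commute)
        qed
        finally show ?thesis
          by (simp add: funpow_add funpow_mult mult.commute)
      qed
      then have "?s (j * m) - c * real (j * m) = (\<Sum>i<j. (\<Sum>k<m. g ((S ^^ k) (((S ^^ m) ^^ i) x))) - c * real m)"
        by (simp add: sum_subtractf)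
      then show ?thesis
        unfolding D_def by (metis sum_abs)
    qed
    show "(\<lambda>n. ?s n / real n) \<longlonglongrightarrow> c"
    proof (rule mono_average_tendsto)
      show "mono ?s"
        using nn by (intro monoI sum_mono2) auto
      fix l :: real assume "0 < l"
      then obtain j where j: "1 / real (Suc j) < l"
        using reals_Archimedean by (metis inverse_eq_divide)
      obtain m where m: "0 < m" "x \<notin> Bad (1 / real (Suc j)) m"
        using x by auto
      have "\<bar>?s (i * m) - c * real (i * m)\<bar> \<le> l * real (i * m)" for i
      proof -
        have "\<bar>?s (i * m) - c * real (i * m)\<bar> \<le> (1 / real (Suc j) * real m) * real i"
          using block[of i m] m(2) x(1) unfolding Bad_def by (auto simp: not_less intro: order_trans)
        also have "\<dots> \<le> l * real (i * m)"
          using mult_right_mono[OF less_imp_le[OF j], of "real (i * m)"] by (simp add: algebra_simps)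
        finally show ?thesis .
      qed
      then show "\<exists>m>0. \<forall>j. \<bar>?s (j * m) - c * real (j * m)\<bar> \<le> l * real (j * m)"
        using m(1) by blast
    qed simp
  qed
qed

section \<open>Rates and marginals\<close>

text \<open>Ratio test: the quotient of consecutive values of \<open>1 + n\<^sup>2\<close> tends to
  \<open>1\<close> and cannot spoil a factor below \<open>1\<close>.\<close>

lemma summable_square_times_geometric_decay:
  fixes b :: "nat \<Rightarrow> real"
  assumes nn: "\<And>n. 0 \<le> b n" and "\<rho> < 1" and decay: "\<And>n. n0 \<le> n \<Longrightarrow> b (Suc n) \<le> \<rho> * b n"
  shows "summable (\<lambda>n. (1 + (real n)\<^sup>2) * b n)"
proof -
  \<comment> \<open>The maximum with \<open>1/2\<close> makes the ratio positive, so that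
    \<open>1 / \<rho>'\<close> makes sense even when the given ratio is \<open>0\<close>.\<close>
  define \<rho>' where "\<rho>' = max \<rho> (1/2)"
  have \<rho>': "0 < \<rho>'" "\<rho>' < 1" "\<rho> \<le> \<rho>'"
    using \<open>\<rho> < 1\<close> by (auto simp: \<rho>'_def)
  \<comment> \<open>Solves \<open>(1 + \<epsilon>) * \<rho>' = (\<rho>' + 1) / 2\<close>, the ratio
    used in the test.\<close>
  define \<epsilon> where "\<epsilon> = (1 / \<rho>' - 1) / 2"
  have \<epsilon>: "0 < \<epsilon>" "1 + \<epsilon> = (1 + 1 / \<rho>') / 2"
    using \<rho>' by (simp_all add: \<epsilon>_def field_simps)
  \<comment> \<open>From \<open>n1\<close> on,
    \<open>2 * n + 1 \<le> 3 * n \<le> \<epsilon> * n\<^sup>2\<close>, which is the growth of the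
    quadratic factor in one step.\<close>
  obtain n1 :: nat where n1: "3 / \<epsilon> < real n1"
    using reals_Archimedean2 by blast
  show ?thesis
  proof (rule summable_ratio_test)
    show "(\<rho>' + 1) / 2 < 1"
      using \<rho>' by simp
    fix n assume n: "max n0 n1 \<le> n"
    have p: "0 < 1 + (real n)\<^sup>2"
      by (simp add: add_pos_nonneg)
    have "3 / \<epsilon> < real n"
      using n1 n by (simp add: max_def split: if_splits)
    then have "3 \<le> \<epsilon> * real n"
      using \<epsilon> by (simp add: divide_less_eq mult.commute)
    then have "3 * real n \<le> \<epsilon> * real n * real n"
      by (intro mult_right_mono) auto
    then have "3 * real n \<le> \<epsilon> * (real n)\<^sup>2"
      by (simp only: power2_eq_square mult.assoc)
    moreover have "1 \<le> real n"
      using \<open>3 / \<epsilon> < real n\<close> \<epsilon> by (cases n) (auto simp: divide_less_0_iff)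
    moreover have "(real (Suc n))\<^sup>2 = (real n)\<^sup>2 + 2 * real n + 1"
      by (simp add: power2_eq_square algebra_simps)
    moreover have "(1 + \<epsilon>) * (1 + (real n)\<^sup>2) = 1 + (real n)\<^sup>2 + \<epsilon> + \<epsilon> * (real n)\<^sup>2"
      by (simp only: distrib_right distrib_left mult_1_left mult_1_right add.assoc)
    ultimately have "1 + (real (Suc n))\<^sup>2 \<le> (1 + \<epsilon>) * (1 + (real n)\<^sup>2)"
      using \<epsilon>(1) by linarith
    then have "1 + (real (Suc n))\<^sup>2 \<le> (1 + 1 / \<rho>') / 2 * (1 + (real n)\<^sup>2)"
      by (simp only: \<epsilon>)
    moreover have "b (Suc n) \<le> \<rho>' * b n"
      using decay[of n] n \<rho>'(3) nn[of n] mult_right_mono[OF \<rho>'(3), of "b n"] by linarith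
    ultimately have "(1 + (real (Suc n))\<^sup>2) * b (Suc n) \<le> ((1 + 1 / \<rho>') / 2 * (1 + (real n)\<^sup>2)) * (\<rho>' * b n)"
      using nn p \<rho>' by (intro mult_mono) auto
    also have "\<dots> = (\<rho>' + 1) / 2 * ((1 + (real n)\<^sup>2) * b n)"
      using \<rho>' by (simp add: field_simps)
    finally show "norm ((1 + (real (Suc n))\<^sup>2) * b (Suc n)) \<le> (\<rho>' + 1) / 2 * norm ((1 + (real n)\<^sup>2) * b n)"
      using nn by (simp add: abs_mult)
  qed
qed

lemma int_le_induct_step:
  fixes P :: "int \<Rightarrow> 'a :: order"
  assumes "a \<le> b" and "\<And>z. a \<le> z \<Longrightarrow> z < b \<Longrightarrow> P z \<le> P (z + 1)"
  shows "P a \<le> P b"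
  using assms
proof (induction b rule: int_ge_induct)
  case (step i)
  have "P a \<le> P i"
    using step by auto
  also have "P i \<le> P (i + 1)"
    using step by auto
  finally show ?case .
qed auto

lemma summable_on_imp_integrable_count_space:
  fixes g :: "'a \<Rightarrow> real"
  assumes "g summable_on A"
  shows "integrable (count_space A) g" "integral\<^sup>L (count_space A) g = (\<Sum>\<^sub>\<infinity>x\<in>A. g x)"
proof -
  have "Infinite_Sum.abs_summable_on g A"
    using assms by (rule iffD1[OF summable_on_iff_abs_summable_on_real])
  then have "Infinite_Set_Sum.abs_summable_on g A"
    by (rule iffD1[OF abs_summable_equivalent])
  moreover from this have "infsetsum g A = infsum g A"
    by (rule infsetsum_infsum)
  ultimately show "integrable (count_space A) g" "integral\<^sup>L (count_space A) g = (\<Sum>\<^sub>\<infinity>x\<in>A. g x)"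
    unfolding abs_summable_on_def infsetsum_def by auto
qed

section \<open>Monotonicity and exchange relations of the rates\<close>

locale deposition =
  fixes wmin wmax :: "int extended" and r :: "int \<Rightarrow> int \<Rightarrow> real" and f1 :: real
  assumes wmin: "wmin \<le> Fin 0" and wmax: "Fin 1 \<le> wmax"
    and rates: "deposition_rates wmin wmax r" and f1: "0 < f1"
begin

abbreviation "I \<equiv> spins wmin wmax"
abbreviation "f \<equiv> f_rate r f1"

lemma spins_convex: "x \<in> I \<Longrightarrow> z \<in> I \<Longrightarrow> x \<le> y \<Longrightarrow> y \<le> z \<Longrightarrow> y \<in> I"
  unfolding spins_def by (cases wmin; cases wmax) auto

lemma zero_in_spins: "0 \<in> I" and one_in_spins: "1 \<in> I"
  using wmin wmax unfolding spins_def by (cases wmin; cases wmax; auto)+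

text \<open>Comparisons with a possibly infinite endpoint become membership of a neighbouring
  integer, which treats finite and infinite endpoints alike from here on.\<close>

lemma above_wmin_iff: "z \<in> I \<Longrightarrow> wmin < Fin z \<longleftrightarrow> z - 1 \<in> I"
  and eq_wmin_iff: "z \<in> I \<Longrightarrow> Fin z = wmin \<longleftrightarrow> z - 1 \<notin> I"
  and eq_wmax_iff: "z \<in> I \<Longrightarrow> Fin z = wmax \<longleftrightarrow> z + 1 \<notin> I"
  unfolding spins_def by (cases wmin; cases wmax; auto)+

lemma r_nonneg: "x \<in> I \<Longrightarrow> y \<in> I \<Longrightarrow> 0 \<le> r x y"
  using rates unfolding deposition_rates_def Let_def by auto

text \<open>A rate vanishes exactly when its jump would leave the set of spins.\<close>

lemma r_zero_iff: "x \<in> I \<Longrightarrow> y \<in> I \<Longrightarrow> r x y = 0 \<longleftrightarrow> x - 1 \<notin> I \<or> y + 1 \<notin> I"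
  using rates eq_wmin_iff eq_wmax_iff unfolding deposition_rates_def Let_def by auto

lemma r_pos: "x \<in> I \<Longrightarrow> y \<in> I \<Longrightarrow> x - 1 \<in> I \<Longrightarrow> y + 1 \<in> I \<Longrightarrow> 0 < r x y"
  using r_nonneg r_zero_iff by (metis order_le_less)

lemma r_mono_left: "x \<in> I \<Longrightarrow> x' \<in> I \<Longrightarrow> y \<in> I \<Longrightarrow> x \<le> x' \<Longrightarrow> r x y \<le> r x' y"
proof (rule int_le_induct_step[where P = "\<lambda>x. r x y"])
  fix z assume a: "x \<in> I" "x' \<in> I" "y \<in> I" "x \<le> z" "z < x'"
  then have "z \<in> I" "z + 1 \<in> I"
    using spins_convex[of x x'] by auto
  then show "r z y \<le> r (z + 1) y"
    using a rates unfolding deposition_rates_def Let_def by auto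
qed

lemma r_antimono_right: "x \<in> I \<Longrightarrow> y \<in> I \<Longrightarrow> y' \<in> I \<Longrightarrow> y \<le> y' \<Longrightarrow> r x y' \<le> r x y"
proof -
  assume a: "x \<in> I" "y \<in> I" "y' \<in> I" "y \<le> y'"
  have "- r x y \<le> - r x y'"
  proof (rule int_le_induct_step[where P = "\<lambda>y. - r x y"])
    fix z assume z: "y \<le> z" "z < y'"
    then have "z \<in> I" "z + 1 \<in> I"
      using spins_convex[of y y'] a by auto
    then show "- r x z \<le> - r x (z + 1)"
      using a rates unfolding deposition_rates_def Let_def by auto
  qed (use a in auto)
  then show ?thesis by simp
qed

text \<open>The cyclic product condition at \<open>x\<close>, \<open>y + 1\<close>,
  \<open>1\<close>. Together with the recursion of the marginal it says that
  \<open>q x * q y * r x y\<close> is unchanged when \<open>(x, y)\<close> is replaced by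
  \<open>(y + 1, x - 1)\<close>.\<close>

lemma r_exchange:
  assumes "x \<in> I" "y \<in> I" "x - 1 \<in> I" "y + 1 \<in> I"
  shows "r x y * f (y + 1) = r (y + 1) (x - 1) * f x"
proof -
  have J: "\<And>z. z \<in> I \<Longrightarrow> z - 1 \<in> I \<Longrightarrow> z \<in> {z \<in> I. wmin < Fin z}"
    using above_wmin_iff by auto
  have "x \<in> {z \<in> I. wmin < Fin z}" "y + 1 \<in> {z \<in> I. wmin < Fin z}" "1 \<in> {z \<in> I. wmin < Fin z}"
    using J[of x] J[of "y + 1"] J[of 1] assms zero_in_spins one_in_spins by auto
  then have "r x (y + 1 - 1) * r (y + 1) (1 - 1) * r 1 (x - 1) = r x (1 - 1) * r 1 (y + 1 - 1) * r (y + 1) (x - 1)"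
    using rates unfolding deposition_rates_def Let_def by blast
  moreover have "r 1 (x - 1) > 0" "r 1 y > 0"
    using assms zero_in_spins one_in_spins by (auto intro!: r_pos)
  ultimately show ?thesis
    unfolding f_rate_def by (simp add: field_simps)
qed

lemma f_pos: "z \<in> I \<Longrightarrow> z - 1 \<in> I \<Longrightarrow> 0 < f z"
  unfolding f_rate_def using f1 zero_in_spins one_in_spins
  by (intro mult_pos_pos divide_pos_pos r_pos) auto

text \<open>In the quotient defining \<open>f\<close>, the numerator grows with \<open>z\<close> and
  the denominator shrinks.\<close>

lemma f_mono:
  assumes "z \<in> I" "z - 1 \<in> I" "z' \<in> I" "z \<le> z'"
  shows "f z \<le> f z'"
proof -
  have "z' - 1 \<in> I"
    using assms spins_convex[of "z - 1" z' "z' - 1"] by auto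
  then show ?thesis
    unfolding f_rate_def using assms f1 zero_in_spins one_in_spins
    by (intro mult_right_mono frac_le r_mono_left r_antimono_right r_pos r_nonneg) auto
qed

lemma f_fact_rec: "z \<in> I \<Longrightarrow> z - 1 \<in> I \<Longrightarrow> f_fact r f1 z = f z * f_fact r f1 (z - 1)"
proof -
  assume z: "z \<in> I" "z - 1 \<in> I"
  consider "1 \<le> z" | "z \<le> 0" by linarith
  then show ?thesis
  proof cases
    case 1
    then have "{1..z} = insert z {1..z - 1}" by auto
    then show ?thesis
      using 1 unfolding f_fact_def by auto
  next
    case 2
    then have "{z - 1 + 1..0} = insert z {z + 1..0}" by auto
    then show ?thesis
      using 2 f_pos[OF z] unfolding f_fact_def by auto
  qed
qed

lemma f_fact_pos: "z \<in> I \<Longrightarrow> 0 < f_fact r f1 z"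
proof -
  assume z: "z \<in> I"
  have "0 < f y" if "y \<in> {1..z}" for y
    using that z zero_in_spins spins_convex[of 0 z] by (intro f_pos) auto
  moreover have "0 < f y" if "y \<in> {z + 1..0}" for y
    using that z zero_in_spins spins_convex[of z 0] by (intro f_pos) auto
  ultimately show ?thesis
    unfolding f_fact_def by (auto intro!: prod_pos)
qed

end

section \<open>The weights, the marginal \<open>q\<close> and its moments\<close>

locale deposition_parameter = deposition +
  fixes \<theta> :: real
  assumes above: "theta_lower wmin r f1 < ereal \<theta>" and below: "ereal \<theta> < theta_upper wmax r f1"
begin

text \<open>Extended by \<open>0\<close> beyond the spins, so that every sum runs over all
  integers.\<close>

definition W :: "int \<Rightarrow> real" where
  "W z = (if z \<in> I then weight r f1 \<theta> z else 0)"

lemma W_nonneg: "0 \<le> W z"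
  unfolding W_def weight_def using f_fact_pos[of z] by (simp add: less_imp_le)

lemma W_pos: "z \<in> I \<Longrightarrow> 0 < W z"
  unfolding W_def weight_def using f_fact_pos[of z] by simp

lemma W_rec: "z \<in> I \<Longrightarrow> z - 1 \<in> I \<Longrightarrow> W z * f z = exp \<theta> * W (z - 1)"
  using f_fact_rec[of z] f_pos[of z] f_fact_pos[of "z - 1"]
  by (simp add: W_def weight_def field_simps flip: exp_add)

text \<open>Consecutive weights have ratio \<open>exp \<theta> / f\<close>. As \<open>f\<close> is
  nondecreasing and \<open>\<theta>\<close> lies below the limit of \<open>ln f\<close>, this ratio
  is eventually bounded by a constant below \<open>1\<close>. With finite \<open>wmax\<close> the
  weights are eventually \<open>0\<close>. The quadratic factor is there for the second moment of a
  spin.\<close>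

lemma summable_W_up: "summable (\<lambda>n. (1 + (real n)\<^sup>2) * W (int n))"
proof (cases wmax)
  case (Fin b)
  have "W (int (Suc n)) \<le> 0 * W (int n)" if "nat b \<le> n" for n
  proof -
    have "int (Suc n) \<notin> I"
      using that unfolding spins_def Fin by auto
    then show ?thesis
      by (simp add: W_def)
  qed
  then show ?thesis
    using W_nonneg by (intro summable_square_times_geometric_decay[of _ 0 "nat b"]) auto
next
  case Pinf
  have I: "int n \<in> I" for n
    using wmin unfolding spins_def Pinf by (cases wmin) auto
  \<comment> \<open>The shift by one avoids \<open>f 0\<close>, whose denominator
    \<open>r 1 (- 1)\<close> is unconstrained when \<open>-1\<close> is not a spin.\<close>
  have "incseq (\<lambda>n. ereal (ln (f (int (Suc n)))))"
  proof (rule incseq_SucI)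
    fix n
    have "0 < f (int (Suc n))" "f (int (Suc n)) \<le> f (int (Suc (Suc n)))"
      using I[of n] I[of "Suc n"] I[of "Suc (Suc n)"] by (auto intro!: f_pos f_mono)
    then show "ereal (ln (f (int (Suc n)))) \<le> ereal (ln (f (int (Suc (Suc n)))))"
      by simp
  qed
  then have "(\<lambda>n. ereal (ln (f (int (Suc n))))) \<longlonglongrightarrow> (SUP n. ereal (ln (f (int (Suc n)))))"
    by (rule LIMSEQ_SUP)
  then have lim: "(\<lambda>n. ereal (ln (f (int n)))) \<longlonglongrightarrow> (SUP n. ereal (ln (f (int (Suc n)))))"
    by (rule LIMSEQ_imp_Suc)
  then have "ereal \<theta> < (SUP n. ereal (ln (f (int (Suc n)))))"
    using below limI[OF lim] unfolding theta_upper_def Pinf by simp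
  then obtain n0 where n0: "\<theta> < ln (f (int (Suc n0)))"
    unfolding less_SUP_iff by auto
  have f0: "0 < f (int (Suc n0))"
    using I[of n0] I[of "Suc n0"] by (intro f_pos) auto
  show ?thesis
  proof (rule summable_square_times_geometric_decay)
    show "exp \<theta> / f (int (Suc n0)) < 1"
      using n0 f0 by (simp add: divide_less_eq) (metis exp_less_cancel_iff exp_ln)
    fix n assume "n0 \<le> n"
    then have "f (int (Suc n0)) \<le> f (int (Suc n))"
      using I[of n0] I[of "Suc n0"] I[of "Suc n"] by (intro f_mono) auto
    then have "W (int (Suc n)) * f (int (Suc n0)) \<le> W (int (Suc n)) * f (int (Suc n))"
      using W_nonneg by (intro mult_left_mono) auto
    also have "\<dots> = exp \<theta> * W (int n)"
      using W_rec[of "int (Suc n)"] I[of n] I[of "Suc n"] by simp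
    finally show "W (int (Suc n)) \<le> exp \<theta> / f (int (Suc n0)) * W (int n)"
      using f0 by (simp add: field_simps)
  qed (rule W_nonneg)
next
  case Minf
  then show ?thesis using wmax by simp
qed

text \<open>Going down, the ratio of consecutive weights is \<open>f (- n) / exp \<theta>\<close>,
  which is nonincreasing in \<open>n\<close> and eventually below \<open>1\<close> because
  \<open>\<theta>\<close> exceeds the limit of \<open>ln f\<close>.\<close>

lemma summable_W_down: "summable (\<lambda>n. (1 + (real n)\<^sup>2) * W (- int n))"
proof (cases wmin)
  case (Fin b)
  have "W (- int (Suc n)) \<le> 0 * W (- int n)" if "nat (- b) \<le> n" for n
  proof -
    have "- int (Suc n) \<notin> I"
      using that unfolding spins_def Fin by auto
    then show ?thesis
      by (simp add: W_def)
  qed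
  then show ?thesis
    using W_nonneg by (intro summable_square_times_geometric_decay[of _ 0 "nat (- b)"]) auto
next
  case Minf
  have I: "- int n \<in> I" for n
    using wmax unfolding spins_def Minf by (cases wmax) auto
  have I1_eq: "- int n - 1 = - int (Suc n)" for n
    by simp
  have I1: "- int n - 1 \<in> I" for n
    by (simp only: I1_eq I)
  have step: "0 < f (- int n)" "m \<le> n \<Longrightarrow> f (- int n) \<le> f (- int m)" for n m
    using I[of n] I[of m] I1[of n] by (auto intro!: f_pos f_mono)
  have "decseq (\<lambda>n. ereal (ln (f (- int n))))"
    using step by (intro decseq_SucI) (simp add: step del: of_nat_Suc)
  then have lim: "(\<lambda>n. ereal (ln (f (- int n)))) \<longlonglongrightarrow> (INF n. ereal (ln (f (- int n))))"
    by (rule LIMSEQ_INF)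
  then have "(INF n. ereal (ln (f (- int n)))) < ereal \<theta>"
    using above limI[OF lim] unfolding theta_lower_def Minf by simp
  then obtain n0 where n0: "ln (f (- int n0)) < \<theta>"
    unfolding INF_less_iff by auto
  show ?thesis
  proof (rule summable_square_times_geometric_decay)
    show "f (- int n0) / exp \<theta> < 1"
      using n0 step(1)[of n0] by (simp add: divide_less_eq) (metis exp_less_cancel_iff exp_ln)
    fix n assume "n0 \<le> n"
    have "exp \<theta> * W (- int (Suc n)) = W (- int n) * f (- int n)"
      using W_rec[OF I I1, of n] unfolding I1_eq by simp
    also have "\<dots> \<le> W (- int n) * f (- int n0)"
      using W_nonneg step(2)[OF \<open>n0 \<le> n\<close>] by (intro mult_left_mono) auto
    finally show "W (- int (Suc n)) \<le> f (- int n0) / exp \<theta> * W (- int n)"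
      by (simp add: field_simps)
  qed (rule W_nonneg)
next
  case Pinf
  then show ?thesis using wmin by simp
qed

lemma W_square_summable: "(\<lambda>z. (1 + (of_int z)\<^sup>2) * W z) summable_on UNIV"
proof -
  have "(\<lambda>z. (1 + (of_int z)\<^sup>2) * W z) summable_on range int"
    using summable_W_up W_nonneg
    by (subst summable_on_reindex) (auto simp: o_def summable_on_UNIV_nonneg_real_iff)
  moreover have "(\<lambda>z. (1 + (of_int z)\<^sup>2) * W z) summable_on range (\<lambda>n. - int n)"
    using summable_W_down W_nonneg
    by (subst summable_on_reindex) (auto simp: o_def inj_def summable_on_UNIV_nonneg_real_iff)
  ultimately have "(\<lambda>z. (1 + (of_int z)\<^sup>2) * W z) summable_on (range int \<union> range (\<lambda>n. - int n))"
    by (rule summable_on_union)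
  moreover have "range int \<union> range (\<lambda>n. - int n) = UNIV"
  proof (intro set_eqI iffI UNIV_I)
    fix z :: int
    have "z = int (nat z) \<or> z = - int (nat (- z))"
      by linarith
    then show "z \<in> range int \<union> range (\<lambda>n. - int n)"
      by (metis UnCI rangeI)
  qed
  ultimately show ?thesis by simp
qed

lemma W_summable: "W summable_on UNIV"
  using W_nonneg by (intro summable_on_comparison_test[OF W_square_summable]) (auto simp: algebra_simps)

lemma partition_fn_eq: "partition_fn wmin wmax r f1 \<theta> = (\<Sum>\<^sub>\<infinity>z. W z)"
  unfolding partition_fn_def by (rule infsum_cong_neutral) (auto simp: W_def)

abbreviation "Z \<equiv> partition_fn wmin wmax r f1 \<theta>"

lemma Z_pos: "0 < Z"
proof -
  have "W 0 \<le> (\<Sum>\<^sub>\<infinity>z. W z)"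
    using infsum_mono2[OF _ W_summable, of "{0}"] W_nonneg by auto
  then show ?thesis
    using W_pos[OF zero_in_spins] by (simp add: partition_fn_eq)
qed

definition q :: "int pmf" where
  "q = embed_pmf (\<lambda>z. W z / Z)"

lemma integrable_W: "integrable (count_space UNIV) W"
  by (rule summable_on_imp_integrable_count_space(1)[OF W_summable])

lemma pmf_q: "pmf q z = W z / Z"
proof -
  have "(\<integral>\<^sup>+z. ennreal (W z / Z) \<partial>count_space UNIV) = ennreal (\<integral>z. W z / Z \<partial>count_space UNIV)"
    using integrable_W W_nonneg Z_pos by (intro nn_integral_eq_integral) auto
  also have "(\<integral>z. W z / Z \<partial>count_space UNIV) = (\<integral>z. W z \<partial>count_space UNIV) / Z"
    by simp
  also have "(\<integral>z. W z \<partial>count_space UNIV) = Z"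
    unfolding partition_fn_eq by (rule summable_on_imp_integrable_count_space(2)[OF W_summable])
  finally have "(\<integral>\<^sup>+z. ennreal (W z / Z) \<partial>count_space UNIV) = 1"
    using Z_pos by simp
  then show ?thesis
    unfolding q_def using W_nonneg Z_pos by (intro pmf_embed_pmf) auto
qed

lemma marginal_eq: "marginal wmin wmax r f1 \<theta> = measure_pmf q"
  unfolding marginal_def measure_pmf_eq_density by (intro arg_cong2[where f = density] ext refl) (auto simp: pmf_q W_def)

lemma q_spins: "pmf q z = 0" if "z \<notin> I"
  using that by (simp add: pmf_q W_def)

lemma q_rec: "z \<in> I \<Longrightarrow> z - 1 \<in> I \<Longrightarrow> pmf q z * f z = exp \<theta> * pmf q (z - 1)"
  using W_rec[of z] by (simp add: pmf_q field_simps)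

lemma q_square_integrable: "integrable (measure_pmf q) (\<lambda>z. (of_int z :: real)\<^sup>2)"
proof -
  have "(\<lambda>z. W z * (of_int z)\<^sup>2) summable_on UNIV"
    using W_nonneg by (intro summable_on_comparison_test[OF W_square_summable]) (auto simp: algebra_simps)
  then have "integrable (count_space UNIV) (\<lambda>z. W z * (of_int z)\<^sup>2)"
    by (rule summable_on_imp_integrable_count_space(1))
  then have "integrable (count_space UNIV) (\<lambda>z. W z * (of_int z)\<^sup>2 / Z)"
    by simp
  then have "integrable (count_space UNIV) (\<lambda>z. pmf q z *\<^sub>R (of_int z :: real)\<^sup>2)"
    by (simp add: pmf_q)
  then show ?thesis
    by (simp add: measure_pmf_eq_density integrable_density)
qed

text \<open>Only the first moment of the rate is available: for zero range rates \<open>r x y = f x\<close>, the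
  second moment is infinite when \<open>f\<close> grows fast enough. The exchange relation reduces
  \<open>x \<ge> y + 2\<close> to \<open>x \<le> y + 1\<close>.\<close>

lemma q_r_bound:
  "\<exists>C\<ge>0. \<forall>x y. pmf q x * pmf q y * r x y \<le>
    C * ((pmf q (x - 1) + pmf q x + pmf q (x + 1)) * (pmf q (y - 1) + pmf q y + pmf q (y + 1)))"
proof -
  \<comment> \<open>One summand per region below: \<open>r 0 0\<close> where
    \<open>x \<le> 0 \<le> y\<close>, \<open>r 1 0 / f1\<close> where \<open>x \<ge> 1\<close> and
    \<open>y \<ge> 0\<close>, and \<open>r 0 (- 1) * f 0\<close> where \<open>y < 0\<close>. The
    absolute value covers the case that \<open>-1\<close> is not a spin and the product has no known
    sign.\<close>
  define C0 where "C0 = r 0 0 + r 1 0 / f1 + \<bar>r 0 (- 1) * f 0\<bar>"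
  \<comment> \<open>The exponentials pay for moving \<open>q\<close> by one unit through
    \<open>q_rec\<close>.\<close>
  define C where "C = C0 * (1 + exp \<theta> + exp (- \<theta>))"
  note 01 = zero_in_spins one_in_spins
  have nn: "0 \<le> r 0 0" "0 \<le> r 1 0 / f1"
    using 01 f1 r_nonneg by auto
  have C0: "0 \<le> C0"
    unfolding C0_def using nn by simp
  have C: "0 \<le> C" "C0 \<le> C" "C0 * exp \<theta> \<le> C" "C0 * exp (- \<theta>) \<le> C"
    unfolding C_def using C0 by (simp_all add: distrib_left)
  let ?q = "pmf q"
  have low: "?q x * ?q y * r x y \<le> C * (?q x * ?q y + ?q (x - 1) * ?q y + ?q x * ?q (y + 1))"
    if I: "x \<in> I" "y \<in> I" "x - 1 \<in> I" "y + 1 \<in> I" and xy: "x \<le> y + 1" for x y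
  proof -
    have n3: "0 \<le> C * (?q x * ?q y)" "0 \<le> C * (?q (x - 1) * ?q y)" "0 \<le> C * (?q x * ?q (y + 1))"
      using C by auto
    have *: "a \<le> C * (?q x * ?q y + ?q (x - 1) * ?q y + ?q x * ?q (y + 1))"
      if "a \<le> C * (?q x * ?q y) \<or> a \<le> C * (?q (x - 1) * ?q y) \<or> a \<le> C * (?q x * ?q (y + 1))" for a
      using that n3 by (auto simp: distrib_left)
    \<comment> \<open>In the first region the rate is at most a constant times \<open>f x\<close>,
      and \<open>q x * f x\<close> is a multiple of \<open>q (x - 1)\<close>. In the second it is
      bounded. In the third \<open>x \<le> 0\<close>, so the rate is at most \<open>r 0 y\<close>,
      which the exchange relation bounds by a constant over \<open>f (y + 1)\<close>;
      \<open>q y / f (y + 1)\<close> is a multiple of \<open>q (y + 1)\<close>.\<close>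
    consider "0 \<le> y" "1 \<le> x" | "0 \<le> y" "x \<le> 0" | "y < 0" by linarith
    then show ?thesis
    proof cases
      case 1
      have "x - 1 \<in> I" using I by simp
      have p: "0 < r 1 (x - 1)" using I 01 by (intro r_pos) auto
      have "r x y \<le> r x 0" using I 01 1 by (intro r_antimono_right) auto
      also have "r x 0 = f x * (r 1 (x - 1) / f1)"
        unfolding f_rate_def using p f1 by simp
      also have "\<dots> \<le> f x * (r 1 0 / f1)"
        using I 01 1 f1 by (intro mult_left_mono divide_right_mono r_antimono_right less_imp_le[OF f_pos]) auto
      also have "\<dots> \<le> f x * C0"
        unfolding C0_def using nn f_pos[of x] I by (intro mult_left_mono) auto
      finally have "?q x * ?q y * r x y \<le> ?q x * ?q y * (f x * C0)"
        by (intro mult_left_mono) auto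
      also have "\<dots> = (C0 * exp \<theta>) * (?q (x - 1) * ?q y)"
        using q_rec[of x] I by (simp add: algebra_simps)
      also have "\<dots> \<le> C * (?q (x - 1) * ?q y)"
        using C by (intro mult_right_mono) auto
      finally show ?thesis by (intro *) simp
    next
      case 2
      have "r x y \<le> r 0 y" using I 01 2 by (intro r_mono_left) auto
      also have "\<dots> \<le> r 0 0" using I 01 2 by (intro r_antimono_right) auto
      also have "\<dots> \<le> C" using nn C(2) unfolding C0_def by linarith
      finally have "?q x * ?q y * r x y \<le> ?q x * ?q y * C"
        by (intro mult_left_mono) auto
      then show ?thesis by (intro *) (simp add: mult_ac)
    next
      case 3
      have m1: "- 1 \<in> I" using I 3 01 spins_convex[of y 0 "-1"] by auto
      have fy: "0 < f (y + 1)" using I by (intro f_pos) auto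
      have "r x y \<le> r 0 y" using I 01 3 xy by (intro r_mono_left) auto
      also have "r 0 y = r (y + 1) (- 1) * f 0 / f (y + 1)"
        using r_exchange[of 0 y] I 01 m1 fy by (simp add: field_simps)
      also have "\<dots> \<le> r 0 (- 1) * f 0 / f (y + 1)"
        using I 01 m1 fy 3 by (intro divide_right_mono mult_right_mono r_mono_left less_imp_le[OF f_pos]) auto
      also have "\<dots> \<le> C0 / f (y + 1)"
        unfolding C0_def using nn fy by (intro divide_right_mono) auto
      finally have "?q x * ?q y * r x y \<le> ?q x * ?q y * (C0 / f (y + 1))"
        by (intro mult_left_mono) auto
      also have "\<dots> = C0 * ?q x * (?q y / f (y + 1))"
        by simp
      also have "?q y / f (y + 1) = exp (- \<theta>) * ?q (y + 1)"
        using q_rec[of "y + 1"] I fy by (simp add: field_simps exp_minus)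
      also have "C0 * ?q x * (exp (- \<theta>) * ?q (y + 1)) = (C0 * exp (- \<theta>)) * (?q x * ?q (y + 1))"
        by (simp only: mult_ac)
      also have "\<dots> \<le> C * (?q x * ?q (y + 1))"
        using C by (intro mult_right_mono) auto
      finally show ?thesis by (intro *) simp
    qed
  qed
  have "?q x * ?q y * r x y \<le> C * ((?q (x - 1) + ?q x + ?q (x + 1)) * (?q (y - 1) + ?q y + ?q (y + 1)))" for x y
  proof (cases "x \<in> I \<and> y \<in> I \<and> x - 1 \<in> I \<and> y + 1 \<in> I")
    case False
    then have "?q x * ?q y * r x y = 0"
      using q_spins r_zero_iff[of x y] by (cases "x \<in> I"; cases "y \<in> I") auto
    moreover have "0 \<le> C * ((?q (x - 1) + ?q x + ?q (x + 1)) * (?q (y - 1) + ?q y + ?q (y + 1)))"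
      using C by (intro mult_nonneg_nonneg add_nonneg_nonneg) auto
    ultimately show ?thesis by linarith
  next
    case I: True
    have expand: "?q x * ?q y + ?q (x - 1) * ?q y + ?q x * ?q (y + 1) \<le> (?q (x - 1) + ?q x + ?q (x + 1)) * (?q (y - 1) + ?q y + ?q (y + 1))"
      "?q (y + 1) * ?q (x - 1) + ?q y * ?q (x - 1) + ?q (y + 1) * ?q x \<le> (?q (x - 1) + ?q x + ?q (x + 1)) * (?q (y - 1) + ?q y + ?q (y + 1))"
      by (simp_all add: distrib_left distrib_right mult.commute add_increasing add_increasing2)
    show ?thesis
    proof (cases "x \<le> y + 1")
      case True
      have "?q x * ?q y * r x y \<le> C * (?q x * ?q y + ?q (x - 1) * ?q y + ?q x * ?q (y + 1))"
        using low I True by auto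
      also have "\<dots> \<le> C * ((?q (x - 1) + ?q x + ?q (x + 1)) * (?q (y - 1) + ?q y + ?q (y + 1)))"
        using expand C by (intro mult_left_mono) auto
      finally show ?thesis .
    next
      case False
      have fx: "0 < f x" "0 < f (y + 1)"
        using I by (auto intro!: f_pos)
      have "?q x = exp \<theta> * ?q (x - 1) / f x"
        using q_rec[of x] I fx by (simp add: field_simps)
      moreover have "?q y = ?q (y + 1) * f (y + 1) / exp \<theta>"
        using q_rec[of "y + 1"] I by (simp add: field_simps)
      moreover have "r x y = r (y + 1) (x - 1) * f x / f (y + 1)"
        using r_exchange[of x y] I fx by (simp add: field_simps)
      ultimately have "?q x * ?q y * r x y = ?q (y + 1) * ?q (x - 1) * r (y + 1) (x - 1)"
        using fx by simp
      also have "\<dots> \<le> C * (?q (y + 1) * ?q (x - 1) + ?q (y + 1 - 1) * ?q (x - 1) + ?q (y + 1) * ?q (x - 1 + 1))"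
        using low[of "y + 1" "x - 1"] I False by auto
      also have "\<dots> \<le> C * ((?q (x - 1) + ?q x + ?q (x + 1)) * (?q (y - 1) + ?q y + ?q (y + 1)))"
        using expand C by (intro mult_left_mono) auto
      finally show ?thesis .
    qed
  qed
  then show ?thesis using C by blast
qed

text \<open>The bound of \<open>q_r_bound\<close> is a product of a function of \<open>x\<close> and
  the same function of \<open>y\<close>, each of total mass three by translation invariance of
  counting measure.\<close>

lemma q_r_integrable: "(\<integral>\<^sup>+x. \<integral>\<^sup>+y. ennreal (r x y) \<partial>measure_pmf q \<partial>measure_pmf q) < \<infinity>"
proof -
  obtain C where C: "0 \<le> C" "\<And>x y. pmf q x * pmf q y * r x y \<le>
    C * ((pmf q (x - 1) + pmf q x + pmf q (x + 1)) * (pmf q (y - 1) + pmf q y + pmf q (y + 1)))"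
    using q_r_bound by blast
  define S where "S x = ennreal (pmf q (x - 1) + pmf q x + pmf q (x + 1))" for x
  have shift: "(\<integral>\<^sup>+x. ennreal (pmf q (x + a)) \<partial>count_space UNIV) = 1" for a
  proof -
    have "bij_betw (\<lambda>x. x + a) (UNIV :: int set) UNIV"
      by (rule bij_betwI[of _ _ _ "\<lambda>x. x - a"]) auto
    then have "(\<integral>\<^sup>+x. ennreal (pmf q (x + a)) \<partial>count_space UNIV) = (\<integral>\<^sup>+x. ennreal (pmf q x) \<partial>count_space UNIV)"
      by (rule nn_integral_bij_count_space)
    then show ?thesis
      by (simp add: nn_integral_pmf)
  qed
  have S: "(\<integral>\<^sup>+x. S x \<partial>count_space UNIV) = 3"
    using shift[of "-1"] shift[of 0] shift[of 1] unfolding S_def by (simp add: nn_integral_add)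
  have "(\<integral>\<^sup>+x. \<integral>\<^sup>+y. ennreal (r x y) \<partial>measure_pmf q \<partial>measure_pmf q)
    = (\<integral>\<^sup>+x. \<integral>\<^sup>+y. ennreal (pmf q x * pmf q y * r x y) \<partial>count_space UNIV \<partial>count_space UNIV)"
    by (simp add: nn_integral_measure_pmf ennreal_mult' mult.assoc nn_integral_cmult)
  also have "\<dots> \<le> (\<integral>\<^sup>+x. \<integral>\<^sup>+y. ennreal C * (S x * S y) \<partial>count_space UNIV \<partial>count_space UNIV)"
  proof (intro nn_integral_mono)
    fix x y
    have "ennreal (pmf q x * pmf q y * r x y) \<le>
      ennreal (C * ((pmf q (x - 1) + pmf q x + pmf q (x + 1)) * (pmf q (y - 1) + pmf q y + pmf q (y + 1))))"
      using C(2) by (rule ennreal_leI)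
    also have "\<dots> = ennreal C * (S x * S y)"
      unfolding S_def by (simp only: ennreal_mult C(1) mult_nonneg_nonneg add_nonneg_nonneg pmf_nonneg)
    finally show "ennreal (pmf q x * pmf q y * r x y) \<le> ennreal C * (S x * S y)" .
  qed
  also have "\<dots> = ennreal C * (3 * 3)"
    by (simp add: nn_integral_cmult nn_integral_multc S)
  also have "\<dots> < \<infinity>"
    by (simp add: ennreal_mult_less_top)
  finally show ?thesis .
qed

end

section \<open>Paths\<close>

text \<open>Excludes simultaneous jumps. The sitewise left limit at a time is unique, and
  \<open>jump i\<close> lowers the spin at \<open>i\<close> and no other.\<close>

lemma jumps_at_unique:
  assumes "jumps_at x i u" "jumps_at x j u"
  shows "i = j"
proof -
  obtain \<eta> where \<eta>: "\<And>k. eventually (\<lambda>s. x s k = \<eta> k) (at_left u)" "x u = jump i \<eta>"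
    using assms(1) unfolding jumps_at_def by blast
  obtain \<zeta> where \<zeta>: "\<And>k. eventually (\<lambda>s. x s k = \<zeta> k) (at_left u)" "x u = jump j \<zeta>"
    using assms(2) unfolding jumps_at_def by blast
  have "\<eta> = \<zeta>"
  proof
    fix k
    have "eventually (\<lambda>s. \<eta> k = \<zeta> k) (at_left u)"
      using \<eta>(1)[of k] \<zeta>(1)[of k] by eventually_elim auto
    then show "\<eta> k = \<zeta> k"
      by (simp add: eventually_const_iff)
  qed
  then have eq: "jump i \<eta> = jump j \<eta>"
    using \<eta>(2) \<zeta>(2) by simp
  then have "jump i \<eta> i = jump j \<eta> i" by simp
  then show ?thesis
    unfolding jump_def by (auto split: if_splits)
qed

text \<open>A test on two sites, hence a cylinder function of the second configuration to which
  Dynkin's formula applies. It can be fooled by several jumps at the bonds \<open>i - 1\<close>,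
  \<open>i\<close>, \<open>i + 1\<close> between the two observations.\<close>

definition bond_jump :: "int \<Rightarrow> config \<Rightarrow> config \<Rightarrow> bool" where
  "bond_jump i \<eta> \<zeta> \<longleftrightarrow> \<zeta> i = \<eta> i - 1 \<and> \<zeta> (i + 1) = \<eta> (i + 1) + 1"

text \<open>The mesh is \<open>1 / Suc q\<close> and the ends \<open>a\<close>, \<open>b\<close> are
  integer times, so that they are grid points for every mesh.\<close>

definition grid_count :: "(real \<Rightarrow> config) \<Rightarrow> int \<Rightarrow> nat \<Rightarrow> nat \<Rightarrow> nat \<Rightarrow> nat" where
  "grid_count x i q a b = (\<Sum>k\<in>{a * Suc q..<b * Suc q}. of_bool (bond_jump i (x (real k / real (Suc q))) (x (real (Suc k) / real (Suc q)))))"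

lemma jump_times_mono: "s \<le> t \<Longrightarrow> jump_times x i s \<subseteq> jump_times x i t"
  unfolding jump_times_def by auto

lemma jump_times_diff:
  "0 \<le> s \<Longrightarrow> s \<le> t \<Longrightarrow> jump_times x i t - jump_times x i s = {u. s < u \<and> u \<le> t \<and> jumps_at x i u}"
  unfolding jump_times_def by auto

context
  fixes x :: "real \<Rightarrow> config" and h :: "real \<Rightarrow> int \<Rightarrow> int"
  assumes heights: "heights_of x h"
begin

lemma heights_finite: "0 \<le> t \<Longrightarrow> finite (jump_times x i t)"
  and heights_spin: "0 \<le> t \<Longrightarrow> x t i = h t (i - 1) - h t i"
  and heights_count: "0 \<le> t \<Longrightarrow> h t i = h 0 i + int (card (jump_times x i t))"
  using heights unfolding heights_of_def by blast+

lemma heights_increment: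
  assumes "0 \<le> s" "s \<le> t"
  shows "h t i = h s i + int (card {u. s < u \<and> u \<le> t \<and> jumps_at x i u})"
proof -
  have "card (jump_times x i t - jump_times x i s) = card (jump_times x i t) - card (jump_times x i s)"
    using assms heights_finite by (intro card_Diff_subset jump_times_mono) auto
  moreover have "card (jump_times x i s) \<le> card (jump_times x i t)"
    using assms heights_finite by (intro card_mono jump_times_mono) auto
  ultimately show ?thesis
    using assms heights_count[of s i] heights_count[of t i] by (simp add: jump_times_diff)
qed

lemma heights_mono: "0 \<le> s \<Longrightarrow> s \<le> t \<Longrightarrow> h s i \<le> h t i"
  using heights_increment[of s t i] by simp

text \<open>The spin at \<open>i\<close> is changed by jumps at the bonds \<open>i - 1\<close> and
  \<open>i\<close> alone, and these have finitely many jump times up to time \<open>1\<close>. This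
  supplies the right-continuity at \<open>0\<close> used to estimate short-time errors.\<close>

lemma heights_constant_near_0:
  assumes "finite A"
  shows "\<exists>\<epsilon>>0. \<forall>s\<in>{0..<\<epsilon>}. \<forall>i\<in>A. x s i = x 0 i"
proof -
  let ?U = "\<Union>i\<in>A. jump_times x i 1 \<union> jump_times x (i - 1) 1"
  define \<epsilon> where "\<epsilon> = Min (insert 1 ?U)"
  have U: "finite ?U"
    using assms heights_finite[of 1] by auto
  have pos: "\<epsilon> > 0" "\<epsilon> \<le> 1"
    unfolding \<epsilon>_def using U by (auto simp: jump_times_def)
  have "x s i = x 0 i" if s: "s \<in> {0..<\<epsilon>}" and i: "i \<in> A" for s i
  proof -
    have "h s j = h 0 j" if j: "j = i \<or> j = i - 1" for j
    proof -
      have "\<not> (0 < u \<and> u \<le> s \<and> jumps_at x j u)" for u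
      proof
        assume u: "0 < u \<and> u \<le> s \<and> jumps_at x j u"
        then have "u \<in> insert 1 ?U"
          using s i j pos unfolding jump_times_def by auto
        then have "\<epsilon> \<le> u"
          unfolding \<epsilon>_def using U by (intro Min_le) auto
        then show False using u s by auto
      qed
      then have "{u. 0 < u \<and> u \<le> s \<and> jumps_at x j u} = {}"
        by blast
      then show ?thesis
        using heights_increment[of 0 s j] s by (simp only:) simp
    qed
    then have "h s i = h 0 i" "h s (i - 1) = h 0 (i - 1)"
      by auto
    then show ?thesis
      using heights_spin[of s i] heights_spin[of 0 i] s by auto
  qed
  then show ?thesis using pos by blast
qed

text \<open>The spin at \<open>i\<close> changes by the count of bond \<open>i - 1\<close> minus
  that of bond \<open>i\<close>, and the spin at \<open>i + 1\<close> by the count of bond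
  \<open>i\<close> minus that of bond \<open>i + 1\<close>. If at most one of the three bonds jumps,
  and at most once, the pattern \<open>-1\<close>, \<open>+1\<close> arises from bond
  \<open>i\<close> alone.\<close>

lemma bond_jump_iff_single_jump:
  assumes "0 \<le> s" "s \<le> t"
    and single: "\<And>u v j k. j \<in> {i - 1..i + 1} \<Longrightarrow> k \<in> {i - 1..i + 1} \<Longrightarrow> u \<in> {s<..t} \<Longrightarrow> v \<in> {s<..t} \<Longrightarrow>
      jumps_at x j u \<Longrightarrow> jumps_at x k v \<Longrightarrow> u = v"
  shows "h t i - h s i = of_bool (bond_jump i (x s) (x t))"
proof -
  define N where "N j = {u. s < u \<and> u \<le> t \<and> jumps_at x j u}" for j
  have fin: "finite (N j)" for j
    using jump_times_diff[OF assms(1,2), of x j] heights_finite[of t j] assms unfolding N_def by (metis finite_Diff order_trans)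
  have le1: "card (N j) \<le> 1" if "j \<in> {i - 1..i + 1}" for j
    unfolding One_nat_def card_le_Suc0_iff_eq[OF fin] using single[of j j] that unfolding N_def by auto
  have excl: "card (N j) = 0 \<or> card (N k) = 0" if "j \<in> {i - 1..i + 1}" "k \<in> {i - 1..i + 1}" "j \<noteq> k" for j k
  proof (rule ccontr)
    assume "\<not> ?thesis"
    then obtain u v where "u \<in> N j" "v \<in> N k"
      using fin by fastforce
    moreover from this have "u = v"
      using single[of j k u v] that unfolding N_def by auto
    ultimately show False
      using jumps_at_unique that unfolding N_def by auto
  qed
  have inc: "h t j = h s j + int (card (N j))" for j
    unfolding N_def by (rule heights_increment[OF assms(1,2)])
  have "x t i = x s i + int (card (N (i - 1))) - int (card (N i))"
    "x t (i + 1) = x s (i + 1) + int (card (N i)) - int (card (N (i + 1)))"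
    using heights_spin assms inc by (auto simp: add.commute)
  then have "bond_jump i (x s) (x t) \<longleftrightarrow> card (N i) = 1"
    using le1[of i] le1[of "i - 1"] le1[of "i + 1"] excl[of i "i - 1"] excl[of i "i + 1"] excl[of "i - 1" "i + 1"]
    unfolding bond_jump_def by auto
  then show ?thesis
    using inc[of i] le1[of i] by (auto simp: of_bool_def)
qed

text \<open>A sufficiently fine grid separates the finitely many jump times of three neighbouring bonds.\<close>

lemma eventually_grid_count:
  assumes "a \<le> b"
  shows "eventually (\<lambda>q. int (grid_count x i q a b) = h (real b) i - h (real a) i) sequentially"
proof -
  define U where "U = (\<Union>j\<in>{i - 1..i + 1}. jump_times x j (real b))"
  have U: "finite U"
    unfolding U_def using heights_finite by auto
  \<comment> \<open>The smallest distance between distinct jump times; removing \<open>0\<close>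
    discards the diagonal, and \<open>1\<close> is the value when nothing else remains.\<close>
  define d where "d = Min (insert 1 ((\<lambda>(u, v). \<bar>u - v\<bar>) ` (U \<times> U) - {0}))"
  have d: "0 < d"
    unfolding d_def using U by (subst Min_gr_iff) (auto simp: abs_real_def)
  have sep: "u = v" if "u \<in> U" "v \<in> U" "\<bar>u - v\<bar> < d" for u v
  proof (rule ccontr)
    assume "u \<noteq> v"
    then have "\<bar>u - v\<bar> \<in> insert 1 ((\<lambda>(u, v). \<bar>u - v\<bar>) ` (U \<times> U) - {0})"
      using that by force
    then have "d \<le> \<bar>u - v\<bar>"
      unfolding d_def using U by (intro Min_le) auto
    then show False using that by simp
  qed
  obtain q0 :: nat where q0: "1 / d < real q0"
    using reals_Archimedean2 by blast
  have "int (grid_count x i q a b) = h (real b) i - h (real a) i" if "q0 \<le> q" for q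
  proof -
    define t where "t k = real k / real (Suc q)" for k
    have step: "t (Suc k) - t k < d" for k
    proof -
      have "1 / d < real (Suc q)"
        using q0 that by linarith
      then have "1 / real (Suc q) < d"
        using d by (simp add: divide_less_eq mult.commute)
      moreover have "t (Suc k) - t k = 1 / real (Suc q)"
        unfolding t_def diff_divide_distrib[symmetric] by simp
      ultimately show ?thesis by simp
    qed
    have t_nat: "real (c * Suc q) / real (Suc q) = real c" for c
      by (simp only: of_nat_mult) simp
    have mono: "0 \<le> t k" "t k \<le> t (Suc k)" for k
      unfolding t_def by (simp_all add: divide_right_mono)
    have inc: "h (t (Suc k)) i - h (t k) i = of_bool (bond_jump i (x (t k)) (x (t (Suc k))))"
      if k: "k < b * Suc q" for k
    proof (rule bond_jump_iff_single_jump[OF mono])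
      fix u v j l
      assume *: "j \<in> {i - 1..i + 1}" "l \<in> {i - 1..i + 1}" "u \<in> {t k<..t (Suc k)}" "v \<in> {t k<..t (Suc k)}"
        "jumps_at x j u" "jumps_at x l v"
      have "real (Suc k) \<le> real (b * Suc q)"
        using k by (simp only: of_nat_le_iff Suc_le_eq)
      then have "t (Suc k) \<le> real (b * Suc q) / real (Suc q)"
        unfolding t_def by (rule divide_right_mono) simp
      then have "t (Suc k) \<le> real b"
        by (simp only: t_nat)
      then have "u \<in> U" "v \<in> U"
        unfolding U_def jump_times_def using * mono(1)[of k] by force+
      moreover have "\<bar>u - v\<bar> < d"
        using * step[of k] by auto
      ultimately show "u = v" by (rule sep)
    qed
    have "int (grid_count x i q a b) = (\<Sum>k\<in>{a * Suc q..<b * Suc q}. h (t (Suc k)) i - h (t k) i)"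
      unfolding grid_count_def t_def[symmetric] by (simp add: inc)
    also have "\<dots> = h (t (b * Suc q)) i - h (t (a * Suc q)) i"
      using assms by (intro sum_Suc_diff') (rule mult_le_mono1)
    finally show ?thesis
      unfolding t_def t_nat .
  qed
  then show ?thesis
    by (auto simp: eventually_sequentially)
qed

end

section \<open>The stationary Markov process\<close>

lemma space_config_space: "space config_space = UNIV"
  unfolding config_space_def by (simp add: space_PiM)

locale stationary_deposition = deposition_parameter +
  fixes T :: "config set" and K :: "real \<Rightarrow> config \<Rightarrow> config measure"
    and M :: "'w measure" and X :: "real \<Rightarrow> 'w \<Rightarrow> config" and h :: "real \<Rightarrow> 'w \<Rightarrow> int \<Rightarrow> int"
  assumes dynamics: "tempered_dynamics wmin wmax r f1 T K"
    and markov: "markov_process T K M X"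
    and initial: "distr M (tempered_space T) (X 0) = restrict_space (product_law wmin wmax r f1 \<theta>) T"
    and h_measurable: "\<And>t i. 0 \<le> t \<Longrightarrow> (\<lambda>w. h t w i) \<in> M \<rightarrow>\<^sub>M count_space UNIV"
    and heights: "AE w in M. heights_of (\<lambda>t. X t w) (\<lambda>t. h t w)"
begin

abbreviation "S \<equiv> tempered_space T"
abbreviation "\<nu> \<equiv> product_law wmin wmax r f1 \<theta>"

sublocale prob_space M
  using markov unfolding markov_process_def by simp

lemma T_sets: "T \<in> sets config_space"
  and T_subset: "T \<subseteq> configs wmin wmax"
  and semigroup: "markov_semigroup T K"
  and gen: "has_generator r T K"
  and T_full: "emeasure \<nu> T = 1"
  and stationary_law: "0 \<le> t \<Longrightarrow> restrict_space \<nu> T \<bind> K t = restrict_space \<nu> T"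
  using dynamics above below unfolding tempered_dynamics_def by blast+

lemma space_S: "space S = T"
  unfolding tempered_space_def by (simp add: space_restrict_space space_config_space)

lemma X_measurable [measurable (raw)]: "0 \<le> t \<Longrightarrow> X t \<in> M \<rightarrow>\<^sub>M S"
  using markov unfolding markov_process_def by auto

lemma X_in_T: "0 \<le> t \<Longrightarrow> w \<in> space M \<Longrightarrow> X t w \<in> T"
  using measurable_space[OF X_measurable] space_S by auto

lemma measurable_S_config: "(\<lambda>\<eta>. \<eta>) \<in> S \<rightarrow>\<^sub>M config_space"
  unfolding tempered_space_def by (rule measurable_restrict_space1) simp

lemma measurable_S_coordinate [measurable]: "(\<lambda>\<eta>. \<eta> i) \<in> S \<rightarrow>\<^sub>M count_space UNIV"
  using measurable_compose[OF measurable_S_config[unfolded config_space_def] measurable_component_singleton[OF UNIV_I]] .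

lemma K_jointly_measurable:
  "(\<lambda>p. K (fst p) (snd p)) \<in> restrict_space borel {0..} \<Otimes>\<^sub>M S \<rightarrow>\<^sub>M subprob_algebra S"
  using semigroup unfolding markov_semigroup_def case_prod_beta by (auto intro: measurable_prob_algebraD)

lemma K_measurable [measurable (raw)]: "0 \<le> t \<Longrightarrow> K t \<in> S \<rightarrow>\<^sub>M subprob_algebra S"
proof -
  assume "0 \<le> t"
  then have "Pair t \<in> S \<rightarrow>\<^sub>M restrict_space borel {0..} \<Otimes>\<^sub>M S"
    by (intro measurable_Pair1') (simp add: space_restrict_space)
  from measurable_compose[OF this K_jointly_measurable] show ?thesis
    by simp
qed

lemma K_prob: "0 \<le> t \<Longrightarrow> \<eta> \<in> T \<Longrightarrow> prob_space (K t \<eta>)" and sets_K: "0 \<le> t \<Longrightarrow> \<eta> \<in> T \<Longrightarrow> sets (K t \<eta>) = sets S"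
proof -
  assume "0 \<le> t" "\<eta> \<in> T"
  then have "(t, \<eta>) \<in> space (restrict_space borel {0..} \<Otimes>\<^sub>M S)"
    by (simp add: space_pair_measure space_restrict_space space_S)
  then have "K t \<eta> \<in> space (prob_algebra S)"
    using measurable_space[OF conjunct1[OF semigroup[unfolded markov_semigroup_def]]] by fastforce
  then show "prob_space (K t \<eta>)" "sets (K t \<eta>) = sets S"
    by (auto simp: space_prob_algebra)
qed

lemma space_K: "0 \<le> t \<Longrightarrow> \<eta> \<in> T \<Longrightarrow> space (K t \<eta>) = T"
  using sets_eq_imp_space_eq[OF sets_K] space_S by simp

section \<open>The past of the process and the Markov property\<close>

lemma past_generators: "0 \<le> s \<Longrightarrow> (\<Union>u\<in>{0..s}. (\<lambda>A. X u -` A \<inter> space M) ` sets S) \<subseteq> sets M"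
  using X_measurable by (auto intro: measurable_sets)

lemma sets_past: "0 \<le> s \<Longrightarrow> sets (past M T X s) = sigma_sets (space M) (\<Union>u\<in>{0..s}. (\<lambda>A. X u -` A \<inter> space M) ` sets S)"
  unfolding past_def by (rule sets_measure_of) auto

lemma subalgebra_past: "0 \<le> s \<Longrightarrow> subalgebra M (past M T X s)"
  unfolding subalgebra_def
proof (intro conjI)
  show "space (past M T X s) = space M"
    unfolding past_def by (rule space_measure_of) auto
  show "sets (past M T X s) \<subseteq> sets M" if "0 \<le> s"
    unfolding sets_past[OF that] by (rule sets.sigma_sets_subset) (rule past_generators[OF that])
qed

lemma past_mono: "0 \<le> s \<Longrightarrow> s \<le> t \<Longrightarrow> sets (past M T X s) \<subseteq> sets (past M T X t)"
  unfolding sets_past[of s] sets_past[OF order_trans[of 0 s t]] by (intro sigma_sets_mono' UN_mono) auto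

lemma past_vimage: "0 \<le> s \<Longrightarrow> s \<le> t \<Longrightarrow> A \<in> sets S \<Longrightarrow> X s -` A \<inter> space M \<in> sets (past M T X t)"
  by (subst sets_past) (auto intro!: sigma_sets.Basic)

lemma past_sets_M: "0 \<le> s \<Longrightarrow> B \<in> sets (past M T X s) \<Longrightarrow> B \<in> sets M"
  using subalgebra_past unfolding subalgebra_def by auto

lemma X_past_measurable: "0 \<le> s \<Longrightarrow> s \<le> t \<Longrightarrow> X s \<in> past M T X t \<rightarrow>\<^sub>M S"
  using subalgebra_past[of t] past_vimage[of s t] X_in_T[of s]
  by (intro measurableI) (auto simp: subalgebra_def space_S)

lemma finite_measure_subalgebra_past: "0 \<le> s \<Longrightarrow> finite_measure_subalgebra M (past M T X s)"
  by unfold_locales (rule subalgebra_past)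

text \<open>The conditional probability in \<open>markov_process\<close> integrated over an event of
  the past, which removes the exceptional null sets that depend on \<open>A\<close>.\<close>

lemma markov_property_sets:
  assumes s: "0 \<le> s" "0 \<le> t" and B: "B \<in> sets (past M T X s)" and A [measurable]: "A \<in> sets S"
  shows "emeasure M (B \<inter> (X (s + t) -` A \<inter> space M)) = (\<integral>\<^sup>+w. indicator B w * emeasure (K t (X s w)) A \<partial>M)"
proof -
  interpret F: finite_measure_subalgebra M "past M T X s"
    by (rule finite_measure_subalgebra_past[OF s(1)])
  let ?E = "X (s + t) -` A \<inter> space M"
  have E [measurable]: "?E \<in> sets M"
    using s A by (intro measurable_sets[OF X_measurable]) auto
  have BM [measurable]: "B \<in> sets M"
    using past_sets_M s B by auto
  have [measurable]: "(\<lambda>w. measure (K t (X s w)) A) \<in> borel_measurable M"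
    using measurable_compose[OF measurable_compose[OF X_measurable[OF s(1)] K_measurable[OF s(2)]] measurable_measure_subprob_algebra[OF A]] .
  have le1: "measure (K t (X s w)) A \<le> 1" if "w \<in> space M" for w
    using prob_space.prob_le_1[OF K_prob[OF s(2) X_in_T[OF s(1) that]]] by simp
  have iE: "integrable M (indicator ?E :: 'w \<Rightarrow> real)"
    by (simp add: integrable_indicator_iff emeasure_eq_measure less_top)
  have iK: "integrable M (\<lambda>w. indicator B w * measure (K t (X s w)) A)"
    using le1 by (intro integrable_const_bound[of _ 1]) (auto simp: indicator_def)
  have AE: "AE w in M. real_cond_exp M (past M T X s) (indicator ?E) w = measure (K t (X s w)) A"
    using markov s A unfolding markov_process_def by blast
  have "measure M (B \<inter> ?E) = (\<integral>w\<in>B. indicator ?E w \<partial>M)"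
    unfolding set_lebesgue_integral_def by (simp flip: indicator_inter_arith)
  also have "\<dots> = (\<integral>w\<in>B. real_cond_exp M (past M T X s) (indicator ?E) w \<partial>M)"
    by (rule F.real_cond_exp_intA[OF iE B])
  also have "\<dots> = (\<integral>w. indicator B w * measure (K t (X s w)) A \<partial>M)"
    unfolding set_lebesgue_integral_def using AE by (intro integral_cong_AE) auto
  finally have "ennreal (measure M (B \<inter> ?E)) = (\<integral>\<^sup>+w. ennreal (indicator B w * measure (K t (X s w)) A) \<partial>M)"
    using iK by (subst nn_integral_eq_integral) auto
  also have "\<dots> = (\<integral>\<^sup>+w. indicator B w * emeasure (K t (X s w)) A \<partial>M)"
  proof (intro nn_integral_cong)
    fix w assume "w \<in> space M"
    then interpret Kw: prob_space "K t (X s w)"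
      using K_prob X_in_T s by auto
    show "ennreal (indicator B w * measure (K t (X s w)) A) = indicator B w * emeasure (K t (X s w)) A"
      by (simp add: Kw.emeasure_eq_measure indicator_def)
  qed
  finally show ?thesis
    by (simp add: emeasure_eq_measure)
qed

text \<open>A joint function of \<open>X s\<close> and \<open>X (s + t)\<close> is required, since a
  jump is detected by comparing the two. Both sides are integrals of \<open>g\<close> against finite
  measures on pairs, which agree on rectangles and therefore everywhere.\<close>

lemma markov_property:
  assumes s: "0 \<le> s" "0 \<le> t" and B: "B \<in> sets (past M T X s)" and g: "g \<in> borel_measurable (S \<Otimes>\<^sub>M S)"
  shows "(\<integral>\<^sup>+w. indicator B w * g (X s w, X (s + t) w) \<partial>M) =
    (\<integral>\<^sup>+w. indicator B w * (\<integral>\<^sup>+\<zeta>. g (X s w, \<zeta>) \<partial>K t (X s w)) \<partial>M)"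
proof -
  have BM [measurable]: "B \<in> sets M"
    using past_sets_M s B by auto
  have XX [measurable]: "X s \<in> M \<rightarrow>\<^sub>M S" "X (s + t) \<in> M \<rightarrow>\<^sub>M S" and KK: "K t \<in> S \<rightarrow>\<^sub>M subprob_algebra S"
    using s by (auto intro!: X_measurable K_measurable)
  let ?MB = "density M (indicator B)"
  let ?\<nu>1 = "distr ?MB (S \<Otimes>\<^sub>M S) (\<lambda>w. (X s w, X (s + t) w))"
  let ?N = "\<lambda>w. distr (K t (X s w)) (S \<Otimes>\<^sub>M S) (Pair (X s w))"
  let ?\<nu>2 = "?MB \<bind> ?N"
  have KX: "(\<lambda>w. K t (X s w)) \<in> M \<rightarrow>\<^sub>M subprob_algebra S"
    by (rule measurable_compose[OF XX(1) KK])
  have N: "?N \<in> M \<rightarrow>\<^sub>M subprob_algebra (S \<Otimes>\<^sub>M S)"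
    by (rule measurable_distr2[OF _ KX]) measurable
  then have N': "?N \<in> ?MB \<rightarrow>\<^sub>M subprob_algebra (S \<Otimes>\<^sub>M S)"
    by simp
  have ne: "space ?MB \<noteq> {}"
    using not_empty by simp
  have PairK: "Pair (X s w) \<in> K t (X s w) \<rightarrow>\<^sub>M S \<Otimes>\<^sub>M S" if "w \<in> space M" for w
    using measurable_Pair1'[of "X s w" S S] X_in_T[OF s(1) that] sets_K[OF s(2) X_in_T[OF s(1) that]]
    by (simp add: space_S cong: measurable_cong_sets)
  have eq: "?\<nu>1 = ?\<nu>2"
  proof (rule measure_eqI_generator_eq[OF Int_stable_pair_measure_generator[of S S], where A = "\<lambda>_. space S \<times> space S"])
    show "{a \<times> b |a b. a \<in> sets S \<and> b \<in> sets S} \<subseteq> Pow (space S \<times> space S)"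
      using sets.sets_into_space by blast
    show "sets ?\<nu>1 = sigma_sets (space S \<times> space S) {a \<times> b |a b. a \<in> sets S \<and> b \<in> sets S}"
      by (simp add: sets_pair_measure)
    show "sets ?\<nu>2 = sigma_sets (space S \<times> space S) {a \<times> b |a b. a \<in> sets S \<and> b \<in> sets S}"
      using sets_bind_measurable[OF N' ne] by (simp add: sets_pair_measure)
    show "range (\<lambda>_::nat. space S \<times> space S) \<subseteq> {a \<times> b |a b. a \<in> sets S \<and> b \<in> sets S}"
      by auto
    show "emeasure ?\<nu>1 (space S \<times> space S) \<noteq> \<infinity>"
    proof -
      have "emeasure ?\<nu>1 (space S \<times> space S) \<le> emeasure ?\<nu>1 (space ?\<nu>1)"
        by (rule emeasure_space)
      also have "\<dots> = emeasure ?MB (space M)"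
        using measurable_space[OF XX(1)] measurable_space[OF XX(2)]
        by (subst emeasure_distr) (auto simp: space_pair_measure intro!: arg_cong2[where f = emeasure])
      also have "\<dots> = (\<integral>\<^sup>+w. indicator B w \<partial>M)"
        by (subst emeasure_density) (auto intro!: nn_integral_cong)
      also have "\<dots> = emeasure M B"
        by simp
      finally show ?thesis
        using emeasure_finite[of B] by (auto simp: top_unique)
    qed
    fix C assume "C \<in> {a \<times> b |a b. a \<in> sets S \<and> b \<in> sets S}"
    then obtain a b where C: "C = a \<times> b" and ab [measurable]: "a \<in> sets S" "b \<in> sets S"
      by auto
    \<comment> \<open>The first side of the rectangle is a condition on \<open>X s\<close>, so it
      can be absorbed into the event of the past.\<close>
    let ?B' = "B \<inter> (X s -` a \<inter> space M)"
    have B': "?B' \<in> sets (past M T X s)"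
      using B past_vimage[of s s a] s ab by auto
    have "emeasure ?\<nu>1 C = (\<integral>\<^sup>+w. indicator B w * indicator ((\<lambda>w. (X s w, X (s + t) w)) -` C \<inter> space M) w \<partial>M)"
      unfolding C by (subst emeasure_distr) (auto simp: emeasure_density)
    also have "\<dots> = (\<integral>\<^sup>+w. indicator (?B' \<inter> (X (s + t) -` b \<inter> space M)) w \<partial>M)"
      unfolding C by (intro nn_integral_cong) (auto simp: indicator_def)
    also have "\<dots> = emeasure M (?B' \<inter> (X (s + t) -` b \<inter> space M))"
      by (intro nn_integral_indicator) measurable
    also have "\<dots> = (\<integral>\<^sup>+w. indicator ?B' w * emeasure (K t (X s w)) b \<partial>M)"
      by (rule markov_property_sets[OF s B' ab(2)])
    also have "\<dots> = (\<integral>\<^sup>+w. indicator B w * emeasure (?N w) C \<partial>M)"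
    proof (intro nn_integral_cong)
      fix w assume w: "w \<in> space M"
      have "emeasure (?N w) C = emeasure (K t (X s w)) (Pair (X s w) -` C \<inter> space (K t (X s w)))"
        unfolding C using PairK[OF w] by (intro emeasure_distr) auto
      also have "Pair (X s w) -` C \<inter> space (K t (X s w)) = (if X s w \<in> a then b else {})"
        using sets.sets_into_space[OF ab(2)] space_K[OF s(2) X_in_T[OF s(1) w]] unfolding C space_S by auto
      finally show "indicator ?B' w * emeasure (K t (X s w)) b = indicator B w * emeasure (?N w) C"
        using w by (auto simp: indicator_def)
    qed
    also have "\<dots> = (\<integral>\<^sup>+w. emeasure (?N w) C \<partial>?MB)"
      unfolding C by (intro nn_integral_density[symmetric] measurable_emeasure_kernel[OF N] borel_measurable_indicator BM) simp
    also have "\<dots> = emeasure ?\<nu>2 C"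
      unfolding C by (rule emeasure_bind[OF ne N', symmetric]) simp
    finally show "emeasure ?\<nu>1 C = emeasure ?\<nu>2 C" .
  qed simp
  have gN: "(\<integral>\<^sup>+p. g p \<partial>?N w) = (\<integral>\<^sup>+\<zeta>. g (X s w, \<zeta>) \<partial>K t (X s w))" if "w \<in> space M" for w
    using PairK[OF that] g by (intro nn_integral_distr) simp_all
  have "(\<integral>\<^sup>+w. indicator B w * g (X s w, X (s + t) w) \<partial>M) = (\<integral>\<^sup>+w. g (X s w, X (s + t) w) \<partial>?MB)"
    using g by (subst nn_integral_density) auto
  also have "\<dots> = (\<integral>\<^sup>+p. g p \<partial>?\<nu>1)"
    using g by (subst nn_integral_distr) auto
  also have "\<dots> = (\<integral>\<^sup>+w. (\<integral>\<^sup>+p. g p \<partial>?N w) \<partial>?MB)"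
    unfolding eq by (rule nn_integral_bind[OF g N'])
  also have "\<dots> = (\<integral>\<^sup>+w. indicator B w * (\<integral>\<^sup>+p. g p \<partial>?N w) \<partial>M)"
    by (intro nn_integral_density measurable_compose[OF N nn_integral_measurable_subprob_algebra[OF g]]) simp
  also have "\<dots> = (\<integral>\<^sup>+w. indicator B w * (\<integral>\<^sup>+\<zeta>. g (X s w, \<zeta>) \<partial>K t (X s w)) \<partial>M)"
    by (intro nn_integral_cong) (simp add: gN)
  finally show ?thesis .
qed

section \<open>Laws at a fixed time and along a time grid\<close>

lemma X_law_S:
  assumes "0 \<le> t"
  shows "distr M S (X t) = restrict_space \<nu> T"
proof (rule measure_eqI)
  have init_sets: "sets (restrict_space \<nu> T) = sets S"
    unfolding initial[symmetric] by simp
  then show "sets (distr M S (X t)) = sets (restrict_space \<nu> T)"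
    by simp
  fix A assume "A \<in> sets (distr M S (X t))"
  then have A [measurable]: "A \<in> sets S" by simp
  have sp: "space M \<in> sets (past M T X 0)"
    using subalgebra_past[of 0] unfolding subalgebra_def by (metis order_refl sets.top)
  have Kt: "K t \<in> S \<rightarrow>\<^sub>M subprob_algebra S" and X0: "X 0 \<in> M \<rightarrow>\<^sub>M S" and Xt: "X t \<in> M \<rightarrow>\<^sub>M S"
    using assms by (auto intro!: K_measurable X_measurable)
  have "emeasure (distr M S (X t)) A = emeasure M (space M \<inter> (X (0 + t) -` A \<inter> space M))"
    using Xt by (simp add: emeasure_distr Int_absorb1)
  also have "\<dots> = (\<integral>\<^sup>+w. indicator (space M) w * emeasure (K t (X 0 w)) A \<partial>M)"
    by (rule markov_property_sets[OF order_refl assms sp A])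
  also have "\<dots> = (\<integral>\<^sup>+w. emeasure (K t (X 0 w)) A \<partial>M)"
    by (intro nn_integral_cong) simp
  also have "\<dots> = (\<integral>\<^sup>+\<eta>. emeasure (K t \<eta>) A \<partial>distr M S (X 0))"
    by (rule nn_integral_distr[OF X0, symmetric]) (simp add: measurable_emeasure_kernel[OF Kt A])
  also have "\<dots> = emeasure (distr M S (X 0) \<bind> K t) A"
    using Kt not_empty space_S X_in_T[of 0] by (intro emeasure_bind[symmetric, where N = S]) auto
  also have "\<dots> = emeasure (restrict_space \<nu> T) A"
    unfolding initial stationary_law[OF assms] ..
  finally show "emeasure (distr M S (X t)) A = emeasure (restrict_space \<nu> T) A" .
qed

lemma product_law_eq: "\<nu> = PiM UNIV (\<lambda>_. measure_pmf q)"
  unfolding product_law_def marginal_eq ..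

lemma sets_product_law: "sets \<nu> = sets config_space"
  unfolding product_law_eq config_space_def by (intro sets_PiM_cong) auto

lemma X_law:
  assumes "0 \<le> t"
  shows "distr M config_space (X t) = \<nu>"
proof (rule measure_eqI)
  interpret \<nu>: prob_space \<nu>
    unfolding product_law_eq by (intro prob_space_PiM measure_pmf.prob_space_axioms)
  show "sets (distr M config_space (X t)) = sets \<nu>"
    by (simp add: sets_product_law)
  fix A assume "A \<in> sets (distr M config_space (X t))"
  then have A: "A \<in> sets config_space" by simp
  have Xc: "X t \<in> M \<rightarrow>\<^sub>M config_space"
    using measurable_compose[OF X_measurable[OF assms] measurable_S_config] .
  have AT: "A \<inter> T \<in> sets S"
    unfolding tempered_space_def sets_restrict_space using A by auto
  have "emeasure (distr M config_space (X t)) A = emeasure M (X t -` A \<inter> space M)"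
    using A Xc by (simp add: emeasure_distr)
  also have "X t -` A \<inter> space M = X t -` (A \<inter> T) \<inter> space M"
    using X_in_T[OF assms] by auto
  also have "emeasure M \<dots> = emeasure (restrict_space \<nu> T) (A \<inter> T)"
    unfolding X_law_S[OF assms, symmetric] using AT X_measurable[OF assms] by (simp add: emeasure_distr)
  also have "\<dots> = emeasure \<nu> (A \<inter> T)"
    using T_sets by (intro emeasure_restrict_space) (auto simp: sets_product_law)
  also have "\<dots> = emeasure \<nu> A"
  proof -
    have "AE \<omega> in \<nu>. \<omega> \<in> T"
      using T_full T_sets sets_product_law by (subst \<nu>.AE_in_set_eq_1) (auto simp: \<nu>.emeasure_eq_measure)
    then show ?thesis
      using A T_sets sets_product_law by (intro emeasure_eq_AE) auto
  qed
  finally show "emeasure (distr M config_space (X t)) A = emeasure \<nu> A" .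
qed


text \<open>The probability that the chain with kernel \<open>K d\<close>, started at
  \<open>\<eta>\<close>, is in \<open>A k\<close> at step \<open>k\<close> for all
  \<open>k \<le> n\<close>, written by conditioning on the first step. It depends on the start and
  not on the starting time.\<close>

primrec path_probability :: "real \<Rightarrow> nat \<Rightarrow> (nat \<Rightarrow> config set) \<Rightarrow> config \<Rightarrow> ennreal" where
  "path_probability d 0 A \<eta> = indicator (A 0) \<eta>"
| "path_probability d (Suc n) A \<eta> =
    indicator (A 0) \<eta> * (\<integral>\<^sup>+\<zeta>. path_probability d n (\<lambda>k. A (Suc k)) \<zeta> \<partial>K d \<eta>)"

lemma path_probability_measurable:
  assumes "0 \<le> d" "\<And>k. A k \<in> sets S"
  shows "path_probability d n A \<in> borel_measurable S"
  using assms(2)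
proof (induction n arbitrary: A)
  case 0
  then show ?case by simp
next
  case (Suc n)
  have [measurable]: "A 0 \<in> sets S"
    by (rule Suc.prems)
  have [measurable]: "(\<lambda>\<eta>. \<integral>\<^sup>+\<zeta>. path_probability d n (\<lambda>k. A (Suc k)) \<zeta> \<partial>K d \<eta>) \<in> borel_measurable S"
    by (rule measurable_compose[OF K_measurable[OF assms(1)] nn_integral_measurable_subprob_algebra[OF Suc.IH]])
       (rule Suc.prems)
  show ?case by simp
qed

text \<open>Induction with the Markov property: the condition at time \<open>s\<close> joins the
  event of the past, and the remaining conditions form a shorter path from time
  \<open>s + d\<close>.\<close>

lemma path_probability_eq:
  assumes "0 \<le> d" "0 \<le> s" "\<And>k. A k \<in> sets S" "B \<in> sets (past M T X s)"
  shows "(\<integral>\<^sup>+w. indicator B w * path_probability d n A (X s w) \<partial>M) =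
    emeasure M (B \<inter> {w \<in> space M. \<forall>k\<le>n. X (s + real k * d) w \<in> A k})"
  using assms(2-)
proof (induction n arbitrary: s A B)
  case 0
  have "X s \<in> M \<rightarrow>\<^sub>M S" using 0 by (intro X_measurable)
  then have "B \<inter> (X s -` A 0 \<inter> space M) \<in> sets M"
    using past_sets_M[of s B] 0 by (auto intro: measurable_sets)
  then have "emeasure M (B \<inter> (X s -` A 0 \<inter> space M)) = (\<integral>\<^sup>+w. indicator (B \<inter> (X s -` A 0 \<inter> space M)) w \<partial>M)"
    by (rule nn_integral_indicator[symmetric])
  also have "\<dots> = (\<integral>\<^sup>+w. indicator B w * path_probability d 0 A (X s w) \<partial>M)"
    by (intro nn_integral_cong) (auto simp: indicator_def)
  also have "B \<inter> (X s -` A 0 \<inter> space M) = B \<inter> {w \<in> space M. \<forall>k\<le>0. X (s + real k * d) w \<in> A k}"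
    by auto
  finally show ?case ..
next
  case (Suc n)
  define B' where "B' = B \<inter> (X s -` A 0 \<inter> space M)"
  have B's: "B' \<in> sets (past M T X s)"
    unfolding B'_def using past_vimage[of s s "A 0"] Suc.prems by auto
  then have B': "B' \<in> sets (past M T X (s + d))"
    using past_mono[of s "s + d"] Suc.prems assms(1) by auto
  let ?g = "path_probability d n (\<lambda>k. A (Suc k))"
  have g: "(\<lambda>p. ?g (snd p)) \<in> borel_measurable (S \<Otimes>\<^sub>M S)"
    by (rule measurable_compose[OF measurable_snd path_probability_measurable]) (use assms(1) Suc.prems in auto)
  have "(\<integral>\<^sup>+w. indicator B w * path_probability d (Suc n) A (X s w) \<partial>M) =
    (\<integral>\<^sup>+w. indicator B' w * (\<integral>\<^sup>+\<zeta>. ?g (snd (X s w, \<zeta>)) \<partial>K d (X s w)) \<partial>M)"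
    unfolding B'_def by (intro nn_integral_cong) (auto simp: indicator_def)
  also have "\<dots> = (\<integral>\<^sup>+w. indicator B' w * ?g (snd (X s w, X (s + d) w)) \<partial>M)"
    by (rule markov_property[OF Suc.prems(1) assms(1) B's g, symmetric])
  also have "\<dots> = (\<integral>\<^sup>+w. indicator B' w * ?g (X (s + d) w) \<partial>M)"
    by simp
  also have "\<dots> = emeasure M (B' \<inter> {w \<in> space M. \<forall>k\<le>n. X (s + d + real k * d) w \<in> A (Suc k)})"
    using Suc.prems assms(1) B' by (intro Suc.IH) auto
  also have "B' \<inter> {w \<in> space M. \<forall>k\<le>n. X (s + d + real k * d) w \<in> A (Suc k)} =
    B \<inter> {w \<in> space M. \<forall>k\<le>Suc n. X (s + real k * d) w \<in> A k}"
  proof -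
    have "(\<forall>k\<le>Suc n. P k) \<longleftrightarrow> P 0 \<and> (\<forall>k\<le>n. P (Suc k))" for P
      by (metis Suc_le_mono le0 not0_implies_Suc)
    then show ?thesis
      unfolding B'_def by (auto simp: algebra_simps)
  qed
  finally show ?case .
qed

definition grid_path :: "real \<Rightarrow> nat \<Rightarrow> 'w \<Rightarrow> nat \<Rightarrow> config" where
  "grid_path d j w k = X (real (j + k) * d) w"

abbreviation "path_space \<equiv> PiM (UNIV :: nat set) (\<lambda>_. S)"

lemma grid_path_measurable: "0 \<le> d \<Longrightarrow> grid_path d j \<in> M \<rightarrow>\<^sub>M path_space"
  by (rule measurable_PiM_single') (auto simp: grid_path_def space_S intro!: X_measurable X_in_T)

text \<open>A finite-dimensional probability is the integral of \<open>path_probability\<close>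
  against the law at the starting time, and this law is the same at all times.\<close>

lemma grid_path_stationary:
  assumes d: "0 \<le> d"
  shows "distr M path_space (grid_path d j) = distr M path_space (grid_path d 0)"
proof (rule measure_eqI_PiM_infinite[where M = "\<lambda>_. S" and I = UNIV])
  note [measurable] = grid_path_measurable[OF d]
  show "finite_measure (distr M path_space (grid_path d j))"
    by (intro finite_measure_distr) measurable
  fix A :: "nat \<Rightarrow> config set" and J :: "nat set"
  assume J: "finite J" "J \<subseteq> UNIV" and A: "\<And>i. i \<in> J \<Longrightarrow> A i \<in> sets S"
  \<comment> \<open>Times outside \<open>J\<close> get the vacuous condition \<open>T\<close>, so
    that the conditions run over consecutive steps as \<open>path_probability\<close>
    demands.\<close>
  define A' where "A' k = (if k \<in> J then A k else T)" for k
  define n where "n = Max (insert 0 J)"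
  have A': "A' k \<in> sets S" for k
    unfolding A'_def using A sets.top[of S] space_S by auto
  have n: "k \<in> J \<Longrightarrow> k \<le> n" for k
    unfolding n_def using J by auto
  have *: "emeasure (distr M path_space (grid_path d j)) (prod_emb UNIV (\<lambda>_. S) J (Pi\<^sub>E J A)) =
    (\<integral>\<^sup>+\<eta>. path_probability d n A' \<eta> \<partial>restrict_space \<nu> T)" for j
  proof -
    let ?s = "real j * d"
    have s: "0 \<le> ?s" using d by simp
    have sp: "space M \<in> sets (past M T X ?s)"
      using subalgebra_past[OF s] unfolding subalgebra_def by (metis sets.top)
    have "emeasure (distr M path_space (grid_path d j)) (prod_emb UNIV (\<lambda>_. S) J (Pi\<^sub>E J A)) =
      emeasure M (grid_path d j -` prod_emb UNIV (\<lambda>_. S) J (Pi\<^sub>E J A) \<inter> space M)"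
      using J A by (intro emeasure_distr sets_PiM_I) auto
    also have "grid_path d j -` prod_emb UNIV (\<lambda>_. S) J (Pi\<^sub>E J A) \<inter> space M =
      space M \<inter> {w \<in> space M. \<forall>k\<le>n. X (?s + real k * d) w \<in> A' k}"
    proof -
      have emb: "prod_emb UNIV (\<lambda>_. S) J (Pi\<^sub>E J A) = {y. (\<forall>k. y k \<in> T) \<and> (\<forall>k\<in>J. y k \<in> A k)}"
        unfolding prod_emb_def by (auto simp: space_S PiE_iff)
      have "grid_path d j w \<in> prod_emb UNIV (\<lambda>_. S) J (Pi\<^sub>E J A) \<longleftrightarrow> (\<forall>k\<le>n. X (?s + real k * d) w \<in> A' k)"
        if w: "w \<in> space M" for w
      proof -
        have g: "grid_path d j w k = X (?s + real k * d) w" for k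
          unfolding grid_path_def by (simp add: distrib_right)
        have XT: "X (?s + real k * d) w \<in> T" for k
          using d w by (intro X_in_T) auto
        show ?thesis
          unfolding emb g A'_def using XT n by (auto simp: g)
      qed
      then show ?thesis by blast
    qed
    also have "emeasure M \<dots> = (\<integral>\<^sup>+w. indicator (space M) w * path_probability d n A' (X ?s w) \<partial>M)"
      by (rule path_probability_eq[OF d s A' sp, symmetric])
    also have "\<dots> = (\<integral>\<^sup>+w. path_probability d n A' (X ?s w) \<partial>M)"
      by (intro nn_integral_cong) simp
    also have "\<dots> = (\<integral>\<^sup>+\<eta>. path_probability d n A' \<eta> \<partial>distr M S (X ?s))"
      by (intro nn_integral_distr[symmetric] X_measurable s)
         (simp add: path_probability_measurable[OF d A'])
    also have "\<dots> = (\<integral>\<^sup>+\<eta>. path_probability d n A' \<eta> \<partial>restrict_space \<nu> T)"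
      by (simp only: X_law_S[OF s])
    finally show ?thesis .
  qed
  show "emeasure (distr M path_space (grid_path d j)) (prod_emb UNIV (\<lambda>_. S) J (Pi\<^sub>E J A)) =
    emeasure (distr M path_space (grid_path d 0)) (prod_emb UNIV (\<lambda>_. S) J (Pi\<^sub>E J A))"
    unfolding * ..
qed simp_all

end

section \<open>Laws of large numbers for the product measure\<close>

context prob_space
begin

lemma expectation_square_sum_orthogonal:
  fixes D :: "'i \<Rightarrow> 'a \<Rightarrow> real"
  assumes A: "finite A" and sq: "\<And>i j. i \<in> A \<Longrightarrow> j \<in> A \<Longrightarrow> integrable M (\<lambda>w. D i w * D j w)"
    and orth: "\<And>i j. i \<in> A \<Longrightarrow> j \<in> A \<Longrightarrow> i \<noteq> j \<Longrightarrow> expectation (\<lambda>w. D i w * D j w) = 0"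
  shows "integrable M (\<lambda>w. (\<Sum>i\<in>A. D i w)\<^sup>2)"
    and "expectation (\<lambda>w. (\<Sum>i\<in>A. D i w)\<^sup>2) = (\<Sum>i\<in>A. expectation (\<lambda>w. (D i w)\<^sup>2))"
proof -
  have eq: "(\<Sum>i\<in>A. D i w)\<^sup>2 = (\<Sum>i\<in>A. \<Sum>j\<in>A. D i w * D j w)" for w
    by (simp add: power2_eq_square sum_product)
  show "integrable M (\<lambda>w. (\<Sum>i\<in>A. D i w)\<^sup>2)"
    unfolding eq using sq by auto
  have "expectation (\<lambda>w. (\<Sum>i\<in>A. D i w)\<^sup>2) = (\<Sum>i\<in>A. \<Sum>j\<in>A. expectation (\<lambda>w. D i w * D j w))"
    unfolding eq using sq by (simp add: Bochner_Integration.integral_sum)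
  also have "\<dots> = (\<Sum>i\<in>A. \<Sum>j\<in>A. if i = j then expectation (\<lambda>w. (D i w)\<^sup>2) else 0)"
    using orth by (intro sum.cong refl) (auto simp: power2_eq_square)
  also have "\<dots> = (\<Sum>i\<in>A. expectation (\<lambda>w. (D i w)\<^sup>2))"
    using A by (simp add: sum.delta)
  finally show "expectation (\<lambda>w. (\<Sum>i\<in>A. D i w)\<^sup>2) = (\<Sum>i\<in>A. expectation (\<lambda>w. (D i w)\<^sup>2))" .
qed

text \<open>The pointwise inequality
  \<open>2 * s * \<bar>Y\<bar> \<le> s\<^sup>2 + Y\<^sup>2\<close> replaces Cauchy-Schwarz and
  yields integrability of \<open>Y\<close> at the same time.\<close>

lemma expectation_abs_le_sqrt:
  fixes Y :: "'a \<Rightarrow> real"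
  assumes [measurable]: "Y \<in> borel_measurable M" and sq: "integrable M (\<lambda>w. (Y w)\<^sup>2)"
    and le: "expectation (\<lambda>w. (Y w)\<^sup>2) \<le> s\<^sup>2" and s: "0 < s"
  shows "integrable M Y" "expectation (\<lambda>w. \<bar>Y w\<bar>) \<le> s"
proof -
  have bound: "\<bar>Y w\<bar> \<le> (s + (Y w)\<^sup>2 / s) / 2" for w
  proof -
    have "0 \<le> (\<bar>Y w\<bar> - s)\<^sup>2" by simp
    then have "2 * s * \<bar>Y w\<bar> \<le> s\<^sup>2 + (Y w)\<^sup>2"
      by (simp add: power2_diff mult_ac)
    then show ?thesis
      using s by (simp add: field_simps power2_eq_square)
  qed
  have i: "integrable M (\<lambda>w. (s + (Y w)\<^sup>2 / s) / 2)"
    using sq by auto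
  show "integrable M Y"
  proof (rule Bochner_Integration.integrable_bound[OF i])
    show "AE w in M. norm (Y w) \<le> norm ((s + (Y w)\<^sup>2 / s) / 2)"
      using bound by (intro AE_I2) (simp only: real_norm_def, rule order_trans[OF bound abs_ge_self])
  qed simp
  then have "expectation (\<lambda>w. \<bar>Y w\<bar>) \<le> expectation (\<lambda>w. (s + (Y w)\<^sup>2 / s) / 2)"
    using i bound by (intro integral_mono) auto
  also have "\<dots> = (s + expectation (\<lambda>w. (Y w)\<^sup>2) / s) / 2"
    using sq by (simp add: prob_space)
  also have "\<dots> \<le> (s + s\<^sup>2 / s) / 2"
    using le s by (intro divide_right_mono add_left_mono) auto
  also have "\<dots> = s"
    using s by (simp add: power2_eq_square)
  finally show "expectation (\<lambda>w. \<bar>Y w\<bar>) \<le> s" .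
qed

text \<open>Truncation at \<open>B\<close> makes a variance available although the variables have a
  first moment only. The discarded parts are small in \<open>L1\<close> uniformly in the number of
  terms, because the laws coincide, and the average of the centred truncations has \<open>L1\<close>
  norm of order \<open>B / sqrt N\<close>.\<close>

lemma L1_law_of_large_numbers:
  fixes Y :: "nat \<Rightarrow> 'a \<Rightarrow> real"
  assumes indep: "indep_vars (\<lambda>_. borel) Y UNIV" and int: "integrable M (Y 0)"
    and law: "\<And>j. distr M borel (Y j) = distr M borel (Y 0)" and e: "0 < e"
  shows "\<exists>N>0. expectation (\<lambda>w. \<bar>(\<Sum>j<N. Y j w) / real N - expectation (Y 0)\<bar>) \<le> e"
proof -
  have Y [measurable]: "Y j \<in> borel_measurable M" for j
    using indep unfolding indep_vars_def by auto
  define tr :: "nat \<Rightarrow> real \<Rightarrow> real" where "tr B x = max (- real B) (min (real B) x)" for B x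
  have tr_m [measurable]: "tr B \<in> borel_measurable borel" for B
    unfolding tr_def by measurable
  have tr_le: "\<bar>tr B x\<bar> \<le> real B" "\<bar>x - tr B x\<bar> \<le> \<bar>x\<bar>" for B x
    unfolding tr_def by (auto simp: max_def min_def)
  have exp_law: "expectation (\<lambda>w. g (Y j w)) = expectation (\<lambda>w. g (Y 0 w))"
    if [measurable]: "g \<in> borel_measurable borel" for g :: "real \<Rightarrow> real" and j
    using integral_distr[of "Y j" M borel g] integral_distr[of "Y 0" M borel g] law[of j] by simp
  have int_law: "integrable M (\<lambda>w. g (Y j w)) \<longleftrightarrow> integrable M (\<lambda>w. g (Y 0 w))"
    if [measurable]: "g \<in> borel_measurable borel" for g :: "real \<Rightarrow> real" and j
    using integrable_distr_eq[of "Y j" M borel g] integrable_distr_eq[of "Y 0" M borel g] law[of j] by simp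
  have "(\<lambda>B. expectation (\<lambda>w. \<bar>Y 0 w - tr B (Y 0 w)\<bar>)) \<longlonglongrightarrow> expectation (\<lambda>w. 0)"
  proof (rule integral_dominated_convergence[where w = "\<lambda>w. \<bar>Y 0 w\<bar>"])
    show "AE w in M. (\<lambda>B. \<bar>Y 0 w - tr B (Y 0 w)\<bar>) \<longlonglongrightarrow> 0"
    proof (intro AE_I2 tendsto_eventually)
      fix w
      obtain B0 :: nat where "\<bar>Y 0 w\<bar> \<le> real B0"
        using real_arch_simple by blast
      then have "\<forall>B\<ge>B0. \<bar>Y 0 w - tr B (Y 0 w)\<bar> = 0"
        unfolding tr_def by (auto simp: max_def min_def)
      then show "eventually (\<lambda>B. \<bar>Y 0 w - tr B (Y 0 w)\<bar> = 0) sequentially"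
        by (auto simp: eventually_sequentially)
    qed
  qed (use int tr_le in auto)
  then have "eventually (\<lambda>B. expectation (\<lambda>w. \<bar>Y 0 w - tr B (Y 0 w)\<bar>) < e / 3) sequentially"
    using e by (intro order_tendstoD(2)) auto
  then obtain B where B: "expectation (\<lambda>w. \<bar>Y 0 w - tr B (Y 0 w)\<bar>) < e / 3"
    by (auto simp: eventually_sequentially)
  define m where "m = expectation (\<lambda>w. tr B (Y 0 w))"
  define D where "D j w = tr B (Y j w) - m" for j w
  have [measurable]: "D j \<in> borel_measurable M" for j
    unfolding D_def by measurable
  have itr: "integrable M (\<lambda>w. tr B (Y j w))" for j
    using tr_le by (intro integrable_const_bound[of _ "real B"]) auto
  have idiff: "integrable M (\<lambda>w. Y j w - tr B (Y j w))" for j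
    using int itr int_law[of "\<lambda>x. x" j] by auto
  have intY: "integrable M (Y j)" for j
    using int_law[of "\<lambda>x. x" j] int by simp
  have m: "\<bar>m\<bar> \<le> real B"
  proof -
    have "\<bar>m\<bar> \<le> expectation (\<lambda>w. \<bar>tr B (Y 0 w)\<bar>)"
      unfolding m_def by (rule integral_abs_bound)
    also have "\<dots> \<le> expectation (\<lambda>w. real B)"
      using itr[of 0] tr_le(1) by (intro integral_mono) auto
    finally show ?thesis by (simp add: prob_space)
  qed
  have D_le: "\<bar>D j w\<bar> \<le> 2 * real B" for j w
    unfolding D_def using tr_le(1)[of B "Y j w"] m by linarith
  have D_int: "integrable M (\<lambda>w. D i w * D j w)" for i j
  proof (rule integrable_const_bound[of _ "(2 * real B) * (2 * real B)"])
    show "AE w in M. norm (D i w * D j w) \<le> (2 * real B) * (2 * real B)"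
      unfolding real_norm_def abs_mult by (intro AE_I2 mult_mono D_le) auto
  qed measurable
  have D_mean: "expectation (D j) = 0" for j
    unfolding D_def using itr[of j] exp_law[of "tr B" j] by (simp add: m_def prob_space)
  have D_orth: "expectation (\<lambda>w. D i w * D j w) = 0" if "i \<noteq> j" for i j
  proof -
    have "indep_vars (\<lambda>_. borel) (\<lambda>j w. tr B (Y j w) - m) {i, j}"
      by (rule indep_vars_compose2[OF indep_vars_subset[OF indep]]) auto
    then have "indep_vars (\<lambda>_. borel) D {i, j}"
      unfolding D_def[abs_def] .
    moreover have "integrable M (D k)" for k
      unfolding D_def using itr[of k] by auto
    ultimately have "expectation (\<lambda>w. \<Prod>k\<in>{i, j}. D k w) = (\<Prod>k\<in>{i, j}. expectation (D k))"
      by (intro indep_vars_lebesgue_integral) auto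
    then show ?thesis
      using that D_mean by simp
  qed
  \<comment> \<open>Makes \<open>2 * (B + 1) / sqrt N0\<close> less than \<open>e / 3\<close>. The
    bound \<open>B + 1\<close> instead of \<open>B\<close> keeps the comparison value positive when
    \<open>B = 0\<close>.\<close>
  obtain N0 :: nat where N0: "(6 * (real B + 1) / e)\<^sup>2 < real N0"
    using reals_Archimedean2 by blast
  then have N: "0 < N0"
    using order_le_less_trans[OF zero_le_power2 N0] by simp
  have sqrtN: "6 * (real B + 1) / e < sqrt (real N0)"
    using N0 by (rule real_less_rsqrt)
  let ?D = "\<lambda>w. \<Sum>j<N0. D j w"
  have "expectation (\<lambda>w. (?D w)\<^sup>2) = (\<Sum>j<N0. expectation (\<lambda>w. (D j w)\<^sup>2))"
    using D_int D_orth by (intro expectation_square_sum_orthogonal) auto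
  also have "\<dots> \<le> (\<Sum>j<N0. (2 * real B)\<^sup>2)"
  proof (intro sum_mono)
    fix j
    have "(D j w)\<^sup>2 \<le> (2 * real B)\<^sup>2" for w
      by (rule iffD2[OF power2_le_iff_abs_le D_le]) simp
    then have "expectation (\<lambda>w. (D j w)\<^sup>2) \<le> expectation (\<lambda>w. (2 * real B)\<^sup>2)"
      using D_int[of j j] by (intro integral_mono) (auto simp: power2_eq_square)
    then show "expectation (\<lambda>w. (D j w)\<^sup>2) \<le> (2 * real B)\<^sup>2"
      by (simp add: prob_space)
  qed
  also have "\<dots> \<le> (2 * (real B + 1) * sqrt (real N0))\<^sup>2"
  proof -
    have "(2 * (real B + 1) * sqrt (real N0))\<^sup>2 = real N0 * (2 * (real B + 1))\<^sup>2"
      by (subst power_mult_distrib) (simp only: real_sqrt_pow2 of_nat_0_le_iff mult.commute)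
    moreover have "(2 * real B)\<^sup>2 \<le> (2 * (real B + 1))\<^sup>2"
      by (intro power_mono) auto
    ultimately show ?thesis
      by (simp only: sum_constant card_lessThan) (intro mult_left_mono, auto)
  qed
  finally have sq_le: "expectation (\<lambda>w. (?D w)\<^sup>2) \<le> (2 * (real B + 1) * sqrt (real N0))\<^sup>2" .
  have "integrable M (\<lambda>w. (?D w)\<^sup>2)"
    using D_int D_orth by (intro expectation_square_sum_orthogonal(1)) auto
  then have "expectation (\<lambda>w. \<bar>?D w\<bar>) \<le> 2 * (real B + 1) * sqrt (real N0)"
    by (rule expectation_abs_le_sqrt(2)[rotated, OF _ sq_le]) (use N in auto)
  also have "\<dots> \<le> e / 3 * real N0"
  proof -
    have "6 * (real B + 1) \<le> e * sqrt (real N0)"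
      using sqrtN e by (simp add: divide_less_eq mult.commute)
    then have "6 * (real B + 1) * sqrt (real N0) \<le> e * sqrt (real N0) * sqrt (real N0)"
      by (intro mult_right_mono) auto
    also have "\<dots> = e * real N0"
      by (simp add: mult.assoc)
    finally show ?thesis by (simp add: algebra_simps)
  qed
  finally have D_bound: "expectation (\<lambda>w. \<bar>?D w\<bar>) \<le> e / 3 * real N0" .
  have m_diff: "\<bar>m - expectation (Y 0)\<bar> \<le> e / 3"
  proof -
    have "m - expectation (Y 0) = expectation (\<lambda>w. - (Y 0 w - tr B (Y 0 w)))"
      unfolding m_def using int itr[of 0] by simp
    also have "\<bar>\<dots>\<bar> \<le> expectation (\<lambda>w. \<bar>Y 0 w - tr B (Y 0 w)\<bar>)"
      using integral_abs_bound[of M "\<lambda>w. - (Y 0 w - tr B (Y 0 w))"] by (simp only: abs_minus_cancel)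
    finally show ?thesis using B by linarith
  qed
  have "expectation (\<lambda>w. \<bar>(\<Sum>j<N0. Y j w) / real N0 - expectation (Y 0)\<bar>) \<le>
    expectation (\<lambda>w. (\<Sum>j<N0. \<bar>Y j w - tr B (Y j w)\<bar>) / real N0 + \<bar>?D w\<bar> / real N0 + e / 3)"
  proof (rule integral_mono)
    show "integrable M (\<lambda>w. \<bar>(\<Sum>j<N0. Y j w) / real N0 - expectation (Y 0)\<bar>)"
      using intY by auto
    show "integrable M (\<lambda>w. (\<Sum>j<N0. \<bar>Y j w - tr B (Y j w)\<bar>) / real N0 + \<bar>?D w\<bar> / real N0 + e / 3)"
      unfolding D_def using idiff itr by auto
    fix w
    have "(\<Sum>j<N0. Y j w) = (\<Sum>j<N0. Y j w - tr B (Y j w)) + ?D w + real N0 * m"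
      unfolding D_def by (simp add: sum_subtractf)
    then have "(\<Sum>j<N0. Y j w) / real N0 - expectation (Y 0) =
      (\<Sum>j<N0. Y j w - tr B (Y j w)) / real N0 + ?D w / real N0 + (m - expectation (Y 0))"
      using N by (simp add: add_divide_distrib)
    also have "\<bar>\<dots>\<bar> \<le> \<bar>\<Sum>j<N0. Y j w - tr B (Y j w)\<bar> / real N0 + \<bar>?D w\<bar> / real N0 + e / 3"
    proof -
      have "\<bar>(\<Sum>j<N0. Y j w - tr B (Y j w)) / real N0\<bar> = \<bar>\<Sum>j<N0. Y j w - tr B (Y j w)\<bar> / real N0"
        "\<bar>?D w / real N0\<bar> = \<bar>?D w\<bar> / real N0"
        by (simp_all add: abs_divide)
      then show ?thesis
        using m_diff by linarith
    qed
    also have "\<dots> \<le> (\<Sum>j<N0. \<bar>Y j w - tr B (Y j w)\<bar>) / real N0 + \<bar>?D w\<bar> / real N0 + e / 3"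
      by (intro add_right_mono divide_right_mono sum_abs) auto
    finally show "\<bar>(\<Sum>j<N0. Y j w) / real N0 - expectation (Y 0)\<bar> \<le> (\<Sum>j<N0. \<bar>Y j w - tr B (Y j w)\<bar>) / real N0 + \<bar>?D w\<bar> / real N0 + e / 3" .
  qed
  also have "\<dots> = (\<Sum>j<N0. expectation (\<lambda>w. \<bar>Y j w - tr B (Y j w)\<bar>)) / real N0 + expectation (\<lambda>w. \<bar>?D w\<bar>) / real N0 + e / 3"
    unfolding D_def using idiff itr by (simp add: Bochner_Integration.integral_sum prob_space)
  also have "(\<Sum>j<N0. expectation (\<lambda>w. \<bar>Y j w - tr B (Y j w)\<bar>)) = real N0 * expectation (\<lambda>w. \<bar>Y 0 w - tr B (Y 0 w)\<bar>)"
    by (rule trans[OF sum.cong[OF refl exp_law[of "\<lambda>x. \<bar>x - tr B x\<bar>"]]]) simp_all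
  also have "real N0 * expectation (\<lambda>w. \<bar>Y 0 w - tr B (Y 0 w)\<bar>) / real N0 + expectation (\<lambda>w. \<bar>?D w\<bar>) / real N0 + e / 3 \<le> e / 3 + e / 3 + e / 3"
    using N B D_bound by (intro add_mono) (auto simp: divide_le_eq)
  finally show ?thesis
    using N by (intro exI[of _ N0]) simp
qed

end

section \<open>Independent spins at a fixed time and spatial averages of the rates\<close>

context stationary_deposition
begin

lemma X_config_measurable: "0 \<le> t \<Longrightarrow> X t \<in> M \<rightarrow>\<^sub>M config_space"
  using measurable_compose[OF X_measurable measurable_S_config] .

lemma X_coordinate_measurable: "0 \<le> t \<Longrightarrow> (\<lambda>w. X t w i) \<in> M \<rightarrow>\<^sub>M count_space UNIV"
  using measurable_compose[OF X_measurable measurable_S_coordinate] .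

lemma X_spins: "0 \<le> t \<Longrightarrow> w \<in> space M \<Longrightarrow> X t w i \<in> I"
  using X_in_T T_subset unfolding configs_def by blast

lemma X_coordinate_law:
  assumes "0 \<le> t"
  shows "distr M (count_space UNIV) (\<lambda>w. X t w i) = measure_pmf q"
proof -
  have c: "(\<lambda>\<omega>. \<omega> i) \<in> config_space \<rightarrow>\<^sub>M count_space UNIV"
    unfolding config_space_def by (rule measurable_component_singleton) simp
  have "distr M (count_space UNIV) (\<lambda>w. X t w i) = distr (distr M config_space (X t)) (count_space UNIV) (\<lambda>\<omega>. \<omega> i)"
    using X_config_measurable[OF assms] c by (simp add: distr_distr comp_def)
  also have "\<dots> = distr (PiM UNIV (\<lambda>_. measure_pmf q)) (count_space UNIV) (\<lambda>\<omega>. \<omega> i)"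
    by (simp only: X_law[OF assms] product_law_eq)
  also have "\<dots> = distr (PiM UNIV (\<lambda>_. measure_pmf q)) (measure_pmf q) (\<lambda>\<omega>. \<omega> i)"
    by (rule distr_cong) auto
  also have "\<dots> = measure_pmf q"
    by (intro distr_PiM_component measure_pmf.prob_space_axioms) auto
  finally show ?thesis .
qed

lemma X_coordinates_indep:
  assumes "0 \<le> t"
  shows "indep_vars (\<lambda>_. count_space UNIV) (\<lambda>i w. X t w i) UNIV"
proof (subst indep_vars_iff_distr_eq_PiM)
  have "distr M (PiM UNIV (\<lambda>i. count_space UNIV)) (\<lambda>w. \<lambda>i\<in>UNIV. X t w i) = \<nu>"
    using X_law[OF assms] unfolding config_space_def by (simp add: restrict_UNIV)
  also have "\<dots> = PiM UNIV (\<lambda>i. distr M (count_space UNIV) (\<lambda>w. X t w i))"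
    unfolding product_law_eq by (intro PiM_cong refl) (simp add: X_coordinate_law[OF assms])
  finally show "distr M (PiM UNIV (\<lambda>i. count_space UNIV)) (\<lambda>w. \<lambda>i\<in>UNIV. X t w i) =
    PiM UNIV (\<lambda>i. distr M (count_space UNIV) (\<lambda>w. X t w i))" .
qed (use X_coordinate_measurable[OF assms] in auto)

lemma nn_integral_X_cong:
  assumes "g \<in> borel_measurable config_space" "0 \<le> s" "0 \<le> t"
  shows "(\<integral>\<^sup>+w. g (X s w) \<partial>M) = (\<integral>\<^sup>+w. g (X t w) \<partial>M)"
proof -
  have "(\<integral>\<^sup>+w. g (X u w) \<partial>M) = (\<integral>\<^sup>+\<omega>. g \<omega> \<partial>\<nu>)" if "0 \<le> u" for u
    unfolding X_law[OF that, symmetric] using assms(1) by (intro nn_integral_distr[symmetric] X_config_measurable[OF that]) simp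
  then show ?thesis
    using assms by simp
qed

abbreviation rate :: "int \<Rightarrow> config \<Rightarrow> real" where
  "rate i \<omega> \<equiv> r (\<omega> i) (\<omega> (i + 1))"

text \<open>The product of two countable discrete spaces is discrete, so the rates, on which no
  measurability is assumed, are harmless.\<close>

lemma measurable_two_coordinates:
  fixes g :: "int \<Rightarrow> int \<Rightarrow> 'b"
  assumes "(\<lambda>w. a w) \<in> N \<rightarrow>\<^sub>M count_space UNIV" "(\<lambda>w. b w) \<in> N \<rightarrow>\<^sub>M count_space UNIV"
    and "\<And>x y. g x y \<in> space L"
  shows "(\<lambda>w. g (a w) (b w)) \<in> N \<rightarrow>\<^sub>M L"
proof -
  have "(\<lambda>y. g x y) \<in> count_space UNIV \<rightarrow>\<^sub>M L" for x
    using assms(3) by auto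
  then have "(\<lambda>p. g (fst p) (snd p)) \<in> count_space UNIV \<Otimes>\<^sub>M count_space UNIV \<rightarrow>\<^sub>M L"
    using assms(3) by (subst pair_measure_countable) auto
  from measurable_compose[OF measurable_Pair[OF assms(1,2)] this] show ?thesis
    by simp
qed

lemma rate_measurable_S: "rate i \<in> borel_measurable S"
  by (rule measurable_two_coordinates[OF measurable_S_coordinate measurable_S_coordinate]) simp

lemma rate_measurable_config: "rate i \<in> borel_measurable config_space"
  unfolding config_space_def by (rule measurable_two_coordinates) (auto intro: measurable_component_singleton)

lemma rate_measurable: "0 \<le> t \<Longrightarrow> (\<lambda>w. rate i (X t w)) \<in> borel_measurable M"
  using measurable_compose[OF X_config_measurable rate_measurable_config] .

lemma rate_nonneg: "\<eta> \<in> T \<Longrightarrow> 0 \<le> rate i \<eta>"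
  using T_subset r_nonneg unfolding configs_def by blast

lemma rate_X_nonneg: "0 \<le> t \<Longrightarrow> w \<in> space M \<Longrightarrow> 0 \<le> rate i (X t w)"
  using rate_nonneg X_in_T by blast

text \<open>Independence of two neighbouring spins. The right-hand side depends on neither the time
  nor the bond, which gives the common law and the common mean of all rates.\<close>

lemma nn_integral_bond:
  fixes g :: "int \<Rightarrow> int \<Rightarrow> ennreal"
  assumes "0 \<le> t"
  shows "(\<integral>\<^sup>+w. g (X t w i) (X t w (i + 1)) \<partial>M) = (\<integral>\<^sup>+x. \<integral>\<^sup>+y. g x y \<partial>measure_pmf q \<partial>measure_pmf q)"
proof -
  let ?C = "count_space UNIV :: int measure"
  have m: "(\<lambda>w. X t w j) \<in> M \<rightarrow>\<^sub>M ?C" for j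
    by (rule X_coordinate_measurable[OF assms])
  have "indep_var (PiM {i} (\<lambda>_. ?C)) (\<lambda>w. restrict (\<lambda>k. X t w k) {i}) (PiM {i + 1} (\<lambda>_. ?C)) (\<lambda>w. restrict (\<lambda>k. X t w k) {i + 1})"
    by (rule indep_var_restrict[OF X_coordinates_indep[OF assms]]) auto
  then have "indep_var ?C ((\<lambda>\<omega>. \<omega> i) \<circ> (\<lambda>w. restrict (\<lambda>k. X t w k) {i})) ?C ((\<lambda>\<omega>. \<omega> (i + 1)) \<circ> (\<lambda>w. restrict (\<lambda>k. X t w k) {i + 1}))"
    by (rule indep_var_compose) (auto intro: measurable_component_singleton)
  then have "indep_var ?C (\<lambda>w. X t w i) ?C (\<lambda>w. X t w (i + 1))"
    by (simp add: comp_def)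
  then have "measure_pmf q \<Otimes>\<^sub>M measure_pmf q = distr M (?C \<Otimes>\<^sub>M ?C) (\<lambda>w. (X t w i, X t w (i + 1)))"
    unfolding indep_var_distribution_eq X_coordinate_law[OF assms] by simp
  moreover have mg: "(\<lambda>p. g (fst p) (snd p)) \<in> borel_measurable (?C \<Otimes>\<^sub>M ?C)"
    by (subst pair_measure_countable) auto
  ultimately have "(\<integral>\<^sup>+p. g (fst p) (snd p) \<partial>(measure_pmf q \<Otimes>\<^sub>M measure_pmf q)) = (\<integral>\<^sup>+w. g (X t w i) (X t w (i + 1)) \<partial>M)"
    using nn_integral_distr[OF measurable_Pair[OF m m], of "\<lambda>p. g (fst p) (snd p)" i "i + 1"] by simp
  moreover have "sets (measure_pmf q \<Otimes>\<^sub>M measure_pmf q) = sets (?C \<Otimes>\<^sub>M ?C)"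
    by (intro sets_pair_measure_cong) auto
  then have "(\<lambda>p. g (fst p) (snd p)) \<in> borel_measurable (measure_pmf q \<Otimes>\<^sub>M measure_pmf q)"
    using mg by (simp cong: measurable_cong_sets)
  then have "(\<integral>\<^sup>+p. g (fst p) (snd p) \<partial>(measure_pmf q \<Otimes>\<^sub>M measure_pmf q)) = (\<integral>\<^sup>+x. \<integral>\<^sup>+y. g x y \<partial>measure_pmf q \<partial>measure_pmf q)"
    by (subst measure_pmf.nn_integral_fst[symmetric]) simp_all
  ultimately show ?thesis by simp
qed

lemma nn_integral_rate_finite: "0 \<le> t \<Longrightarrow> (\<integral>\<^sup>+w. ennreal (rate i (X t w)) \<partial>M) < \<infinity>"
  using nn_integral_bond[of t "\<lambda>x y. ennreal (r x y)" i] q_r_integrable by simp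

definition flux :: real where
  "flux = expectation (\<lambda>w. r (X 0 w 0) (X 0 w 1))"

lemma rate_integrable: "0 \<le> t \<Longrightarrow> integrable M (\<lambda>w. rate i (X t w))"
  by (intro integrableI_nonneg rate_measurable nn_integral_rate_finite AE_I2 rate_X_nonneg)

lemma rate_expectation: "0 \<le> t \<Longrightarrow> expectation (\<lambda>w. rate i (X t w)) = flux"
proof -
  have *: "expectation (\<lambda>w. rate i (X t w)) = enn2real (\<integral>\<^sup>+x. \<integral>\<^sup>+y. ennreal (r x y) \<partial>measure_pmf q \<partial>measure_pmf q)"
    if t: "0 \<le> t" for i t
  proof -
    have "expectation (\<lambda>w. rate i (X t w)) = enn2real (\<integral>\<^sup>+w. ennreal (rate i (X t w)) \<partial>M)"
      using t by (intro integral_eq_nn_integral rate_measurable AE_I2 rate_X_nonneg)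
    then show ?thesis
      using nn_integral_bond[OF t, of "\<lambda>x y. ennreal (r x y)" i] by simp
  qed
  assume "0 \<le> t"
  then show ?thesis
    using *[of t i] *[of 0 0] unfolding flux_def by simp
qed

lemma flux_nonneg: "0 \<le> flux"
  unfolding flux_def using X_spins[of 0] by (intro integral_nonneg_AE AE_I2 r_nonneg) auto

text \<open>The even bonds occupy disjoint pairs of sites, so their rates are independent and
  identically distributed. The law of large numbers is used at time \<open>0\<close> only;
  stationarity of the one-time law then makes a single \<open>N\<close> serve all times.\<close>

lemma spatial_average_rate:
  assumes "0 < e"
  shows "\<exists>N>0. \<forall>t\<ge>0. (\<integral>\<^sup>+w. ennreal \<bar>(\<Sum>j<N. rate (2 * int j) (X t w)) / real N - flux\<bar> \<partial>M) \<le> ennreal e"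
proof -
  let ?C = "count_space UNIV :: int measure"
  define Y where "Y j w = rate (2 * int j) (X 0 w)" for j w
  have Ym [measurable]: "Y j \<in> borel_measurable M" for j
    unfolding Y_def by (rule rate_measurable) simp
  have indep: "indep_vars (\<lambda>_. borel) Y UNIV"
  proof -
    have "indep_vars (\<lambda>j. PiM {2 * int j, 2 * int j + 1} (\<lambda>_. ?C))
      (\<lambda>j w. restrict (\<lambda>i. X 0 w i) {2 * int j, 2 * int j + 1}) UNIV"
    proof (rule indep_vars_restrict[OF X_coordinates_indep])
      show "disjoint_family (\<lambda>j. {2 * int j, 2 * int j + 1})"
        unfolding disjoint_family_on_def by (auto; presburger)
    qed auto
    from indep_vars_compose2[OF this, of "\<lambda>j \<omega>. rate (2 * int j) \<omega>" "\<lambda>_. borel"]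
    have "indep_vars (\<lambda>_. borel) (\<lambda>j w. rate (2 * int j) (restrict (\<lambda>i. X 0 w i) {2 * int j, 2 * int j + 1})) UNIV"
      by (simp add: measurable_two_coordinates measurable_component_singleton)
    then show ?thesis
      unfolding Y_def[abs_def] by simp
  qed
  have law: "distr M borel (Y j) = distr M borel (Y 0)" for j
  proof (rule measure_eqI)
    fix A assume "A \<in> sets (distr M borel (Y j))"
    then have A [measurable]: "A \<in> sets borel" by simp
    have *: "emeasure (distr M borel (Y j)) A = (\<integral>\<^sup>+x. \<integral>\<^sup>+y. indicator A (r x y) \<partial>measure_pmf q \<partial>measure_pmf q)" for j
    proof -
      have "(\<integral>\<^sup>+w. indicator A (Y j w) \<partial>M) = (\<integral>\<^sup>+x. \<integral>\<^sup>+y. indicator A (r x y) \<partial>measure_pmf q \<partial>measure_pmf q)"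
        unfolding Y_def by (rule nn_integral_bond) simp
      moreover have "emeasure (distr M borel (Y j)) A = (\<integral>\<^sup>+w. indicator A (Y j w) \<partial>M)"
        using nn_integral_distr[of "Y j" M borel "indicator A"] by simp
      ultimately show ?thesis by simp
    qed
    show "emeasure (distr M borel (Y j)) A = emeasure (distr M borel (Y 0)) A"
      unfolding * ..
  qed simp
  have intY: "integrable M (Y j)" for j
    unfolding Y_def by (rule rate_integrable) simp
  have flux: "expectation (Y 0) = flux"
    unfolding Y_def by (rule rate_expectation) simp
  obtain N where N: "0 < N" "expectation (\<lambda>w. \<bar>(\<Sum>j<N. Y j w) / real N - flux\<bar>) \<le> e"
    using L1_law_of_large_numbers[OF indep intY law assms] unfolding flux by blast
  have "(\<integral>\<^sup>+w. ennreal \<bar>(\<Sum>j<N. rate (2 * int j) (X t w)) / real N - flux\<bar> \<partial>M) \<le> ennreal e" if t: "0 \<le> t" for t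
  proof -
    have [measurable]: "rate i \<in> borel_measurable config_space" for i
      by (rule rate_measurable_config)
    have "(\<lambda>\<omega>. ennreal \<bar>(\<Sum>j<N. rate (2 * int j) \<omega>) / real N - flux\<bar>) \<in> borel_measurable config_space"
      by measurable
    from nn_integral_X_cong[OF this t order_refl]
    have "(\<integral>\<^sup>+w. ennreal \<bar>(\<Sum>j<N. rate (2 * int j) (X t w)) / real N - flux\<bar> \<partial>M) =
      (\<integral>\<^sup>+w. ennreal \<bar>(\<Sum>j<N. Y j w) / real N - flux\<bar> \<partial>M)"
      unfolding Y_def .
    also have "\<dots> = ennreal (expectation (\<lambda>w. \<bar>(\<Sum>j<N. Y j w) / real N - flux\<bar>))"
      using intY by (intro nn_integral_eq_integral) auto
    finally show ?thesis
      using N(2) by (simp add: ennreal_leI)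
  qed
  then show ?thesis using N(1) by blast
qed

section \<open>Moments of centred sums of spins\<close>

definition mean_spin :: real where
  "mean_spin = expectation (\<lambda>w. of_int (X 0 w 0))"

lemma X_square_integrable: "0 \<le> t \<Longrightarrow> integrable M (\<lambda>w. (of_int (X t w i) :: real)\<^sup>2)"
  using q_square_integrable integrable_distr_eq[OF X_coordinate_measurable, of t "\<lambda>z. (of_int z :: real)\<^sup>2" i]
  by (simp add: X_coordinate_law)

lemma X_integrable: "0 \<le> t \<Longrightarrow> integrable M (\<lambda>w. of_int (X t w i) :: real)"
proof -
  assume t: "0 \<le> t"
  have m: "(\<lambda>w. of_int (X t w i) :: real) \<in> borel_measurable M"
    by (rule measurable_compose[OF X_coordinate_measurable[OF t]]) simp
  have "integrable M (\<lambda>w. 1 + (of_int (X t w i) :: real)\<^sup>2)"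
    using X_square_integrable[OF t, of i] by simp
  from this m show ?thesis
  proof (rule Bochner_Integration.integrable_bound)
    have "\<bar>x\<bar> \<le> \<bar>1 + x\<^sup>2\<bar>" for x :: real
      using sum_squares_bound[of "\<bar>x\<bar>" 1] by (simp add: abs_mult)
    then show "AE w in M. norm (of_int (X t w i) :: real) \<le> norm (1 + (of_int (X t w i) :: real)\<^sup>2)"
      by simp
  qed
qed

lemma X_expectation: "0 \<le> t \<Longrightarrow> expectation (\<lambda>w. of_int (X t w i)) = mean_spin"
  unfolding mean_spin_def
  using integral_distr[OF X_coordinate_measurable, of t "of_int :: int \<Rightarrow> real" i]
    integral_distr[OF X_coordinate_measurable, of 0 "of_int :: int \<Rightarrow> real" 0]
  by (simp add: X_coordinate_law)

lemma centered_sum_second_moment: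
  "\<exists>C>0. \<forall>t\<ge>0. \<forall>A. finite A \<longrightarrow> integrable M (\<lambda>w. (\<Sum>i\<in>A. of_int (X t w i) - mean_spin)\<^sup>2) \<and>
    expectation (\<lambda>w. (\<Sum>i\<in>A. of_int (X t w i) - mean_spin)\<^sup>2) \<le> C * real (card A)"
proof -
  \<comment> \<open>The variance of a spin is \<open>C - 1\<close>; the added \<open>1\<close> makes
    \<open>C\<close> positive without an argument that the spin is random.\<close>
  define C where "C = expectation (\<lambda>w. (of_int (X 0 w 0) - mean_spin)\<^sup>2) + 1"
  define D where "D t i w = (of_int (X t w i) - mean_spin :: real)" for t i w
  have Dm: "D t i \<in> borel_measurable M" if "0 \<le> t" for t i
    unfolding D_def using X_integrable[OF that, of i] by auto
  have sq: "integrable M (\<lambda>w. (D t i w)\<^sup>2)" if "0 \<le> t" for t i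
    unfolding D_def power2_diff using X_square_integrable[OF that, of i] X_integrable[OF that, of i] by auto
  have law: "expectation (\<lambda>w. (D t i w)\<^sup>2) = C - 1" if "0 \<le> t" for t i
    unfolding C_def D_def
    using integral_distr[OF X_coordinate_measurable[OF that], of "\<lambda>z. (of_int z - mean_spin :: real)\<^sup>2" i]
      integral_distr[OF X_coordinate_measurable[OF order_refl], of "\<lambda>z. (of_int z - mean_spin :: real)\<^sup>2" 0]
    by (simp add: X_coordinate_law that)
  have C: "0 < C"
    unfolding C_def by (intro add_nonneg_pos integral_nonneg_AE) auto
  have "integrable M (\<lambda>w. (\<Sum>i\<in>A. D t i w)\<^sup>2) \<and> expectation (\<lambda>w. (\<Sum>i\<in>A. D t i w)\<^sup>2) \<le> C * real (card A)"
    if t: "0 \<le> t" and A: "finite A" for t A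
  proof -
    have int: "integrable M (D t i)" for i
      unfolding D_def using X_integrable[OF t, of i] by auto
    have mean: "expectation (D t i) = 0" for i
      unfolding D_def using X_integrable[OF t, of i] by (simp add: X_expectation[OF t] prob_space)
    have prod: "integrable M (\<lambda>w. D t i w * D t j w)" "expectation (\<lambda>w. D t i w * D t j w) = (if i = j then C - 1 else 0)" for i j
    proof -
      have "integrable M (\<lambda>w. D t i w * D t j w) \<and> expectation (\<lambda>w. D t i w * D t j w) = (if i = j then C - 1 else 0)"
      proof (cases "i = j")
        case True
        then show ?thesis
          using sq[OF t, of i] law[OF t, of i] by (simp add: power2_eq_square)
      next
        case False
        have ind: "indep_vars (\<lambda>_. borel) (D t) {i, j}"
          unfolding D_def[abs_def]
          by (rule indep_vars_compose2[where Y = "\<lambda>_ z. of_int z - mean_spin", OF indep_vars_subset[OF X_coordinates_indep[OF t]]]) auto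
        show ?thesis
          using indep_vars_lebesgue_integral[OF _ ind] indep_vars_integrable[OF _ ind] int mean False by simp
      qed
      then show "integrable M (\<lambda>w. D t i w * D t j w)" "expectation (\<lambda>w. D t i w * D t j w) = (if i = j then C - 1 else 0)"
        by auto
    qed
    have "expectation (\<lambda>w. (\<Sum>i\<in>A. D t i w)\<^sup>2) = (\<Sum>i\<in>A. C - 1)"
      using expectation_square_sum_orthogonal(2)[OF A, of "D t"] prod law[OF t] by simp
    then show ?thesis
      using expectation_square_sum_orthogonal(1)[OF A, of "D t"] prod by (simp add: algebra_simps)
  qed
  then show ?thesis
    using C unfolding D_def by blast
qed

end

section \<open>Jump probabilities over short times\<close>

lemma jump_other:
  "k \<noteq> i \<Longrightarrow> k \<noteq> i - 1 \<Longrightarrow> jump k \<zeta> i = \<zeta> i"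
  unfolding jump_def by auto

text \<open>The test reads the sites \<open>i\<close> and \<open>i + 1\<close>, which are touched by
  three bonds; the infinite sum of the generator collapses to them.\<close>

lemma generator_bond_jump:
  "generator r (\<lambda>\<zeta>. of_bool (bond_jump i \<eta> \<zeta>)) \<zeta> =
    (\<Sum>k\<in>{i - 1, i, i + 1}. r (\<zeta> k) (\<zeta> (k + 1)) * (of_bool (bond_jump i \<eta> (jump k \<zeta>)) - of_bool (bond_jump i \<eta> \<zeta>)))"
proof -
  have "bond_jump i \<eta> (jump k \<zeta>) \<longleftrightarrow> bond_jump i \<eta> \<zeta>" if "k \<notin> {i - 1, i, i + 1}" for k
    using that jump_other[of k i \<zeta>] jump_other[of k "i + 1" \<zeta>] unfolding bond_jump_def by simp
  then show ?thesis
    unfolding generator_def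
    by (subst infsum_cong_neutral[where T = "{i - 1, i, i + 1}"
        and g = "\<lambda>k. r (\<zeta> k) (\<zeta> (k + 1)) * (of_bool (bond_jump i \<eta> (jump k \<zeta>)) - of_bool (bond_jump i \<eta> \<zeta>))"]) auto
qed

text \<open>From \<open>\<eta>\<close> itself, of the three relevant bonds only bond
  \<open>i\<close> produces the pattern, so the generator of the test at \<open>\<eta>\<close>
  equals the rate of that bond.\<close>

lemma bond_jump_self:
  "bond_jump i \<eta> (jump i \<eta>)" "\<not> bond_jump i \<eta> (jump (i - 1) \<eta>)" "\<not> bond_jump i \<eta> (jump (i + 1) \<eta>)" "\<not> bond_jump i \<eta> \<eta>"
  unfolding bond_jump_def jump_def by auto

text \<open>The four sites are those read by the rates of the bonds \<open>i - 1\<close>,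
  \<open>i\<close>, \<open>i + 1\<close>.\<close>

definition window_changed :: "int \<Rightarrow> config \<Rightarrow> config \<Rightarrow> bool" where
  "window_changed i \<eta> \<zeta> \<longleftrightarrow> (\<exists>j\<in>{i - 1..i + 2}. \<zeta> j \<noteq> \<eta> j)"

context stationary_deposition
begin

abbreviation local_rate :: "int \<Rightarrow> config \<Rightarrow> real" where
  "local_rate i \<omega> \<equiv> rate (i - 1) \<omega> + rate i \<omega> + rate (i + 1) \<omega>"

lemma local_rate_nonneg: "\<eta> \<in> T \<Longrightarrow> 0 \<le> local_rate i \<eta>"
  by (intro add_nonneg_nonneg rate_nonneg)

lemma local_rate_cong: "\<not> window_changed i \<eta> \<zeta> \<Longrightarrow> local_rate i \<zeta> = local_rate i \<eta>"
  unfolding window_changed_def by auto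

lemma local_rate_measurable_S: "local_rate i \<in> borel_measurable S"
  by (intro borel_measurable_add rate_measurable_S)

abbreviation bond_generator :: "int \<Rightarrow> config \<Rightarrow> config \<Rightarrow> real" where
  "bond_generator i \<eta> \<equiv> generator r (\<lambda>\<zeta>. of_bool (bond_jump i \<eta> \<zeta>))"

lemma abs_bond_generator_le: "\<zeta> \<in> T \<Longrightarrow> \<bar>bond_generator i \<eta> \<zeta>\<bar> \<le> local_rate i \<zeta>"
proof -
  assume \<zeta>: "\<zeta> \<in> T"
  have "\<bar>bond_generator i \<eta> \<zeta>\<bar> \<le> (\<Sum>k\<in>{i - 1, i, i + 1}. \<bar>rate k \<zeta> * (of_bool (bond_jump i \<eta> (jump k \<zeta>)) - of_bool (bond_jump i \<eta> \<zeta>))\<bar>)"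
    unfolding generator_bond_jump by (rule sum_abs)
  also have "\<dots> \<le> (\<Sum>k\<in>{i - 1, i, i + 1}. rate k \<zeta>)"
    using rate_nonneg[OF \<zeta>] by (intro sum_mono) (auto simp: of_bool_def)
  finally show ?thesis by simp
qed

lemma bond_generator_unchanged:
  assumes "\<not> window_changed i \<eta> \<zeta>"
  shows "bond_generator i \<eta> \<zeta> = rate i \<eta>"
proof -
  have eq: "\<zeta> j = \<eta> j" if "j \<in> {i - 1..i + 2}" for j
    using assms that unfolding window_changed_def by auto
  have "bond_jump i \<eta> (jump k \<zeta>) \<longleftrightarrow> bond_jump i \<eta> (jump k \<eta>)" "bond_jump i \<eta> \<zeta> \<longleftrightarrow> bond_jump i \<eta> \<eta>" for k
    unfolding bond_jump_def jump_def using eq by auto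
  then show ?thesis
    unfolding generator_bond_jump using bond_jump_self[of i \<eta>] eq by simp
qed

text \<open>Exact while the window is unchanged; otherwise generator and rate are bounded separately
  by the local rates at the two configurations.\<close>

lemma bond_generator_error:
  assumes "\<eta> \<in> T" "\<zeta> \<in> T"
  shows "\<bar>bond_generator i \<eta> \<zeta> - rate i \<eta>\<bar> \<le> of_bool (window_changed i \<eta> \<zeta>) * (local_rate i \<eta> + local_rate i \<zeta>)"
  using abs_bond_generator_le[OF assms(2), of i \<eta>] bond_generator_unchanged[of i \<eta> \<zeta>]
    rate_nonneg[OF assms(1), of i] rate_nonneg[OF assms(1), of "i - 1"] rate_nonneg[OF assms(1), of "i + 1"]
  by (cases "window_changed i \<eta> \<zeta>") auto

lemma bond_generator_measurable: "bond_generator i \<eta> \<in> borel_measurable S"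
proof -
  have [measurable]: "rate k \<in> borel_measurable S" for k
    by (rule rate_measurable_S)
  have jm: "(\<lambda>\<zeta>. of_bool (bond_jump i \<eta> (jump k \<zeta>)) :: real) \<in> borel_measurable S" for k
    unfolding bond_jump_def jump_def
    by (rule measurable_two_coordinates[OF measurable_S_coordinate[of i] measurable_S_coordinate[of "i + 1"],
        of "\<lambda>x y. of_bool ((if i = k then x - 1 else if i = k + 1 then x + 1 else x) = \<eta> i - 1 \<and>
            (if i + 1 = k then y - 1 else if i + 1 = k + 1 then y + 1 else y) = \<eta> (i + 1) + 1)"]) simp
  have im: "(\<lambda>\<zeta>. of_bool (bond_jump i \<eta> \<zeta>) :: real) \<in> borel_measurable S"
    unfolding bond_jump_def
    by (rule measurable_two_coordinates[OF measurable_S_coordinate[of i] measurable_S_coordinate[of "i + 1"],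
        of "\<lambda>x y. of_bool (x = \<eta> i - 1 \<and> y = \<eta> (i + 1) + 1)"]) simp
  show ?thesis
    unfolding generator_bond_jump[abs_def] using jm im by measurable
qed

lemma coordinate_pair_measurable:
  "(\<lambda>p. fst p j) \<in> S \<Otimes>\<^sub>M S \<rightarrow>\<^sub>M count_space UNIV" "(\<lambda>p. snd p j) \<in> S \<Otimes>\<^sub>M S \<rightarrow>\<^sub>M count_space UNIV"
  by (rule measurable_compose[OF measurable_fst measurable_S_coordinate] measurable_compose[OF measurable_snd measurable_S_coordinate])+

lemma bond_jump_measurable: "Measurable.pred (S \<Otimes>\<^sub>M S) (\<lambda>p. bond_jump i (fst p) (snd p))"
proof -
  have "Measurable.pred (S \<Otimes>\<^sub>M S) (\<lambda>p. snd p j = fst p j + c)" for j c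
    by (rule measurable_two_coordinates[OF coordinate_pair_measurable(1) coordinate_pair_measurable(2),
        of "\<lambda>x y. y = x + c"]) simp
  from pred_intros_logic(3)[OF this[of i "-1"] this[of "i + 1" 1]] show ?thesis
    unfolding bond_jump_def by simp
qed

lemma window_changed_measurable: "Measurable.pred (S \<Otimes>\<^sub>M S) (\<lambda>p. window_changed i (fst p) (snd p))"
proof -
  have "Measurable.pred (S \<Otimes>\<^sub>M S) (\<lambda>p. snd p j \<noteq> fst p j)" for j
    by (rule measurable_two_coordinates[OF coordinate_pair_measurable(1) coordinate_pair_measurable(2),
        of "\<lambda>x y. y \<noteq> x"]) simp
  then show ?thesis
    unfolding window_changed_def by (intro pred_intros_finite) auto
qed

section \<open>Comparison of jump probability and rate\<close>

definition jump_probability :: "int \<Rightarrow> real \<Rightarrow> config \<Rightarrow> real" where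
  "jump_probability i d \<eta> = measure (K d \<eta>) {\<zeta> \<in> T. bond_jump i \<eta> \<zeta>}"

text \<open>Written as a function of the pair of configurations so that
  \<open>markov_property\<close> can replace the kernel integral by an expectation along the
  process.\<close>

definition error_density :: "int \<Rightarrow> config \<times> config \<Rightarrow> ennreal" where
  "error_density i p = ennreal (of_bool (window_changed i (fst p) (snd p)) * (local_rate i (fst p) + local_rate i (snd p)))"

lemma error_density_measurable: "error_density i \<in> borel_measurable (S \<Otimes>\<^sub>M S)"
proof -
  have "(\<lambda>p. local_rate i (fst p)) \<in> borel_measurable (S \<Otimes>\<^sub>M S)" "(\<lambda>p. local_rate i (snd p)) \<in> borel_measurable (S \<Otimes>\<^sub>M S)"
    using measurable_compose[OF measurable_fst local_rate_measurable_S] measurable_compose[OF measurable_snd local_rate_measurable_S]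
    by auto
  then show ?thesis
    unfolding error_density_def[abs_def] using window_changed_measurable[of i] by measurable
qed

lemma time_measurable: "(\<lambda>s. s) \<in> restrict_space lborel {0..d} \<rightarrow>\<^sub>M restrict_space borel {0..}"
  by (rule measurable_restrict_space3) auto

lemma K_time_measurable:
  assumes "\<eta> \<in> T"
  shows "(\<lambda>s. K s \<eta>) \<in> restrict_space lborel {0..d} \<rightarrow>\<^sub>M subprob_algebra S"
proof -
  have "(\<lambda>s. (s, \<eta>)) \<in> restrict_space lborel {0..d} \<rightarrow>\<^sub>M restrict_space borel {0..} \<Otimes>\<^sub>M S"
    using assms by (intro measurable_Pair time_measurable measurable_const) (simp add: space_S)
  from measurable_compose[OF this K_jointly_measurable] show ?thesis
    by simp
qed

lemma error_integral_measurable: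
  "(\<lambda>(s, w). \<integral>\<^sup>+\<zeta>. error_density i (X 0 w, \<zeta>) \<partial>K s (X 0 w)) \<in> borel_measurable (restrict_space lborel {0..d} \<Otimes>\<^sub>M M)"
proof -
  let ?L = "restrict_space borel {0..} \<Otimes>\<^sub>M S :: (real \<times> config) measure"
  have "(\<lambda>x. (snd (fst x), snd x)) \<in> ?L \<Otimes>\<^sub>M S \<rightarrow>\<^sub>M S \<Otimes>\<^sub>M S"
    by measurable
  from measurable_compose[OF this error_density_measurable]
  have "(\<lambda>(p, \<zeta>). error_density i (snd p, \<zeta>)) \<in> borel_measurable (?L \<Otimes>\<^sub>M S)"
    by (simp add: case_prod_beta)
  from nn_integral_measurable_subprob_algebra2[OF this K_jointly_measurable]
  have G: "(\<lambda>p. \<integral>\<^sup>+\<zeta>. error_density i (snd p, \<zeta>) \<partial>K (fst p) (snd p)) \<in> borel_measurable ?L" .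
  have "(\<lambda>p. (fst p, X 0 (snd p))) \<in> restrict_space lborel {0..d} \<Otimes>\<^sub>M M \<rightarrow>\<^sub>M ?L"
    by (intro measurable_Pair measurable_compose[OF measurable_fst time_measurable] measurable_compose[OF measurable_snd X_measurable]) simp
  from measurable_compose[OF this G] show ?thesis
    by (simp add: case_prod_beta)
qed

text \<open>Ensures that the integrals in Dynkin's formula are genuine and not the default value
  \<open>0\<close> of a non-integrable function.\<close>

lemma rate_time_integral_finite:
  assumes "\<eta> \<in> T" "0 \<le> d"
  shows "(\<integral>\<^sup>+s. (\<integral>\<^sup>+\<zeta>. ennreal (local_rate i \<zeta>) \<partial>K s \<eta>) \<partial>restrict_space lborel {0..d}) < \<infinity>"
proof -
  let ?N = "restrict_space lborel {0..d}"
  have fin: "(\<integral>\<^sup>+s. (\<integral>\<^sup>+\<zeta>. ennreal (rate k \<zeta>) \<partial>K s \<eta>) \<partial>?N) < top" for k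
    using gen assms unfolding has_generator_def by (simp add: nn_integral_restrict_space)
  have m: "(\<lambda>s. \<integral>\<^sup>+\<zeta>. ennreal (rate k \<zeta>) \<partial>K s \<eta>) \<in> borel_measurable ?N" for k
    by (rule measurable_compose[OF K_time_measurable[OF assms(1)] nn_integral_measurable_subprob_algebra])
       (intro measurable_compose_rev[OF measurable_ennreal] rate_measurable_S)
  have "(\<integral>\<^sup>+s. (\<integral>\<^sup>+\<zeta>. ennreal (local_rate i \<zeta>) \<partial>K s \<eta>) \<partial>?N) =
    (\<integral>\<^sup>+s. (\<integral>\<^sup>+\<zeta>. ennreal (rate (i - 1) \<zeta>) \<partial>K s \<eta>) + (\<integral>\<^sup>+\<zeta>. ennreal (rate i \<zeta>) \<partial>K s \<eta>) + (\<integral>\<^sup>+\<zeta>. ennreal (rate (i + 1) \<zeta>) \<partial>K s \<eta>) \<partial>?N)"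
  proof (intro nn_integral_cong)
    fix s assume "s \<in> space ?N"
    then have s: "0 \<le> s" by (simp add: space_restrict_space)
    have [measurable]: "rate k \<in> borel_measurable (K s \<eta>)" for k
      using rate_measurable_S[of k] sets_K[OF s assms(1)] by (simp cong: measurable_cong_sets)
    have "(\<integral>\<^sup>+\<zeta>. ennreal (local_rate i \<zeta>) \<partial>K s \<eta>) = (\<integral>\<^sup>+\<zeta>. ennreal (rate (i - 1) \<zeta>) + ennreal (rate i \<zeta>) + ennreal (rate (i + 1) \<zeta>) \<partial>K s \<eta>)"
    proof (intro nn_integral_cong)
      fix \<zeta> assume "\<zeta> \<in> space (K s \<eta>)"
      then have "\<zeta> \<in> T" using space_K[OF s assms(1)] by simp
      then show "ennreal (local_rate i \<zeta>) = ennreal (rate (i - 1) \<zeta>) + ennreal (rate i \<zeta>) + ennreal (rate (i + 1) \<zeta>)"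
        using rate_nonneg by (simp only: ennreal_plus add_nonneg_nonneg)
    qed
    also have "\<dots> = (\<integral>\<^sup>+\<zeta>. ennreal (rate (i - 1) \<zeta>) \<partial>K s \<eta>) + (\<integral>\<^sup>+\<zeta>. ennreal (rate i \<zeta>) \<partial>K s \<eta>) + (\<integral>\<^sup>+\<zeta>. ennreal (rate (i + 1) \<zeta>) \<partial>K s \<eta>)"
      by (subst nn_integral_add; (subst nn_integral_add)?; measurable?)
    finally show "(\<integral>\<^sup>+\<zeta>. ennreal (local_rate i \<zeta>) \<partial>K s \<eta>) = (\<integral>\<^sup>+\<zeta>. ennreal (rate (i - 1) \<zeta>) \<partial>K s \<eta>) + (\<integral>\<^sup>+\<zeta>. ennreal (rate i \<zeta>) \<partial>K s \<eta>) + (\<integral>\<^sup>+\<zeta>. ennreal (rate (i + 1) \<zeta>) \<partial>K s \<eta>)" .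
  qed
  also have "\<dots> = (\<integral>\<^sup>+s. (\<integral>\<^sup>+\<zeta>. ennreal (rate (i - 1) \<zeta>) \<partial>K s \<eta>) \<partial>?N) + (\<integral>\<^sup>+s. (\<integral>\<^sup>+\<zeta>. ennreal (rate i \<zeta>) \<partial>K s \<eta>) \<partial>?N)
      + (\<integral>\<^sup>+s. (\<integral>\<^sup>+\<zeta>. ennreal (rate (i + 1) \<zeta>) \<partial>K s \<eta>) \<partial>?N)"
    by (simp only: nn_integral_add borel_measurable_add m)
  also have "\<dots> < \<infinity>"
    by (simp only: infinity_ennreal_def ennreal_add_less_top fin simp_thms)
  finally show ?thesis .
qed

text \<open>Dynkin's formula for the test function with its reference configuration frozen at the
  starting point \<open>\<eta>\<close>, where the test gives \<open>0\<close>. The jump probability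
  is thus the time integral of the mean generator, and the integrand is compared with the rate at
  \<open>\<eta>\<close>.\<close>

lemma jump_probability_error:
  assumes \<eta>: "\<eta> \<in> T" and d: "0 \<le> d"
  shows "ennreal \<bar>jump_probability i d \<eta> - d * rate i \<eta>\<bar> \<le>
    (\<integral>\<^sup>+s. (\<integral>\<^sup>+\<zeta>. error_density i (\<eta>, \<zeta>) \<partial>K s \<eta>) \<partial>restrict_space lborel {0..d})"
proof -
  let ?N = "restrict_space lborel {0..d}"
  let ?\<phi> = "\<lambda>\<zeta>. of_bool (bond_jump i \<eta> \<zeta>) :: real"
  define F where "F s = (\<integral>\<zeta>. bond_generator i \<eta> \<zeta> \<partial>K s \<eta>)" for s
  have cyl: "cylinder ?\<phi>"
    unfolding cylinder_def bond_jump_def by (intro exI[of _ "{i, i + 1}"]) auto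
  have bd: "bounded (range ?\<phi>)"
    by (rule boundedI[of _ 1]) auto
  have space: "space (K d \<eta>) = T"
    by (rule space_K[OF d \<eta>])
  have "jump_probability i d \<eta> = (\<integral>\<zeta>. indicator {\<zeta> \<in> T. bond_jump i \<eta> \<zeta>} \<zeta> \<partial>K d \<eta>)"
    unfolding jump_probability_def using space by (simp add: Int_def conj_commute)
  also have "\<dots> = (\<integral>\<zeta>. ?\<phi> \<zeta> \<partial>K d \<eta>)"
    using space by (intro Bochner_Integration.integral_cong) (auto simp: indicator_def)
  also have "\<dots> = ?\<phi> \<eta> + (LINT s:{0..d}|lborel. F s)"
    using gen \<eta> d cyl bd unfolding has_generator_def F_def by blast
  also have "?\<phi> \<eta> = 0"
    using bond_jump_self(4)[of i \<eta>] by simp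
  also have "(LINT s:{0..d}|lborel. F s) = (\<integral>s. F s \<partial>?N)"
    unfolding set_lebesgue_integral_def by (subst integral_restrict_space) auto
  finally have p: "jump_probability i d \<eta> = (\<integral>s. F s \<partial>?N)"
    by simp
  have Fm: "F \<in> borel_measurable ?N"
    unfolding F_def[abs_def]
    by (rule measurable_compose[OF K_time_measurable[OF \<eta>] integral_measurable_subprob_algebra[OF bond_generator_measurable]])
  have Rm: "(\<lambda>s. \<integral>\<^sup>+\<zeta>. ennreal (local_rate i \<zeta>) \<partial>K s \<eta>) \<in> borel_measurable ?N"
    by (rule measurable_compose[OF K_time_measurable[OF \<eta>] nn_integral_measurable_subprob_algebra])
       (intro measurable_compose_rev[OF measurable_ennreal] local_rate_measurable_S)
  have gle: "(\<integral>\<^sup>+\<zeta>. ennreal \<bar>bond_generator i \<eta> \<zeta>\<bar> \<partial>K s \<eta>) \<le> (\<integral>\<^sup>+\<zeta>. ennreal (local_rate i \<zeta>) \<partial>K s \<eta>)" if "0 \<le> s" for s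
    using space_K[OF that \<eta>] by (intro nn_integral_mono ennreal_leI abs_bond_generator_le) auto
  have gm: "bond_generator i \<eta> \<in> borel_measurable (K s \<eta>)" if "0 \<le> s" for s
    using bond_generator_measurable[of i \<eta>] sets_K[OF that \<eta>] by (simp cong: measurable_cong_sets)
  \<comment> \<open>The expected local rate is known to be finite after integration over time, hence
    at almost every time and possibly not at all times.\<close>
  have AE: "AE s in ?N. integrable (K s \<eta>) (bond_generator i \<eta>)"
  proof -
    have "AE s in ?N. (\<integral>\<^sup>+\<zeta>. ennreal (local_rate i \<zeta>) \<partial>K s \<eta>) \<noteq> \<infinity>"
      by (rule nn_integral_PInf_AE[OF Rm less_imp_neq[OF rate_time_integral_finite[OF \<eta> d]]])
    then show ?thesis
    proof (rule AE_mp, intro AE_I2 impI)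
      fix s assume s: "s \<in> space ?N" "(\<integral>\<^sup>+\<zeta>. ennreal (local_rate i \<zeta>) \<partial>K s \<eta>) \<noteq> \<infinity>"
      then have "0 \<le> s" by (simp add: space_restrict_space)
      then show "integrable (K s \<eta>) (bond_generator i \<eta>)"
        using gle[of s] s gm[of s] unfolding integrable_iff_bounded by (auto simp: less_top order_le_less_trans)
    qed
  qed
  have Fint: "integrable ?N F"
  proof (rule integrableI_bounded[OF Fm])
    have "(\<integral>\<^sup>+s. ennreal (norm (F s)) \<partial>?N) \<le> (\<integral>\<^sup>+s. (\<integral>\<^sup>+\<zeta>. ennreal (local_rate i \<zeta>) \<partial>K s \<eta>) \<partial>?N)"
    proof (rule nn_integral_mono_AE, use AE in \<open>rule AE_mp\<close>, intro AE_I2 impI)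
      fix s assume s: "s \<in> space ?N" "integrable (K s \<eta>) (bond_generator i \<eta>)"
      then have "0 \<le> s" by (simp add: space_restrict_space)
      have "ennreal (norm (F s)) \<le> (\<integral>\<^sup>+\<zeta>. ennreal (norm (bond_generator i \<eta> \<zeta>)) \<partial>K s \<eta>)"
        unfolding F_def by (rule integral_norm_bound_ennreal[OF s(2)])
      then show "ennreal (norm (F s)) \<le> (\<integral>\<^sup>+\<zeta>. ennreal (local_rate i \<zeta>) \<partial>K s \<eta>)"
        using gle[OF \<open>0 \<le> s\<close>] by simp
    qed
    also have "\<dots> < \<infinity>"
      by (rule rate_time_integral_finite[OF \<eta> d])
    finally show "(\<integral>\<^sup>+s. ennreal (norm (F s)) \<partial>?N) < \<infinity>" .
  qed
  have mN: "measure ?N (space ?N) = d" "emeasure ?N (space ?N) = ennreal d"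
    using d by (simp_all add: measure_restrict_space emeasure_restrict_space space_restrict_space)
  have cint: "integrable ?N (\<lambda>s. c)" for c :: real
    by (rule finite_measure.integrable_const) (use mN in \<open>auto intro: finite_measureI\<close>)
  have "jump_probability i d \<eta> - d * rate i \<eta> = (\<integral>s. F s - rate i \<eta> \<partial>?N)"
    using Fint cint mN unfolding p by (subst Bochner_Integration.integral_diff) auto
  then have "ennreal \<bar>jump_probability i d \<eta> - d * rate i \<eta>\<bar> \<le> (\<integral>\<^sup>+s. ennreal (norm (F s - rate i \<eta>)) \<partial>?N)"
    using integral_norm_bound_ennreal[of ?N "\<lambda>s. F s - rate i \<eta>"] Fint cint by simp
  also have "\<dots> \<le> (\<integral>\<^sup>+s. (\<integral>\<^sup>+\<zeta>. error_density i (\<eta>, \<zeta>) \<partial>K s \<eta>) \<partial>?N)"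
  proof (rule nn_integral_mono_AE, use AE in \<open>rule AE_mp\<close>, intro AE_I2 impI)
    fix s assume s: "s \<in> space ?N" "integrable (K s \<eta>) (bond_generator i \<eta>)"
    then have s0: "0 \<le> s" by (simp add: space_restrict_space)
    interpret Ks: prob_space "K s \<eta>"
      by (rule K_prob[OF s0 \<eta>])
    have "F s - rate i \<eta> = (\<integral>\<zeta>. bond_generator i \<eta> \<zeta> - rate i \<eta> \<partial>K s \<eta>)"
      unfolding F_def using s(2) by (simp add: Ks.prob_space)
    then have "ennreal (norm (F s - rate i \<eta>)) \<le> (\<integral>\<^sup>+\<zeta>. ennreal (norm (bond_generator i \<eta> \<zeta> - rate i \<eta>)) \<partial>K s \<eta>)"
      using integral_norm_bound_ennreal[of "K s \<eta>" "\<lambda>\<zeta>. bond_generator i \<eta> \<zeta> - rate i \<eta>"] s(2) by simp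
    also have "\<dots> \<le> (\<integral>\<^sup>+\<zeta>. error_density i (\<eta>, \<zeta>) \<partial>K s \<eta>)"
      unfolding error_density_def
      using space_K[OF s0 \<eta>] bond_generator_error[OF \<eta>] by (intro nn_integral_mono ennreal_leI) simp
    finally show "ennreal (norm (F s - rate i \<eta>)) \<le> (\<integral>\<^sup>+\<zeta>. error_density i (\<eta>, \<zeta>) \<partial>K s \<eta>)" .
  qed
  finally show ?thesis .
qed

definition changed_mass :: "int \<Rightarrow> real \<Rightarrow> ennreal" where
  "changed_mass i s = (\<integral>\<^sup>+w. ennreal (of_bool (window_changed i (X 0 w) (X s w)) * local_rate i (X 0 w)) \<partial>M)"

lemma local_rate_X_nonneg: "0 \<le> s \<Longrightarrow> w \<in> space M \<Longrightarrow> 0 \<le> local_rate i (X s w)"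
  using local_rate_nonneg X_in_T by blast

lemma local_rate_X_measurable: "0 \<le> s \<Longrightarrow> (\<lambda>w. local_rate i (X s w)) \<in> borel_measurable M"
  by (intro borel_measurable_add rate_measurable)

lemma local_rate_X_integrable: "0 \<le> s \<Longrightarrow> integrable M (\<lambda>w. local_rate i (X s w))"
  by (intro Bochner_Integration.integrable_add rate_integrable)

lemma window_changed_X_measurable:
  assumes "0 \<le> s"
  shows "(\<lambda>w. of_bool (window_changed i (X 0 w) (X s w)) :: real) \<in> borel_measurable M"
proof -
  have "(\<lambda>w. (X 0 w, X s w)) \<in> M \<rightarrow>\<^sub>M S \<Otimes>\<^sub>M S"
    by (intro measurable_Pair X_measurable assms) simp
  from measurable_compose[OF this window_changed_measurable[of i]]
  have "Measurable.pred M (\<lambda>w. window_changed i (X 0 w) (X s w))"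
    by simp
  then show ?thesis by measurable
qed

text \<open>By stationarity the total local rate at time \<open>s\<close> has the same mean as at time \<open>0\<close>, and the two agree
  where the window is unchanged; so they have the same mass where the window has changed.\<close>

lemma error_density_mean:
  assumes s: "0 \<le> s"
  shows "(\<integral>\<^sup>+w. error_density i (X 0 w, X s w) \<partial>M) = 2 * changed_mass i s"
proof -
  let ?c = "\<lambda>w. of_bool (window_changed i (X 0 w) (X s w)) :: real"
  let ?R = "\<lambda>u w. local_rate i (X u w)"
  note [measurable] = window_changed_X_measurable[OF s, of i] local_rate_X_measurable[OF s, of i] local_rate_X_measurable[OF order_refl, of i]
  have bound: "integrable M (\<lambda>w. ?c w * ?R u w)" if "u = 0 \<or> u = s" for u
  proof (rule Bochner_Integration.integrable_bound)
    show "integrable M (?R u)"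
      using that s by (intro local_rate_X_integrable) auto
    show "(\<lambda>w. ?c w * ?R u w) \<in> borel_measurable M"
      using that s by (intro borel_measurable_times window_changed_X_measurable local_rate_X_measurable) auto
    show "AE w in M. norm (?c w * ?R u w) \<le> norm (?R u w)"
      by (intro AE_I2) (simp add: of_bool_def)
  qed
  have same: "expectation (\<lambda>w. ?c w * ?R s w) = expectation (\<lambda>w. ?c w * ?R 0 w)"
  proof -
    have "expectation (\<lambda>w. ?R u w) = flux + flux + flux" if "u = 0 \<or> u = s" for u
    proof -
      have "0 \<le> u" using that s by auto
      then show ?thesis
        by (simp only: Bochner_Integration.integral_add Bochner_Integration.integrable_add rate_integrable rate_expectation)
    qed
    then have "expectation (\<lambda>w. ?R s w) - expectation (\<lambda>w. ?R 0 w) = 0"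
      by simp
    then have "expectation (\<lambda>w. ?R s w - ?R 0 w) = 0"
      by (subst Bochner_Integration.integral_diff[OF local_rate_X_integrable[OF s] local_rate_X_integrable[OF order_refl]])
    moreover have "?R s w - ?R 0 w = ?c w * ?R s w - ?c w * ?R 0 w" for w
      using local_rate_cong[of i "X 0 w" "X s w"] by (cases "window_changed i (X 0 w) (X s w)") auto
    ultimately have "expectation (\<lambda>w. ?c w * ?R s w - ?c w * ?R 0 w) = 0"
      by (simp only:)
    then show ?thesis
      using bound[of s] bound[of 0] by simp
  qed
  have "(\<integral>\<^sup>+w. error_density i (X 0 w, X s w) \<partial>M) = (\<integral>\<^sup>+w. ennreal (?c w * ?R 0 w) + ennreal (?c w * ?R s w) \<partial>M)"
  proof (intro nn_integral_cong)
    fix w assume w: "w \<in> space M"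
    have "error_density i (X 0 w, X s w) = ennreal (?c w * ?R 0 w + ?c w * ?R s w)"
      unfolding error_density_def fst_conv snd_conv by (rule arg_cong[OF distrib_left])
    also have "\<dots> = ennreal (?c w * ?R 0 w) + ennreal (?c w * ?R s w)"
      by (intro ennreal_plus mult_nonneg_nonneg local_rate_X_nonneg s order_refl zero_less_eq_of_bool w)
    finally show "error_density i (X 0 w, X s w) = ennreal (?c w * ?R 0 w) + ennreal (?c w * ?R s w)" .
  qed
  also have "\<dots> = (\<integral>\<^sup>+w. ennreal (?c w * ?R 0 w) \<partial>M) + (\<integral>\<^sup>+w. ennreal (?c w * ?R s w) \<partial>M)"
    by (rule nn_integral_add) measurable
  also have "(\<integral>\<^sup>+w. ennreal (?c w * ?R s w) \<partial>M) = (\<integral>\<^sup>+w. ennreal (?c w * ?R 0 w) \<partial>M)"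
  proof -
    have "(\<integral>\<^sup>+w. ennreal (?c w * ?R u w) \<partial>M) = ennreal (expectation (\<lambda>w. ?c w * ?R u w))" if u: "u = 0 \<or> u = s" for u
    proof (rule nn_integral_eq_integral[OF bound[OF u]])
      have "0 \<le> u" using u s by auto
      then show "AE w in M. 0 \<le> ?c w * ?R u w"
        by (intro AE_I2 mult_nonneg_nonneg local_rate_X_nonneg zero_less_eq_of_bool)
    qed
    then show ?thesis
      by (simp only: same simp_thms)
  qed
  finally show ?thesis
    unfolding changed_mass_def by (simp only: mult_2)
qed

text \<open>Dominated convergence along times tending to \<open>0\<close>: almost surely the window
  is eventually unchanged, and the integrable local rate at time \<open>0\<close> dominates. A
  sequence of times violating the bound is therefore impossible.\<close>

lemma changed_mass_small:
  assumes "0 < e"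
  shows "\<exists>d>0. \<forall>s\<in>{0..d}. changed_mass i s \<le> ennreal e"
proof (rule ccontr)
  assume neg: "\<not> ?thesis"
  have "\<exists>s. 0 \<le> s \<and> s \<le> inverse (real (Suc n)) \<and> ennreal e < changed_mass i s" for n
    using neg by (metis atLeastAtMost_iff inverse_positive_iff_positive not_le of_nat_0_less_iff zero_less_Suc)
  then obtain s where s: "\<And>n. 0 \<le> s n" "\<And>n. s n \<le> inverse (real (Suc n))" "\<And>n. ennreal e < changed_mass i (s n)"
    by metis
  have s0: "s \<longlonglongrightarrow> 0"
    by (rule tendsto_sandwich[OF _ _ tendsto_const LIMSEQ_inverse_real_of_nat]) (use s in auto)
  let ?c = "\<lambda>n w. of_bool (window_changed i (X 0 w) (X (s n) w)) :: real"
  have "(\<lambda>n. expectation (\<lambda>w. ?c n w * local_rate i (X 0 w))) \<longlonglongrightarrow> expectation (\<lambda>w. 0)"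
  proof (rule integral_dominated_convergence[where w = "\<lambda>w. local_rate i (X 0 w)"])
    show "AE w in M. (\<lambda>n. ?c n w * local_rate i (X 0 w)) \<longlonglongrightarrow> 0"
      using heights
    proof (rule AE_mp, intro AE_I2 impI tendsto_eventually)
      fix w assume h: "heights_of (\<lambda>t. X t w) (\<lambda>t. h t w)"
      obtain \<epsilon> where \<epsilon>: "0 < \<epsilon>" "\<forall>u\<in>{0..<\<epsilon>}. \<forall>j\<in>{i - 1..i + 2}. X u w j = X 0 w j"
        using heights_constant_near_0[OF h, of "{i - 1..i + 2}"] by auto
      have "eventually (\<lambda>n. s n < \<epsilon>) sequentially"
        using order_tendstoD(2)[OF s0 \<epsilon>(1)] .
      then show "eventually (\<lambda>n. ?c n w * local_rate i (X 0 w) = 0) sequentially"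
      proof eventually_elim
        case (elim n)
        then have "s n \<in> {0..<\<epsilon>}"
          using s(1)[of n] by simp
        with \<epsilon>(2) have "\<forall>j\<in>{i - 1..i + 2}. X (s n) w j = X 0 w j"
          by (rule bspec)
        then have "\<not> window_changed i (X 0 w) (X (s n) w)"
          unfolding window_changed_def by blast
        then show ?case
          by simp
      qed
    qed
    show "(\<lambda>w. ?c n w * local_rate i (X 0 w)) \<in> borel_measurable M" for n
      by (intro borel_measurable_times window_changed_X_measurable s local_rate_X_measurable order_refl)
    show "AE w in M. norm (?c n w * local_rate i (X 0 w)) \<le> local_rate i (X 0 w)" for n
    proof (intro AE_I2)
      fix w assume "w \<in> space M"
      then show "norm (?c n w * local_rate i (X 0 w)) \<le> local_rate i (X 0 w)"
        using local_rate_X_nonneg[OF order_refl, of w i] by (simp add: of_bool_def del: of_bool_eq_iff)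
    qed
    show "integrable M (\<lambda>w. local_rate i (X 0 w))"
      by (rule local_rate_X_integrable[OF order_refl])
  qed simp
  then have "eventually (\<lambda>n. expectation (\<lambda>w. ?c n w * local_rate i (X 0 w)) < e) sequentially"
    using assms by (intro order_tendstoD(2)) auto
  then obtain n where n: "expectation (\<lambda>w. ?c n w * local_rate i (X 0 w)) < e"
    by (auto simp: eventually_sequentially)
  have eq: "changed_mass i (s n) = ennreal (expectation (\<lambda>w. ?c n w * local_rate i (X 0 w)))"
    unfolding changed_mass_def
  proof (rule nn_integral_eq_integral)
    show "integrable M (\<lambda>w. ?c n w * local_rate i (X 0 w))"
    proof (rule Bochner_Integration.integrable_bound[OF local_rate_X_integrable[OF order_refl, of i]])
      show "(\<lambda>w. ?c n w * local_rate i (X 0 w)) \<in> borel_measurable M"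
        by (intro borel_measurable_times window_changed_X_measurable s local_rate_X_measurable order_refl)
    qed (auto simp: of_bool_def)
    show "AE w in M. 0 \<le> ?c n w * local_rate i (X 0 w)"
      by (intro AE_I2 mult_nonneg_nonneg local_rate_X_nonneg order_refl zero_less_eq_of_bool)
  qed
  have "changed_mass i (s n) \<le> ennreal e"
    unfolding eq by (intro ennreal_leI less_imp_le n)
  then show False
    using leD[of "changed_mass i (s n)" "ennreal e"] s(3)[of n] by blast
qed

text \<open>After exchanging the integrals, the Markov property turns the kernel integral at time
  \<open>s\<close> into the mean error density, which is twice \<open>changed_mass i s\<close> and
  hence at most \<open>e\<close>. Integrating over \<open>s\<close> up to \<open>d\<close> yields
  the decisive factor \<open>d\<close>.\<close>

lemma jump_probability_limit:
  assumes "0 < e"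
  shows "\<exists>d0>0. \<forall>d\<in>{0..d0}. (\<integral>\<^sup>+w. ennreal \<bar>jump_probability i d (X 0 w) - d * rate i (X 0 w)\<bar> \<partial>M) \<le> ennreal (e * d)"
proof -
  obtain d0 where d0: "0 < d0" "\<And>s. s \<in> {0..d0} \<Longrightarrow> changed_mass i s \<le> ennreal (e / 2)"
    using changed_mass_small[of "e / 2" i] assms by auto
  have sp: "space M \<in> sets (past M T X 0)"
    using subalgebra_past[of 0] unfolding subalgebra_def by (metis order_refl sets.top)
  have "(\<integral>\<^sup>+w. ennreal \<bar>jump_probability i d (X 0 w) - d * rate i (X 0 w)\<bar> \<partial>M) \<le> ennreal (e * d)" if d: "d \<in> {0..d0}" for d
  proof -
    let ?N = "restrict_space lborel {0..d}"
    interpret pair_sigma_finite ?N M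
      by (intro pair_sigma_finite.intro sigma_finite_measure_restrict_space sigma_finite_measure_axioms) (auto intro: lborel.sigma_finite_measure_axioms)
    have "(\<integral>\<^sup>+w. ennreal \<bar>jump_probability i d (X 0 w) - d * rate i (X 0 w)\<bar> \<partial>M) \<le>
      (\<integral>\<^sup>+w. (\<integral>\<^sup>+s. (\<integral>\<^sup>+\<zeta>. error_density i (X 0 w, \<zeta>) \<partial>K s (X 0 w)) \<partial>?N) \<partial>M)"
      using d X_in_T[of 0] by (intro nn_integral_mono jump_probability_error) auto
    also have "\<dots> = (\<integral>\<^sup>+s. (\<integral>\<^sup>+w. (\<integral>\<^sup>+\<zeta>. error_density i (X 0 w, \<zeta>) \<partial>K s (X 0 w)) \<partial>M) \<partial>?N)"
      by (rule Fubini'[OF error_integral_measurable])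
    also have "\<dots> \<le> (\<integral>\<^sup>+s. ennreal e \<partial>?N)"
    proof (intro nn_integral_mono)
      fix s assume "s \<in> space ?N"
      then have s: "0 \<le> s" "s \<in> {0..d0}"
        using d by (auto simp: space_restrict_space)
      have "(\<integral>\<^sup>+w. (\<integral>\<^sup>+\<zeta>. error_density i (X 0 w, \<zeta>) \<partial>K s (X 0 w)) \<partial>M) =
        (\<integral>\<^sup>+w. indicator (space M) w * (\<integral>\<^sup>+\<zeta>. error_density i (X 0 w, \<zeta>) \<partial>K s (X 0 w)) \<partial>M)"
        by (intro nn_integral_cong) simp
      also have "\<dots> = (\<integral>\<^sup>+w. indicator (space M) w * error_density i (X 0 w, X (0 + s) w) \<partial>M)"
        by (rule markov_property[OF order_refl s(1) sp error_density_measurable, symmetric])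
      also have "\<dots> = (\<integral>\<^sup>+w. error_density i (X 0 w, X s w) \<partial>M)"
        by (intro nn_integral_cong) simp
      also have "\<dots> = 2 * changed_mass i s"
        by (rule error_density_mean[OF s(1)])
      also have "\<dots> \<le> 2 * ennreal (e / 2)"
        using d0(2)[OF s(2)] by (intro mult_left_mono) auto
      also have "\<dots> = ennreal (2 * (e / 2))"
        using assms by (subst ennreal_mult) auto
      finally show "(\<integral>\<^sup>+w. (\<integral>\<^sup>+\<zeta>. error_density i (X 0 w, \<zeta>) \<partial>K s (X 0 w)) \<partial>M) \<le> ennreal e"
        by simp
    qed
    also have "\<dots> = ennreal e * ennreal d"
      using d by (simp add: nn_integral_const emeasure_restrict_space space_restrict_space)
    also have "\<dots> = ennreal (e * d)"
      using assms d by (simp add: ennreal_mult)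
    finally show ?thesis .
  qed
  then show ?thesis using d0(1) by blast
qed

end

section \<open>The current through a bond\<close>

lemma (in prob_space) expectation_abs_sum_le:
  fixes g :: "'i \<Rightarrow> 'a \<Rightarrow> real"
  assumes "\<And>a. a \<in> A \<Longrightarrow> integrable M (g a)"
  shows "expectation (\<lambda>w. \<bar>\<Sum>a\<in>A. g a w\<bar>) \<le> (\<Sum>a\<in>A. expectation (\<lambda>w. \<bar>g a w\<bar>))"
proof -
  have "expectation (\<lambda>w. \<bar>\<Sum>a\<in>A. g a w\<bar>) \<le> expectation (\<lambda>w. \<Sum>a\<in>A. \<bar>g a w\<bar>)"
    using assms by (intro integral_mono) (auto intro: sum_abs)
  also have "\<dots> = (\<Sum>a\<in>A. expectation (\<lambda>w. \<bar>g a w\<bar>))"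
    using assms by (intro Bochner_Integration.integral_sum) auto
  finally show ?thesis .
qed

text \<open>Fatou's lemma. It carries bounds from grid counts to the current when no integrable
  dominating function is at hand.\<close>

lemma nn_integral_le_of_eventually_eq:
  fixes u :: "nat \<Rightarrow> 'a \<Rightarrow> ennreal"
  assumes [measurable]: "\<And>n. u n \<in> borel_measurable M"
    and eq: "AE x in M. eventually (\<lambda>n. u n x = v x) sequentially"
    and le: "eventually (\<lambda>n. (\<integral>\<^sup>+x. u n x \<partial>M) \<le> B) sequentially"
  shows "(\<integral>\<^sup>+x. v x \<partial>M) \<le> B"
proof -
  have "(\<integral>\<^sup>+x. v x \<partial>M) = (\<integral>\<^sup>+x. liminf (\<lambda>n. u n x) \<partial>M)"
    using eq
  proof (intro nn_integral_cong_AE, elim AE_mp, intro AE_I2 impI)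
    fix x assume "eventually (\<lambda>n. u n x = v x) sequentially"
    then have "(\<lambda>n. u n x) \<longlonglongrightarrow> v x"
      by (rule tendsto_eventually)
    then show "v x = liminf (\<lambda>n. u n x)"
      by (simp add: lim_imp_Liminf)
  qed
  also have "\<dots> \<le> liminf (\<lambda>n. \<integral>\<^sup>+x. u n x \<partial>M)"
    by (rule nn_integral_liminf) measurable
  also have "\<dots> \<le> B"
    using le by (intro Liminf_le) auto
  finally show ?thesis .
qed

context stationary_deposition
begin

lemma X_law_S_cong: "0 \<le> s \<Longrightarrow> 0 \<le> t \<Longrightarrow> distr M S (X s) = distr M S (X t)"
  by (simp only: X_law_S)

lemma expectation_X_cong:
  fixes g :: "config \<Rightarrow> real"
  assumes g: "g \<in> borel_measurable S" and "0 \<le> s" "0 \<le> t"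
  shows "expectation (\<lambda>w. g (X s w)) = expectation (\<lambda>w. g (X t w))"
  using integral_distr[OF X_measurable[OF assms(2)] g] integral_distr[OF X_measurable[OF assms(3)] g]
    X_law_S_cong[OF assms(2,3)] by simp

lemma ennreal_jump_probability:
  assumes "\<eta> \<in> T" "0 \<le> d"
  shows "ennreal (jump_probability i d \<eta>) = (\<integral>\<^sup>+\<zeta>. of_bool (bond_jump i \<eta> \<zeta>) \<partial>K d \<eta>)"
proof -
  interpret Kd: prob_space "K d \<eta>"
    by (rule K_prob[OF assms(2,1)])
  have sp: "space (K d \<eta>) = T"
    by (rule space_K[OF assms(2,1)])
  have "Measurable.pred S (\<lambda>\<zeta>. bond_jump i \<eta> \<zeta>)"
    using measurable_compose[OF measurable_Pair1'[of \<eta> S S] bond_jump_measurable[of i]] assms by (simp add: space_S)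
  then have "{\<zeta> \<in> space S. bond_jump i \<eta> \<zeta>} \<in> sets S"
    by (rule predE)
  then have B: "{\<zeta> \<in> T. bond_jump i \<eta> \<zeta>} \<in> sets (K d \<eta>)"
    using sets_K[OF assms(2,1)] space_S by simp
  have "(\<integral>\<^sup>+\<zeta>. of_bool (bond_jump i \<eta> \<zeta>) \<partial>K d \<eta>) = (\<integral>\<^sup>+\<zeta>. indicator {\<zeta> \<in> T. bond_jump i \<eta> \<zeta>} \<zeta> \<partial>K d \<eta>)"
    using sp by (intro nn_integral_cong) (auto simp: indicator_def)
  also have "\<dots> = emeasure (K d \<eta>) {\<zeta> \<in> T. bond_jump i \<eta> \<zeta>}"
    using B by simp
  finally show ?thesis
    unfolding jump_probability_def by (simp add: Kd.emeasure_eq_measure)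
qed

lemma bond_jump_indicator_measurable: "(\<lambda>p. of_bool (bond_jump i (fst p) (snd p)) :: ennreal) \<in> borel_measurable (S \<Otimes>\<^sub>M S)"
  using bond_jump_measurable[of i] by measurable

lemma jump_probability_measurable:
  assumes "0 \<le> d"
  shows "jump_probability i d \<in> borel_measurable S"
proof -
  have "(\<lambda>\<eta>. \<integral>\<^sup>+\<zeta>. of_bool (bond_jump i \<eta> \<zeta>) \<partial>K d \<eta>) \<in> borel_measurable S"
    by (rule nn_integral_measurable_subprob_algebra2[OF _ K_measurable[OF assms]])
       (use bond_jump_indicator_measurable[of i] in \<open>simp add: case_prod_beta\<close>)
  then have "(\<lambda>\<eta>. enn2real (\<integral>\<^sup>+\<zeta>. of_bool (bond_jump i \<eta> \<zeta>) \<partial>K d \<eta>)) \<in> borel_measurable S"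
    by measurable
  moreover have "jump_probability i d \<eta> = enn2real (\<integral>\<^sup>+\<zeta>. of_bool (bond_jump i \<eta> \<zeta>) \<partial>K d \<eta>)" if "\<eta> \<in> space S" for \<eta>
    using that ennreal_jump_probability[of \<eta> d i, symmetric] assms space_S by (simp add: jump_probability_def)
  ultimately show ?thesis
    by (simp cong: measurable_cong)
qed

lemma jump_probability_bounds: "0 \<le> jump_probability i d \<eta>" "\<eta> \<in> T \<Longrightarrow> 0 \<le> d \<Longrightarrow> jump_probability i d \<eta> \<le> 1"
  unfolding jump_probability_def using prob_space.prob_le_1[OF K_prob] by auto

section \<open>Martingale differences on the grid\<close>

definition jump_indicator :: "int \<Rightarrow> real \<Rightarrow> nat \<Rightarrow> 'w \<Rightarrow> real" where
  "jump_indicator i d k w = of_bool (bond_jump i (X (real k * d) w) (X (real (Suc k) * d) w))"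

text \<open>One martingale difference, not a partial sum.\<close>

definition jump_martingale :: "int \<Rightarrow> real \<Rightarrow> nat \<Rightarrow> 'w \<Rightarrow> real" where
  "jump_martingale i d k w = jump_indicator i d k w - jump_probability i d (X (real k * d) w)"

context
  fixes d :: real and i :: int
  assumes d: "0 \<le> d"
begin

lemma jump_indicator_past:
  assumes "k < l"
  shows "jump_indicator i d k \<in> borel_measurable (past M T X (real l * d))"
proof -
  have le: "real k * d \<le> real l * d" "real (Suc k) * d \<le> real l * d"
    using assms d by (intro mult_right_mono; simp)+
  have "(\<lambda>w. (X (real k * d) w, X (real (Suc k) * d) w)) \<in> past M T X (real l * d) \<rightarrow>\<^sub>M S \<Otimes>\<^sub>M S"
    using d le by (intro measurable_Pair X_past_measurable) auto
  from measurable_compose[OF this bond_jump_measurable[of i]]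
  have "Measurable.pred (past M T X (real l * d)) (\<lambda>w. bond_jump i (X (real k * d) w) (X (real (Suc k) * d) w))"
    by simp
  then show ?thesis
    unfolding jump_indicator_def[abs_def] by measurable
qed

lemma jump_probability_past:
  assumes "k \<le> l"
  shows "(\<lambda>w. jump_probability i d (X (real k * d) w)) \<in> borel_measurable (past M T X (real l * d))"
  using assms d by (intro measurable_compose[OF X_past_measurable jump_probability_measurable] mult_right_mono) auto

lemma jump_indicator_measurable: "jump_indicator i d k \<in> borel_measurable M"
  by (rule measurable_from_subalg[OF subalgebra_past jump_indicator_past[of k "Suc k"]]) (use d in auto)

lemma jump_probability_X_measurable: "(\<lambda>w. jump_probability i d (X (real k * d) w)) \<in> borel_measurable M"
  by (rule measurable_from_subalg[OF subalgebra_past jump_probability_past[of k k]]) (use d in auto)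

lemma jump_indicator_bound: "\<bar>jump_indicator i d k w\<bar> \<le> 1"
  unfolding jump_indicator_def by simp

lemma jump_probability_X_bound: "w \<in> space M \<Longrightarrow> \<bar>jump_probability i d (X (real k * d) w)\<bar> \<le> 1"
  using jump_probability_bounds(1)[of i d "X (real k * d) w"] jump_probability_bounds(2)[of "X (real k * d) w" d i] X_in_T[of "real k * d" w] d by simp

lemma jump_indicator_integrable: "integrable M (jump_indicator i d k)"
  using jump_indicator_bound jump_indicator_measurable by (intro integrable_const_bound[of _ 1]) auto

lemma jump_probability_X_integrable: "integrable M (\<lambda>w. jump_probability i d (X (real k * d) w))"
  using jump_probability_X_bound jump_probability_X_measurable by (intro integrable_const_bound[of _ 1] AE_I2) auto

text \<open>The Markov property for the pair of consecutive grid configurations identifies the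
  conditional probability of a detected jump with the one-step jump probability.\<close>

lemma jump_indicator_cond_exp:
  "AE w in M. real_cond_exp M (past M T X (real k * d)) (jump_indicator i d k) w = jump_probability i d (X (real k * d) w)"
proof -
  let ?F = "past M T X (real k * d)"
  have s: "0 \<le> real k * d" using d by simp
  interpret F: finite_measure_subalgebra M ?F
    by (rule finite_measure_subalgebra_past[OF s])
  show ?thesis
  proof (rule F.real_cond_exp_charact[OF _ jump_indicator_integrable jump_probability_X_integrable jump_probability_past[OF order_refl]])
    fix A assume A: "A \<in> sets ?F"
    have AM: "A \<in> sets M"
      by (rule past_sets_M[OF s A])
    have t: "real k * d + d = real (Suc k) * d"
      by (simp add: algebra_simps)
    have "(\<integral>\<^sup>+w. ennreal (indicator A w * jump_indicator i d k w) \<partial>M) =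
      (\<integral>\<^sup>+w. indicator A w * of_bool (bond_jump i (fst (X (real k * d) w, X (real k * d + d) w)) (snd (X (real k * d) w, X (real k * d + d) w))) \<partial>M)"
      unfolding jump_indicator_def t by (intro nn_integral_cong) (simp add: indicator_def)
    also have "\<dots> = (\<integral>\<^sup>+w. indicator A w * (\<integral>\<^sup>+\<zeta>. of_bool (bond_jump i (fst (X (real k * d) w, \<zeta>)) (snd (X (real k * d) w, \<zeta>))) \<partial>K d (X (real k * d) w)) \<partial>M)"
      by (rule markov_property[OF s d A bond_jump_indicator_measurable])
    also have "\<dots> = (\<integral>\<^sup>+w. ennreal (indicator A w * jump_probability i d (X (real k * d) w)) \<partial>M)"
      using X_in_T[OF s] d by (intro nn_integral_cong) (simp add: ennreal_jump_probability[symmetric] indicator_def)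
    finally have eq: "(\<integral>\<^sup>+w. ennreal (indicator A w * jump_indicator i d k w) \<partial>M) =
      (\<integral>\<^sup>+w. ennreal (indicator A w * jump_probability i d (X (real k * d) w)) \<partial>M)" .
    have int: "integrable M (\<lambda>w. indicator A w * jump_indicator i d k w)"
      "integrable M (\<lambda>w. indicator A w * jump_probability i d (X (real k * d) w))"
      using integrable_mult_indicator[OF AM jump_indicator_integrable[of k]]
        integrable_mult_indicator[OF AM jump_probability_X_integrable[of k]] by simp_all
    have "(\<integral>w. indicator A w * jump_indicator i d k w \<partial>M) = enn2real (\<integral>\<^sup>+w. ennreal (indicator A w * jump_indicator i d k w) \<partial>M)"
      using int(1) by (intro integral_eq_nn_integral) (auto simp: jump_indicator_def)
    also have "\<dots> = (\<integral>w. indicator A w * jump_probability i d (X (real k * d) w) \<partial>M)"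
      unfolding eq using int(2) jump_probability_bounds(1) by (intro integral_eq_nn_integral[symmetric]) auto
    finally show "(\<integral>w\<in>A. jump_indicator i d k w \<partial>M) = (\<integral>w\<in>A. jump_probability i d (X (real k * d) w) \<partial>M)"
      unfolding set_lebesgue_integral_def by simp
  qed
qed

lemma jump_indicator_past_product:
  assumes G: "G \<in> borel_measurable (past M T X (real k * d))" and bd: "\<And>w. w \<in> space M \<Longrightarrow> \<bar>G w\<bar> \<le> 1"
  shows "expectation (\<lambda>w. G w * jump_indicator i d k w) = expectation (\<lambda>w. G w * jump_probability i d (X (real k * d) w))"
    and "integrable M (\<lambda>w. G w * jump_indicator i d k w)"
    and "integrable M (\<lambda>w. G w * jump_probability i d (X (real k * d) w))"
proof -
  let ?F = "past M T X (real k * d)"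
  have s: "0 \<le> real k * d" using d by simp
  interpret F: finite_measure_subalgebra M ?F
    by (rule finite_measure_subalgebra_past[OF s])
  note [measurable] = measurable_from_subalg[OF subalgebra_past[OF s] G] jump_indicator_measurable[of k] jump_probability_X_measurable[of k]
  show i1: "integrable M (\<lambda>w. G w * jump_indicator i d k w)"
  proof (rule integrable_const_bound[of _ "1 * 1"])
    show "AE w in M. norm (G w * jump_indicator i d k w) \<le> 1 * 1"
      unfolding real_norm_def abs_mult by (intro AE_I2 mult_mono bd jump_indicator_bound) auto
  qed measurable
  show i2: "integrable M (\<lambda>w. G w * jump_probability i d (X (real k * d) w))"
  proof (rule integrable_const_bound[of _ "1 * 1"])
    show "AE w in M. norm (G w * jump_probability i d (X (real k * d) w)) \<le> 1 * 1"
      unfolding real_norm_def abs_mult by (intro AE_I2 mult_mono bd jump_probability_X_bound) auto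
  qed measurable
  have "expectation (\<lambda>w. G w * jump_indicator i d k w) = expectation (\<lambda>w. G w * real_cond_exp M ?F (jump_indicator i d k) w)"
    by (rule F.real_cond_exp_intg(2)[OF i1 G jump_indicator_measurable, symmetric])
  also have "\<dots> = expectation (\<lambda>w. G w * jump_probability i d (X (real k * d) w))"
    using jump_indicator_cond_exp[of k] by (intro integral_cong_AE) auto
  finally show "expectation (\<lambda>w. G w * jump_indicator i d k w) = expectation (\<lambda>w. G w * jump_probability i d (X (real k * d) w))" .
qed

lemma jump_martingale_bound: "w \<in> space M \<Longrightarrow> \<bar>jump_martingale i d k w\<bar> \<le> 1"
  using jump_probability_X_bound[of w k] jump_probability_bounds(1)[of i d "X (real k * d) w"]
  unfolding jump_martingale_def jump_indicator_def by (auto simp: of_bool_def)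

lemma jump_martingale_measurable: "jump_martingale i d k \<in> borel_measurable M"
  unfolding jump_martingale_def[abs_def]
  by (intro borel_measurable_diff jump_indicator_measurable jump_probability_X_measurable)

lemma jump_martingale_product_integrable: "integrable M (\<lambda>w. jump_martingale i d k w * jump_martingale i d l w)"
proof (rule integrable_const_bound[of _ "1 * 1"])
  show "AE w in M. norm (jump_martingale i d k w * jump_martingale i d l w) \<le> 1 * 1"
    unfolding real_norm_def abs_mult by (intro AE_I2 mult_mono jump_martingale_bound) auto
qed (intro borel_measurable_times jump_martingale_measurable)

lemma jump_martingale_orthogonal:
  assumes "k < l"
  shows "expectation (\<lambda>w. jump_martingale i d k w * jump_martingale i d l w) = 0"
proof -
  have G: "jump_martingale i d k \<in> borel_measurable (past M T X (real l * d))"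
    unfolding jump_martingale_def[abs_def] using assms
    by (intro borel_measurable_diff jump_indicator_past jump_probability_past) auto
  note * = jump_indicator_past_product[OF G jump_martingale_bound]
  have "expectation (\<lambda>w. jump_martingale i d k w * jump_martingale i d l w) =
    expectation (\<lambda>w. jump_martingale i d k w * jump_indicator i d l w - jump_martingale i d k w * jump_probability i d (X (real l * d) w))"
    unfolding jump_martingale_def[of i d l] by (simp only: right_diff_distrib)
  also have "\<dots> = 0"
    using *(1) by (simp only: Bochner_Integration.integral_diff[OF *(2,3)])
  finally show ?thesis .
qed

text \<open>An indicator \<open>I\<close> equals its square, and conditioning replaces
  \<open>p * I\<close> by \<open>p * p\<close> in the mean. So the second moment is the mean of
  \<open>I\<close> minus that of \<open>p * p\<close>, at most the mean of \<open>p\<close>.\<close>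

lemma jump_martingale_square:
  "expectation (\<lambda>w. (jump_martingale i d k w)\<^sup>2) \<le> expectation (\<lambda>w. jump_probability i d (X 0 w))"
proof -
  let ?p = "\<lambda>w. jump_probability i d (X (real k * d) w)" and ?I = "jump_indicator i d k"
  note p = jump_indicator_past_product[OF jump_probability_past[OF order_refl] jump_probability_X_bound, of k]
  note one = jump_indicator_past_product[of "\<lambda>_. 1" k]
  have sq: "(jump_martingale i d k w)\<^sup>2 = ?I w - 2 * (?p w * ?I w) + ?p w * ?p w" for w
    unfolding jump_martingale_def jump_indicator_def by (auto simp: power2_eq_square algebra_simps of_bool_def)
  have "expectation (\<lambda>w. (jump_martingale i d k w)\<^sup>2) = expectation ?I - 2 * expectation (\<lambda>w. ?p w * ?I w) + expectation (\<lambda>w. ?p w * ?p w)"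
    unfolding sq using p(2,3) jump_indicator_integrable[of k] by simp
  also have "\<dots> = expectation ?I - expectation (\<lambda>w. ?p w * ?p w)"
    using p(1) by simp
  also have "\<dots> \<le> expectation ?I"
    by (simp add: integral_nonneg_AE)
  also have "\<dots> = expectation ?p"
    using one(1) by simp
  also have "\<dots> = expectation (\<lambda>w. jump_probability i d (X 0 w))"
    using d by (intro expectation_X_cong jump_probability_measurable) auto
  finally show ?thesis .
qed

text \<open>With \<open>a\<close> proportional to the mesh, \<open>n * a\<close> is proportional to
  the elapsed time, so the bound survives refinement of the grid.\<close>

lemma jump_martingale_sum:
  assumes n: "0 < n" and a: "0 < a" and p: "expectation (\<lambda>w. jump_probability i d (X 0 w)) \<le> a"
  shows "expectation (\<lambda>w. \<bar>\<Sum>k<n. jump_martingale i d k w\<bar>) \<le> sqrt (real n * a)"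
proof -
  have orth: "expectation (\<lambda>w. jump_martingale i d k w * jump_martingale i d l w) = 0" if "k \<noteq> l" for k l
    using jump_martingale_orthogonal[of k l] jump_martingale_orthogonal[of l k] that
    by (cases "k < l") (auto simp: mult.commute)
  note sq = expectation_square_sum_orthogonal[of "{..<n}" "jump_martingale i d"]
  have i: "integrable M (\<lambda>w. (\<Sum>k<n. jump_martingale i d k w)\<^sup>2)"
    using orth jump_martingale_product_integrable by (intro sq(1)) auto
  have "expectation (\<lambda>w. (\<Sum>k<n. jump_martingale i d k w)\<^sup>2) = (\<Sum>k<n. expectation (\<lambda>w. (jump_martingale i d k w)\<^sup>2))"
    using orth jump_martingale_product_integrable by (intro sq(2)) auto
  also have "\<dots> \<le> (\<Sum>k<n. a)"
    using jump_martingale_square p by (intro sum_mono) (rule order_trans)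
  also have "\<dots> = (sqrt (real n * a))\<^sup>2"
    using a by simp
  finally have le: "expectation (\<lambda>w. (\<Sum>k<n. jump_martingale i d k w)\<^sup>2) \<le> (sqrt (real n * a))\<^sup>2" .
  show ?thesis
    by (rule expectation_abs_le_sqrt(2)[OF _ i le]) (use n a jump_martingale_measurable in auto)
qed

end

section \<open>Grid counts averaged over bonds\<close>

lemma jump_probability_X0_integrable:
  assumes "0 \<le> d"
  shows "integrable M (\<lambda>w. jump_probability i d (X 0 w))"
  using jump_probability_X_integrable[OF assms, of i 0] by simp

lemma jump_probability_mean_error:
  assumes "0 < e"
  shows "\<exists>d0>0. \<forall>d\<in>{0..d0}. \<forall>s\<ge>0. expectation (\<lambda>w. \<bar>jump_probability i d (X s w) - d * rate i (X s w)\<bar>) \<le> e * d"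
proof -
  obtain d0 where d0: "0 < d0" "\<And>d. d \<in> {0..d0} \<Longrightarrow>
      (\<integral>\<^sup>+w. ennreal \<bar>jump_probability i d (X 0 w) - d * rate i (X 0 w)\<bar> \<partial>M) \<le> ennreal (e * d)"
    using jump_probability_limit[OF assms, of i] by blast
  have "expectation (\<lambda>w. \<bar>jump_probability i d (X s w) - d * rate i (X s w)\<bar>) \<le> e * d" if d: "d \<in> {0..d0}" and s: "0 \<le> s" for d s
  proof -
    have dn: "0 \<le> d" using d by simp
    have m: "(\<lambda>\<eta>. \<bar>jump_probability i d \<eta> - d * rate i \<eta>\<bar>) \<in> borel_measurable S"
      by (intro borel_measurable_abs borel_measurable_diff borel_measurable_times borel_measurable_const
        jump_probability_measurable[OF dn] rate_measurable_S)
    have i: "integrable M (\<lambda>w. \<bar>jump_probability i d (X 0 w) - d * rate i (X 0 w)\<bar>)"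
      using jump_probability_X0_integrable[OF dn, of i] rate_integrable[of 0 i] by auto
    have "expectation (\<lambda>w. \<bar>jump_probability i d (X s w) - d * rate i (X s w)\<bar>) = expectation (\<lambda>w. \<bar>jump_probability i d (X 0 w) - d * rate i (X 0 w)\<bar>)"
      by (rule expectation_X_cong[OF m s order_refl])
    moreover have "ennreal (expectation (\<lambda>w. \<bar>jump_probability i d (X 0 w) - d * rate i (X 0 w)\<bar>)) \<le> ennreal (e * d)"
      using d0(2)[OF d] nn_integral_eq_integral[OF i] by simp
    ultimately show ?thesis
      using assms dn by (simp add: ennreal_le_iff)
  qed
  then show ?thesis using d0(1) by blast
qed

lemma grid_count_eq: "real (grid_count (\<lambda>t. X t w) i g 0 m) = (\<Sum>k<m * Suc g. jump_indicator i (1 / real (Suc g)) k w)"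
  unfolding grid_count_def jump_indicator_def by (simp add: lessThan_atLeast0)

lemma grid_count_measurable: "(\<lambda>w. grid_count (\<lambda>t. X t w) i g 0 m) \<in> M \<rightarrow>\<^sub>M count_space UNIV"
proof -
  have "(\<lambda>w. real (grid_count (\<lambda>t. X t w) i g 0 m)) \<in> borel_measurable M"
    unfolding grid_count_eq by (intro borel_measurable_sum jump_indicator_measurable) simp
  then have "(\<lambda>w. nat \<lfloor>real (grid_count (\<lambda>t. X t w) i g 0 m)\<rfloor>) \<in> M \<rightarrow>\<^sub>M count_space UNIV"
    by measurable
  then show ?thesis by simp
qed

text \<open>Each bond contributes a martingale of variance of order \<open>m\<close>, whose size does not matter, and a
  compensator; the average over bonds is only needed for the compensator.\<close>

lemma grid_count_average:
  assumes N: "0 < N" and e: "0 < e" "e \<le> 1"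
    and avg: "\<And>t. 0 \<le> t \<Longrightarrow> (\<integral>\<^sup>+w. ennreal \<bar>(\<Sum>j<N. rate (2 * int j) (X t w)) / real N - flux\<bar> \<partial>M) \<le> ennreal e"
    and m: "0 < m"
  shows "eventually (\<lambda>g. (\<integral>\<^sup>+w. ennreal \<bar>(\<Sum>j<N. real (grid_count (\<lambda>t. X t w) (2 * int j) g 0 m)) / real N - flux * real m\<bar> \<partial>M)
      \<le> ennreal (sqrt (real m * (flux + 1)) + 2 * real m * e)) sequentially"
proof -
  have "\<forall>j. \<exists>d0>0. \<forall>d\<in>{0..d0}. \<forall>s\<ge>0. expectation (\<lambda>w. \<bar>jump_probability (2 * int j) d (X s w) - d * rate (2 * int j) (X s w)\<bar>) \<le> e * d"
    using jump_probability_mean_error[OF e(1)] by blast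
  from choice[OF this] obtain d0 where "\<forall>j. 0 < d0 j \<and> (\<forall>d\<in>{0..d0 j}. \<forall>s\<ge>0.
      expectation (\<lambda>w. \<bar>jump_probability (2 * int j) d (X s w) - d * rate (2 * int j) (X s w)\<bar>) \<le> e * d)" ..
  then have d0: "\<And>j. 0 < d0 j"
    "\<And>j d s. d \<in> {0..d0 j} \<Longrightarrow> 0 \<le> s \<Longrightarrow> expectation (\<lambda>w. \<bar>jump_probability (2 * int j) d (X s w) - d * rate (2 * int j) (X s w)\<bar>) \<le> e * d"
    by blast+
  define D where "D = Min (d0 ` {..<N})"
  have D: "0 < D" "\<And>j. j < N \<Longrightarrow> D \<le> d0 j"
    unfolding D_def using N d0(1) by (auto simp: Min_gr_iff lessThan_empty_iff)
  have "eventually (\<lambda>g. 1 / real (Suc g) < D) sequentially"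
    using order_tendstoD(2)[OF LIMSEQ_inverse_real_of_nat D(1)] by (simp add: inverse_eq_divide)
  then show ?thesis
  proof eventually_elim
    case (elim g)
    define d where "d = 1 / real (Suc g)"
    define n where "n = m * Suc g"
    have d: "0 < d" "d < D" and nd: "real n * d = real m" and n: "0 < n"
      unfolding d_def n_def using elim m by (simp_all only: of_nat_mult) simp_all
    have dn: "0 \<le> d" using d by simp
    define Y where "Y k = X (real k * d)" for k
    have tk: "0 \<le> real k * d" for k using dn by simp
    let ?i = "\<lambda>j. 2 * int j"
    \<comment> \<open>The averaged count minus \<open>flux * m\<close> splits into three parts: the
      martingale differences, the gap between jump probability and \<open>d\<close> times the rate,
      and the spatial average of the rates minus its mean.\<close>
    define mart where "mart j w = (\<Sum>k<n. jump_martingale (?i j) d k w)" for j w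
    define err where "err j k w = jump_probability (?i j) d (Y k w) - d * rate (?i j) (Y k w)" for j k w
    define comp where "comp k w = (\<Sum>j<N. rate (?i j) (Y k w)) / real N - flux" for k w
    have int_mart: "integrable M (mart j)" for j
      unfolding mart_def jump_martingale_def
      using jump_indicator_integrable[OF dn] jump_probability_X_integrable[OF dn] by auto
    have int_rate: "integrable M (\<lambda>w. rate (?i j) (Y k w))" for j k
      unfolding Y_def by (rule rate_integrable[OF tk])
    have int_err: "integrable M (err j k)" for j k
      unfolding err_def using jump_probability_X_integrable[OF dn] int_rate by (auto simp: Y_def)
    have int_comp: "integrable M (comp k)" for k
      unfolding comp_def using int_rate by (intro Bochner_Integration.integrable_diff integrable_divide_zero Bochner_Integration.integrable_sum) auto
    have err_le: "expectation (\<lambda>w. \<bar>err j k w\<bar>) \<le> e * d" if "j < N" for j k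
      unfolding err_def Y_def using D(2)[OF that] d by (intro d0(2) tk) auto
    have comp_le: "expectation (\<lambda>w. \<bar>comp k w\<bar>) \<le> e" for k
    proof -
      have "ennreal (expectation (\<lambda>w. \<bar>comp k w\<bar>)) = (\<integral>\<^sup>+w. ennreal \<bar>comp k w\<bar> \<partial>M)"
        using int_comp by (intro nn_integral_eq_integral[symmetric]) auto
      also have "\<dots> \<le> ennreal e"
        unfolding comp_def Y_def by (rule avg[OF tk])
      finally show ?thesis using e by (simp add: ennreal_le_iff)
    qed
    have mart_le: "expectation (\<lambda>w. \<bar>mart j w\<bar>) \<le> sqrt (real m * (flux + 1))" if j: "j < N" for j
    proof -
      have "expectation (\<lambda>w. jump_probability (?i j) d (X 0 w)) = expectation (\<lambda>w. err j 0 w + d * rate (?i j) (X 0 w))"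
        unfolding err_def Y_def by simp
      also have "\<dots> = expectation (err j 0) + d * flux"
        using int_err[of j 0] rate_integrable[of 0 "?i j"] rate_expectation[of 0 "?i j"] by simp
      also have "expectation (err j 0) \<le> expectation (\<lambda>w. \<bar>err j 0 w\<bar>)"
        using int_err by (intro integral_mono) auto
      also have "\<dots> \<le> e * d"
        by (rule err_le[OF j])
      \<comment> \<open>Here \<open>e \<le> 1\<close> enters, to make the variance bound independent
        of \<open>e\<close>.\<close>
      also have "e * d + d * flux \<le> d * (flux + 1)"
        using e d by (simp add: algebra_simps)
      finally have p: "expectation (\<lambda>w. jump_probability (?i j) d (X 0 w)) \<le> d * (flux + 1)"
        by simp
      have "expectation (\<lambda>w. \<bar>mart j w\<bar>) \<le> sqrt (real n * (d * (flux + 1)))"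
        unfolding mart_def using d flux_nonneg by (intro jump_martingale_sum[OF dn n _ p]) simp
      also have "real n * (d * (flux + 1)) = real m * (flux + 1)"
        by (simp only: mult.assoc[symmetric] nd)
      finally show ?thesis .
    qed
    define total where "total w = (\<Sum>j<N. mart j w) / real N + (\<Sum>j<N. \<Sum>k<n. err j k w) / real N + d * (\<Sum>k<n. comp k w)" for w
    have decomp: "(\<Sum>j<N. real (grid_count (\<lambda>t. X t w) (?i j) g 0 m)) / real N - flux * real m = total w" for w
    proof -
      have "(\<Sum>j<N. real (grid_count (\<lambda>t. X t w) (?i j) g 0 m)) = (\<Sum>j<N. \<Sum>k<n. jump_indicator (?i j) d k w)"
        unfolding grid_count_eq d_def n_def ..
      also have "\<dots> = (\<Sum>j<N. mart j w + (\<Sum>k<n. err j k w) + (\<Sum>k<n. d * rate (?i j) (Y k w)))"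
        unfolding mart_def err_def jump_martingale_def Y_def by (simp flip: sum.distrib)
      also have "\<dots> = (\<Sum>j<N. mart j w) + (\<Sum>j<N. \<Sum>k<n. err j k w) + d * (\<Sum>k<n. \<Sum>j<N. rate (?i j) (Y k w))"
        by (simp only: sum.distrib sum_distrib_left[symmetric]) (simp only: sum.swap[of _ "{..<n}" "{..<N}"])
      finally have 1: "(\<Sum>j<N. real (grid_count (\<lambda>t. X t w) (?i j) g 0 m)) / real N =
        (\<Sum>j<N. mart j w) / real N + (\<Sum>j<N. \<Sum>k<n. err j k w) / real N + d * ((\<Sum>k<n. \<Sum>j<N. rate (?i j) (Y k w)) / real N)"
        by (simp only: add_divide_distrib times_divide_eq_right)
      have "d * (\<Sum>k<n. comp k w) = d * ((\<Sum>k<n. \<Sum>j<N. rate (?i j) (Y k w)) / real N) - flux * (real n * d)"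
        unfolding comp_def by (simp only: sum_subtractf sum_divide_distrib[symmetric] sum_constant card_lessThan right_diff_distrib mult_ac)
      then show ?thesis
        unfolding total_def nd using 1 by linarith
    qed
    have i1: "integrable M (\<lambda>w. \<Sum>j<N. mart j w)" and i2: "integrable M (\<lambda>w. \<Sum>j<N. \<Sum>k<n. err j k w)"
      and i3: "integrable M (\<lambda>w. \<Sum>k<n. comp k w)"
      using int_mart int_err int_comp by (auto intro!: Bochner_Integration.integrable_sum)
    have int_total: "integrable M total"
      unfolding total_def using i1 i2 i3 by auto
    have b1: "expectation (\<lambda>w. \<bar>\<Sum>j<N. mart j w\<bar>) \<le> real N * sqrt (real m * (flux + 1))"
    proof -
      have "expectation (\<lambda>w. \<bar>\<Sum>j<N. mart j w\<bar>) \<le> (\<Sum>j<N. expectation (\<lambda>w. \<bar>mart j w\<bar>))"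
        using int_mart by (intro expectation_abs_sum_le)
      also have "\<dots> \<le> (\<Sum>j<N. sqrt (real m * (flux + 1)))"
        by (intro sum_mono mart_le) simp
      finally show ?thesis by simp
    qed
    have b2: "expectation (\<lambda>w. \<bar>\<Sum>j<N. \<Sum>k<n. err j k w\<bar>) \<le> real N * (real m * e)"
    proof -
      have "expectation (\<lambda>w. \<bar>\<Sum>j<N. \<Sum>k<n. err j k w\<bar>) \<le> (\<Sum>j<N. expectation (\<lambda>w. \<bar>\<Sum>k<n. err j k w\<bar>))"
        using int_err by (intro expectation_abs_sum_le Bochner_Integration.integrable_sum)
      also have "\<dots> \<le> (\<Sum>j<N. \<Sum>k<n. expectation (\<lambda>w. \<bar>err j k w\<bar>))"
        using int_err by (intro sum_mono expectation_abs_sum_le)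
      also have "\<dots> \<le> (\<Sum>j<N. \<Sum>k<n. e * d)"
        by (intro sum_mono err_le) simp
      also have "\<dots> = real N * ((real n * d) * e)"
        by simp
      finally show ?thesis by (simp only: nd)
    qed
    have b3: "d * expectation (\<lambda>w. \<bar>\<Sum>k<n. comp k w\<bar>) \<le> real m * e"
    proof -
      have "expectation (\<lambda>w. \<bar>\<Sum>k<n. comp k w\<bar>) \<le> (\<Sum>k<n. expectation (\<lambda>w. \<bar>comp k w\<bar>))"
        using int_comp by (intro expectation_abs_sum_le)
      also have "\<dots> \<le> (\<Sum>k<n. e)"
        by (intro sum_mono comp_le)
      finally have "d * expectation (\<lambda>w. \<bar>\<Sum>k<n. comp k w\<bar>) \<le> d * (real n * e)"
        using dn by (intro mult_left_mono) auto
      also have "\<dots> = (real n * d) * e"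
        by simp
      finally show ?thesis by (simp only: nd)
    qed
    have total_eq: "(\<integral>\<^sup>+w. ennreal \<bar>(\<Sum>j<N. real (grid_count (\<lambda>t. X t w) (?i j) g 0 m)) / real N - flux * real m\<bar> \<partial>M) = ennreal (expectation (\<lambda>w. \<bar>total w\<bar>))"
      unfolding decomp using int_total by (intro nn_integral_eq_integral) auto
    have "expectation (\<lambda>w. \<bar>total w\<bar>) \<le> expectation (\<lambda>w. \<bar>\<Sum>j<N. mart j w\<bar> / real N + \<bar>\<Sum>j<N. \<Sum>k<n. err j k w\<bar> / real N + d * \<bar>\<Sum>k<n. comp k w\<bar>)"
    proof (rule integral_mono)
      show "integrable M (\<lambda>w. \<bar>total w\<bar>)"
        using int_total by auto
      show "integrable M (\<lambda>w. \<bar>\<Sum>j<N. mart j w\<bar> / real N + \<bar>\<Sum>j<N. \<Sum>k<n. err j k w\<bar> / real N + d * \<bar>\<Sum>k<n. comp k w\<bar>)"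
        using i1 i2 i3 by auto
      fix w
      have tri: "\<bar>x + y + z\<bar> \<le> \<bar>x\<bar> + \<bar>y\<bar> + \<bar>z\<bar>" for x y z :: real
        by linarith
      show "\<bar>total w\<bar> \<le> \<bar>\<Sum>j<N. mart j w\<bar> / real N + \<bar>\<Sum>j<N. \<Sum>k<n. err j k w\<bar> / real N + d * \<bar>\<Sum>k<n. comp k w\<bar>"
        unfolding total_def by (rule order_trans[OF tri]) (simp add: abs_mult dn)
    qed
    also have "\<dots> = expectation (\<lambda>w. \<bar>\<Sum>j<N. mart j w\<bar>) / real N + expectation (\<lambda>w. \<bar>\<Sum>j<N. \<Sum>k<n. err j k w\<bar>) / real N + d * expectation (\<lambda>w. \<bar>\<Sum>k<n. comp k w\<bar>)"
      using i1 i2 i3 by simp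
    also have "\<dots> \<le> sqrt (real m * (flux + 1)) + real m * e + real m * e"
      using b1 b2 b3 N by (intro add_mono) (simp_all add: divide_le_eq mult.commute)
    also have "\<dots> = sqrt (real m * (flux + 1)) + 2 * real m * e"
      by simp
    finally show ?case
      unfolding total_eq by (rule ennreal_leI)
  qed
qed

section \<open>The \<open>L1\<close> limit of the current\<close>

definition current :: "int \<Rightarrow> nat \<Rightarrow> 'w \<Rightarrow> real" where
  "current i m w = of_int (h (real m) w i - h 0 w i)"

lemma current_measurable: "current i m \<in> borel_measurable M"
proof -
  have "(\<lambda>w. of_int (h t w i) :: real) \<in> borel_measurable M" if "0 \<le> t" for t
    by (rule measurable_compose[OF h_measurable[OF that]]) simp
  then show ?thesis
    unfolding current_def[abs_def] by (simp add: of_int_diff)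
qed

lemma eventually_grid_count_AE:
  "AE w in M. \<forall>i a b. a \<le> b \<longrightarrow> eventually (\<lambda>g. int (grid_count (\<lambda>t. X t w) i g a b) = h (real b) w i - h (real a) w i) sequentially"
  using heights
proof (rule AE_mp, intro AE_I2 impI allI)
  fix w i and a b :: nat
  assume "heights_of (\<lambda>t. X t w) (\<lambda>t. h t w)" "a \<le> b"
  then show "eventually (\<lambda>g. int (grid_count (\<lambda>t. X t w) i g a b) = h (real b) w i - h (real a) w i) sequentially"
    by (rule eventually_grid_count)
qed

lemma height_difference:
  assumes "heights_of x k" "0 \<le> t"
  shows "k t a - k t (a + int n) = (\<Sum>i\<in>{a + 1..a + int n}. x t i)"
proof (induction n)
  case (Suc n)
  have "{a + 1..a + int (Suc n)} = insert (a + int (Suc n)) {a + 1..a + int n}"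
    by auto
  moreover have "x t (a + int (Suc n)) = k t (a + int n) - k t (a + int (Suc n))"
    using heights_spin[OF assms, of "a + int (Suc n)"] by simp
  ultimately show ?case
    using Suc by simp
qed simp

lemma mean_abs_spin:
  "\<exists>b\<ge>0. \<forall>t\<ge>0. \<forall>i. (\<integral>\<^sup>+w. ennreal \<bar>of_int (X t w i) :: real\<bar> \<partial>M) = ennreal b"
proof (intro exI conjI allI impI)
  show "0 \<le> (\<integral>z. \<bar>of_int z :: real\<bar> \<partial>measure_pmf q)"
    by (intro integral_nonneg_AE) auto
  fix t :: real and i assume t: "0 \<le> t"
  have "(\<integral>\<^sup>+w. ennreal \<bar>of_int (X t w i) :: real\<bar> \<partial>M) = ennreal (expectation (\<lambda>w. \<bar>of_int (X t w i)\<bar>))"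
    using X_integrable[OF t, of i] by (intro nn_integral_eq_integral) auto
  also have "expectation (\<lambda>w. \<bar>of_int (X t w i) :: real\<bar>) = (\<integral>z. \<bar>of_int z\<bar> \<partial>measure_pmf q)"
    using integral_distr[OF X_coordinate_measurable[OF t], of "\<lambda>z. \<bar>of_int z :: real\<bar>" i] X_coordinate_law[OF t, of i] by simp
  finally show "(\<integral>\<^sup>+w. ennreal \<bar>of_int (X t w i) :: real\<bar> \<partial>M) = ennreal (\<integral>z. \<bar>of_int z\<bar> \<partial>measure_pmf q)" .
qed

text \<open>The constant \<open>C\<close> may depend on \<open>e\<close>, through the number of
  bonds, but not on \<open>m\<close>; this order of quantifiers makes it negligible as
  \<open>m\<close> grows.\<close>

lemma current_mean_deviation:
  assumes e: "0 < e" "e \<le> 1"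
  shows "\<exists>C\<ge>0. \<forall>m>0. (\<integral>\<^sup>+w. ennreal \<bar>current 0 m w - flux * real m\<bar> \<partial>M) \<le> ennreal (sqrt (real m * (flux + 1)) + 2 * real m * e + C)"
proof -
  obtain N where N: "0 < N" "\<And>t. 0 \<le> t \<Longrightarrow> (\<integral>\<^sup>+w. ennreal \<bar>(\<Sum>j<N. rate (2 * int j) (X t w)) / real N - flux\<bar> \<partial>M) \<le> ennreal e"
    using spatial_average_rate[OF e(1)] by blast
  obtain b where b: "0 \<le> b" "\<And>t i. 0 \<le> t \<Longrightarrow> (\<integral>\<^sup>+w. ennreal \<bar>of_int (X t w i) :: real\<bar> \<partial>M) = ennreal b"
    using mean_abs_spin by blast
  \<comment> \<open>There are \<open>2 * N\<close> sites between the outermost bonds involved, and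
    each contributes its spin at time \<open>0\<close> and at time \<open>m\<close>, of mean
    absolute value \<open>b\<close>.\<close>
  define C where "C = real (2 * N) * (2 * b)"
  have "(\<integral>\<^sup>+w. ennreal \<bar>current 0 m w - flux * real m\<bar> \<partial>M) \<le> ennreal (sqrt (real m * (flux + 1)) + 2 * real m * e + C)" if m: "0 < m" for m
  proof -
    let ?avg = "\<lambda>w. (\<Sum>j<N. current (2 * int j) m w) / real N"
    let ?B = "\<lambda>w. \<Sum>i\<in>{1..2 * int N}. \<bar>of_int (X (real m) w i) :: real\<bar> + \<bar>of_int (X 0 w i)\<bar>"
    have gm: "(\<lambda>w. real (grid_count (\<lambda>t. X t w) i g 0 m)) \<in> borel_measurable M" for i g
      by (rule measurable_compose[OF grid_count_measurable]) simp
    \<comment> \<open>Refining the mesh turns the grid counts into the currents, and Fatou's lemma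
      keeps the bound.\<close>
    have avg_le: "(\<integral>\<^sup>+w. ennreal \<bar>?avg w - flux * real m\<bar> \<partial>M) \<le> ennreal (sqrt (real m * (flux + 1)) + 2 * real m * e)"
    proof (rule nn_integral_le_of_eventually_eq[OF _ _ grid_count_average[OF N(1) e N(2) m]])
      show "(\<lambda>w. ennreal \<bar>(\<Sum>j<N. real (grid_count (\<lambda>t. X t w) (2 * int j) g 0 m)) / real N - flux * real m\<bar>) \<in> borel_measurable M" for g
        using gm by measurable
      show "AE w in M. eventually (\<lambda>g. ennreal \<bar>(\<Sum>j<N. real (grid_count (\<lambda>t. X t w) (2 * int j) g 0 m)) / real N - flux * real m\<bar> =
          ennreal \<bar>?avg w - flux * real m\<bar>) sequentially"
        using eventually_grid_count_AE
      proof (rule AE_mp, intro AE_I2 impI)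
        fix w assume *: "\<forall>i a b. a \<le> b \<longrightarrow> eventually (\<lambda>g. int (grid_count (\<lambda>t. X t w) i g a b) = h (real b) w i - h (real a) w i) sequentially"
        have "eventually (\<lambda>g. \<forall>j\<in>{..<N}. int (grid_count (\<lambda>t. X t w) (2 * int j) g 0 m) = h (real m) w (2 * int j) - h (real 0) w (2 * int j)) sequentially"
        proof (rule eventually_ball_finite)
          show "\<forall>j\<in>{..<N}. eventually (\<lambda>g. int (grid_count (\<lambda>t. X t w) (2 * int j) g 0 m) = h (real m) w (2 * int j) - h (real 0) w (2 * int j)) sequentially"
            using *[rule_format, of 0 m] by blast
        qed simp
        then show "eventually (\<lambda>g. ennreal \<bar>(\<Sum>j<N. real (grid_count (\<lambda>t. X t w) (2 * int j) g 0 m)) / real N - flux * real m\<bar> =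
          ennreal \<bar>?avg w - flux * real m\<bar>) sequentially"
        proof eventually_elim
          case (elim g)
          have "real (grid_count (\<lambda>t. X t w) (2 * int j) g 0 m) = current (2 * int j) m w" if "j < N" for j
          proof -
            have "int (grid_count (\<lambda>t. X t w) (2 * int j) g 0 m) = h (real m) w (2 * int j) - h 0 w (2 * int j)"
              using elim that by simp
            then have "of_int (int (grid_count (\<lambda>t. X t w) (2 * int j) g 0 m)) = current (2 * int j) m w"
              unfolding current_def by (simp only:)
            then show ?thesis by simp
          qed
          then show ?case by simp
        qed
      qed
    qed
    have B_int: "(\<integral>\<^sup>+w. ennreal (?B w) \<partial>M) = ennreal C"
    proof -
      have xm: "(\<lambda>w. ennreal \<bar>of_int (X t w i)\<bar>) \<in> borel_measurable M" if "0 \<le> t" for t i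
        using X_integrable[OF that, of i] by measurable
      have "(\<integral>\<^sup>+w. ennreal (?B w) \<partial>M) = (\<integral>\<^sup>+w. (\<Sum>i\<in>{1..2 * int N}. ennreal \<bar>of_int (X (real m) w i)\<bar> + ennreal \<bar>of_int (X 0 w i)\<bar>) \<partial>M)"
        by (simp add: sum_ennreal[symmetric] ennreal_plus)
      also have "\<dots> = (\<Sum>i\<in>{1..2 * int N}. ennreal b + ennreal b)"
        using xm by (simp add: nn_integral_sum nn_integral_add b(2))
      also have "\<dots> = ennreal C"
        using b(1) unfolding C_def by (simp add: ennreal_plus[symmetric] ennreal_of_nat_eq_real_of_nat ennreal_mult[symmetric] del: ennreal_plus)
      finally show ?thesis .
    qed
    have "(\<integral>\<^sup>+w. ennreal \<bar>current 0 m w - flux * real m\<bar> \<partial>M) \<le> (\<integral>\<^sup>+w. ennreal \<bar>?avg w - flux * real m\<bar> + ennreal (?B w) \<partial>M)"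
    proof (rule nn_integral_mono_AE, use heights in \<open>rule AE_mp\<close>, intro AE_I2 impI)
      fix w assume hw: "heights_of (\<lambda>t. X t w) (\<lambda>t. h t w)"
      \<comment> \<open>Conservation of mass: the difference of the two currents is the change of
        the total spin on the sites between the bonds.\<close>
      have diff: "\<bar>current 0 m w - current (2 * int j) m w\<bar> \<le> ?B w" if j: "j < N" for j
      proof -
        have "current 0 m w - current (2 * int j) m w = of_int ((h (real m) w 0 - h (real m) w (0 + int (2 * j))) - (h 0 w 0 - h 0 w (0 + int (2 * j))))"
          unfolding current_def by simp
        also have "\<dots> = (\<Sum>i\<in>{0 + 1..0 + int (2 * j)}. of_int (X (real m) w i) - of_int (X 0 w i))"
          by (simp only: height_difference[OF hw of_nat_0_le_iff] height_difference[OF hw order_refl] of_int_diff of_int_sum sum_subtractf)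
        also have "\<bar>\<dots>\<bar> \<le> (\<Sum>i\<in>{0 + 1..0 + int (2 * j)}. \<bar>of_int (X (real m) w i) :: real\<bar> + \<bar>of_int (X 0 w i)\<bar>)"
          by (rule order_trans[OF sum_abs]) (intro sum_mono abs_triangle_ineq4)
        also have "\<dots> \<le> ?B w"
          using j by (intro sum_mono2) auto
        finally show ?thesis .
      qed
      have "current 0 m w - ?avg w = (\<Sum>j<N. current 0 m w - current (2 * int j) m w) / real N"
        using N(1) by (simp add: sum_subtractf diff_divide_distrib)
      also have "\<bar>\<dots>\<bar> \<le> (\<Sum>j<N. ?B w) / real N"
        unfolding abs_divide abs_of_nat by (intro divide_right_mono order_trans[OF sum_abs] sum_mono diff) auto
      also have "\<dots> = ?B w"
        using N(1) by simp
      finally have "\<bar>current 0 m w - flux * real m\<bar> \<le> \<bar>?avg w - flux * real m\<bar> + ?B w"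
        by linarith
      then have "ennreal \<bar>current 0 m w - flux * real m\<bar> \<le> ennreal (\<bar>?avg w - flux * real m\<bar> + ?B w)"
        by (rule ennreal_leI)
      also have "\<dots> = ennreal \<bar>?avg w - flux * real m\<bar> + ennreal (?B w)"
        by (intro ennreal_plus sum_nonneg) auto
      finally show "ennreal \<bar>current 0 m w - flux * real m\<bar> \<le> ennreal \<bar>?avg w - flux * real m\<bar> + ennreal (?B w)" .
    qed
    also have "\<dots> = (\<integral>\<^sup>+w. ennreal \<bar>?avg w - flux * real m\<bar> \<partial>M) + (\<integral>\<^sup>+w. ennreal (?B w) \<partial>M)"
    proof (rule nn_integral_add)
      have [measurable]: "current i m \<in> borel_measurable M" for i
        by (rule current_measurable)
      show "(\<lambda>w. ennreal \<bar>?avg w - flux * real m\<bar>) \<in> borel_measurable M"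
        by measurable
      have [measurable]: "(\<lambda>w. of_int (X t w i) :: real) \<in> borel_measurable M" if "0 \<le> t" for t i
        using X_integrable[OF that, of i] by auto
      show "(\<lambda>w. ennreal (?B w)) \<in> borel_measurable M"
        by measurable
    qed
    also have "\<dots> \<le> ennreal (sqrt (real m * (flux + 1)) + 2 * real m * e) + ennreal C"
      unfolding B_int by (intro add_right_mono avg_le)
    also have "\<dots> = ennreal (sqrt (real m * (flux + 1)) + 2 * real m * e + C)"
      using flux_nonneg e b(1) unfolding C_def by (intro ennreal_plus[symmetric] add_nonneg_nonneg) auto
    finally show ?thesis .
  qed
  moreover have "0 \<le> C"
    unfolding C_def using b(1) by simp
  ultimately show ?thesis by blast
qed

text \<open>No integrability of the jump counts is assumed; it comes out of the deviation bound at
  \<open>e = 1\<close>.\<close>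

lemma current_integrable: "integrable M (current 0 m)"
proof (cases "m = 0")
  case True
  then show ?thesis unfolding current_def by simp
next
  case False
  then obtain C where "(\<integral>\<^sup>+w. ennreal \<bar>current 0 m w - flux * real m\<bar> \<partial>M) \<le> ennreal C"
    using current_mean_deviation[of 1] by auto
  then have "(\<integral>\<^sup>+w. ennreal (norm (current 0 m w - flux * real m)) \<partial>M) < \<infinity>"
    by (auto intro: le_less_trans)
  then have "integrable M (\<lambda>w. current 0 m w - flux * real m)"
    using current_measurable by (intro integrableI_bounded) auto
  then have "integrable M (\<lambda>w. (current 0 m w - flux * real m) + flux * real m)"
    by (intro Bochner_Integration.integrable_add) auto
  then show ?thesis by simp
qed

lemma current_L1_limit:
  "(\<lambda>m. expectation (\<lambda>w. \<bar>current 0 m w - flux * real m\<bar>)) \<in> o(\<lambda>m. real m)"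
proof (rule landau_o.smallI)
  fix c :: real assume c: "0 < c"
  \<comment> \<open>The value \<open>c / 8\<close> turns the term \<open>2 * m * e\<close> into at
    most \<open>c * m / 4\<close>.\<close>
  define e where "e = min 1 (c / 8)"
  have e: "0 < e" "e \<le> 1" "8 * e \<le> c"
    unfolding e_def using c by auto
  obtain C where C: "0 \<le> C" "\<And>m. 0 < m \<Longrightarrow> (\<integral>\<^sup>+w. ennreal \<bar>current 0 m w - flux * real m\<bar> \<partial>M) \<le> ennreal (sqrt (real m * (flux + 1)) + 2 * real m * e + C)"
    using current_mean_deviation[OF e(1,2)] by blast
  \<comment> \<open>The first two summands make the square root and the constant \<open>C\<close> at
    most \<open>c * m / 4\<close> each; the last makes \<open>m\<close> positive.\<close>
  obtain m0 :: nat where m0: "16 * (flux + 1) / c\<^sup>2 + 4 * C / c + 1 < real m0"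
    using reals_Archimedean2 by blast
  have "norm (expectation (\<lambda>w. \<bar>current 0 m w - flux * real m\<bar>)) \<le> c * norm (real m)" if "m0 \<le> m" for m
  proof -
    have p: "0 \<le> 16 * (flux + 1) / c\<^sup>2" "0 \<le> 4 * C / c"
      using c C flux_nonneg by auto
    then have mm: "16 * (flux + 1) / c\<^sup>2 \<le> real m" "4 * C / c \<le> real m" "1 < real m"
    proof -
      have "real m0 \<le> real m" using that by simp
      then show "16 * (flux + 1) / c\<^sup>2 \<le> real m" "4 * C / c \<le> real m" "1 < real m"
        using m0 p by linarith+
    qed
    then have m: "0 < m" by simp
    have "16 * (flux + 1) \<le> c\<^sup>2 * real m"
      using mm(1) c by (simp add: divide_le_eq mult.commute)
    then have "16 * (real m * (flux + 1)) \<le> (c * real m)\<^sup>2"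
      using mult_left_mono[of "16 * (flux + 1)" "c\<^sup>2 * real m" "real m"] by (simp add: power2_eq_square algebra_simps)
    then have "real m * (flux + 1) \<le> (c * real m / 4)\<^sup>2"
      by (simp add: power_divide)
    then have s: "sqrt (real m * (flux + 1)) \<le> c * real m / 4"
      using c by (intro real_le_lsqrt) (auto simp: flux_nonneg)
    have "C \<le> c * real m / 4"
      using mm(2) c by (simp add: divide_le_eq mult.commute)
    have "2 * real m * e \<le> c * real m / 4"
      using mult_right_mono[OF e(3), of "real m"] by (simp add: algebra_simps)
    have le: "sqrt (real m * (flux + 1)) + 2 * real m * e + C \<le> c * real m"
    proof -
      have "0 \<le> c * real m" using c by simp
      then show ?thesis
        using s \<open>C \<le> c * real m / 4\<close> \<open>2 * real m * e \<le> c * real m / 4\<close> by linarith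
    qed
    have "ennreal (expectation (\<lambda>w. \<bar>current 0 m w - flux * real m\<bar>)) = (\<integral>\<^sup>+w. ennreal \<bar>current 0 m w - flux * real m\<bar> \<partial>M)"
      using current_integrable by (intro nn_integral_eq_integral[symmetric]) auto
    also have "\<dots> \<le> ennreal (c * real m)"
      using C(2)[OF m] ennreal_leI[OF le] by (rule order_trans)
    finally show ?thesis
      using c by (simp add: ennreal_le_iff integral_nonneg_AE)
  qed
  then show "eventually (\<lambda>m. norm (expectation (\<lambda>w. \<bar>current 0 m w - flux * real m\<bar>)) \<le> c * norm (real m)) at_top"
    by (auto simp: eventually_at_top_linorder)
qed

end

section \<open>Almost sure convergence of the current\<close>

context stationary_deposition
begin

abbreviation "count_path_space \<equiv> PiM (UNIV :: nat set) (\<lambda>_. count_space (UNIV :: nat set))"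

definition path_count :: "nat \<Rightarrow> (nat \<Rightarrow> config) \<Rightarrow> nat \<Rightarrow> nat" where
  "path_count g y k = (\<Sum>l\<in>{k * Suc g..<Suc k * Suc g}. of_bool (bond_jump 0 (y l) (y (Suc l))))"

text \<open>Delaying by \<open>j\<close> units of time means delaying by \<open>j * Suc g\<close>
  grid steps, so the delayed counts are a fixed functional of a shifted grid path.\<close>

lemma grid_count_path:
  "grid_count (\<lambda>t. X t w) 0 g (k + j) (Suc (k + j)) = path_count g (grid_path (1 / real (Suc g)) (j * Suc g) w) k"
proof -
  have "grid_count (\<lambda>t. X t w) 0 g (k + j) (Suc (k + j)) =
    (\<Sum>l\<in>{k * Suc g + j * Suc g..<Suc k * Suc g + j * Suc g}.
      of_bool (bond_jump 0 (X (real l / real (Suc g)) w) (X (real (Suc l) / real (Suc g)) w)))"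
    unfolding grid_count_def by (simp only: add_mult_distrib add_Suc[symmetric])
  also have "\<dots> = path_count g (grid_path (1 / real (Suc g)) (j * Suc g) w) k"
    unfolding sum.shift_bounds_nat_ivl path_count_def grid_path_def
    by (simp only: add.commute[of _ "j * Suc g"] times_divide_eq_right mult_1_right add_Suc_right)
  finally show ?thesis .
qed

lemma path_count_measurable: "path_count g \<in> path_space \<rightarrow>\<^sub>M count_path_space"
proof (rule measurable_PiM_single')
  fix k :: nat
  have bj: "Measurable.pred path_space (\<lambda>y. bond_jump 0 (y l) (y (Suc l)))" for l
  proof -
    have "(\<lambda>y. (y l, y (Suc l))) \<in> path_space \<rightarrow>\<^sub>M S \<Otimes>\<^sub>M S"
      by (intro measurable_Pair measurable_component_singleton) auto
    from measurable_compose[OF this bond_jump_measurable[of 0]] show ?thesis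
      by simp
  qed
  have "(\<lambda>y. real (path_count g y k)) \<in> borel_measurable path_space"
    unfolding path_count_def of_nat_sum of_nat_of_bool using bj by measurable
  then have "(\<lambda>y. nat \<lfloor>real (path_count g y k)\<rfloor>) \<in> path_space \<rightarrow>\<^sub>M count_space UNIV"
    by measurable
  then show "(\<lambda>y. path_count g y k) \<in> path_space \<rightarrow>\<^sub>M count_space UNIV"
    by simp
qed auto

text \<open>Heights never decrease, so \<open>nat\<close> loses nothing along a path with
  \<open>heights_of\<close>; natural-number values make the sequence space countable in each
  coordinate.\<close>

definition increments :: "nat \<Rightarrow> 'w \<Rightarrow> nat \<Rightarrow> nat" where
  "increments j w k = nat (h (real (Suc (k + j))) w 0 - h (real (k + j)) w 0)"

lemma increments_measurable: "increments j \<in> M \<rightarrow>\<^sub>M count_path_space"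
proof (rule measurable_PiM_single')
  show "(\<lambda>w. increments j w k) \<in> M \<rightarrow>\<^sub>M count_space UNIV" for k
    unfolding increments_def
    by (rule measurable_two_coordinates[where g = "\<lambda>x y. nat (x - y)"]) (auto intro: h_measurable)
qed auto

text \<open>For every mesh the grid counts have a law invariant under delay. Almost surely the
  counts in finitely many time intervals eventually equal the increments, so the probabilities of
  finite-dimensional events converge, by dominated convergence, and invariance passes to the
  limit.\<close>

lemma increments_stationary:
  "distr M count_path_space (increments j) = distr M count_path_space (increments 0)"
proof (rule measure_eqI_PiM_infinite[where M = "\<lambda>_. count_space UNIV" and I = UNIV])
  show "finite_measure (distr M count_path_space (increments j))"
    by (intro finite_measure_distr increments_measurable)
  fix A :: "nat \<Rightarrow> nat set" and J :: "nat set"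
  assume J: "finite J" "J \<subseteq> UNIV"
  define E where "E = prod_emb UNIV (\<lambda>_. count_space (UNIV :: nat set)) J (Pi\<^sub>E J A)"
  have E: "E \<in> sets count_path_space"
    unfolding E_def using J by (intro sets_PiM_I) auto
  have E_iff: "y \<in> E \<longleftrightarrow> (\<forall>k\<in>J. y k \<in> A k)" for y
    unfolding E_def prod_emb_def by (auto simp: PiE_iff)
  define G where "G j g w k = grid_count (\<lambda>t. X t w) 0 g (k + j) (Suc (k + j))" for j g w k
  have G_eq: "G j g w = path_count g (grid_path (1 / real (Suc g)) (j * Suc g) w)" for j g w
    unfolding G_def grid_count_path ..
  have gp: "grid_path (1 / real (Suc g)) (j * Suc g) \<in> M \<rightarrow>\<^sub>M path_space" for j g
    by (rule grid_path_measurable) simp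
  have G_m: "G j g \<in> M \<rightarrow>\<^sub>M count_path_space" for j g
    unfolding G_eq[abs_def] by (rule measurable_compose[OF gp path_count_measurable])
  have G_law: "distr M count_path_space (G j g) = distr M count_path_space (G 0 g)" for j g
  proof -
    have "distr M count_path_space (G j g) = distr (distr M path_space (grid_path (1 / real (Suc g)) (j * Suc g))) count_path_space (path_count g)" for j
      unfolding G_eq[abs_def] by (subst distr_distr[OF path_count_measurable gp]) (simp add: comp_def)
    then show ?thesis
      by (simp only: grid_path_stationary[of "1 / real (Suc g)" "j * Suc g"] mult_0 of_nat_0_le_iff zero_le_divide_1_iff)
  qed
  have lim: "(\<lambda>g. measure (distr M count_path_space (G j g)) E) \<longlonglongrightarrow> measure (distr M count_path_space (increments j)) E" for j
  proof -
    have ind: "measure (distr M count_path_space Y) E = expectation (\<lambda>w. indicator E (Y w))" if Y: "Y \<in> M \<rightarrow>\<^sub>M count_path_space" for Y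
    proof -
      have "expectation (\<lambda>w. indicat_real E (Y w)) = (\<integral>y. indicat_real E y \<partial>distr M count_path_space Y)"
        by (rule integral_distr[OF Y, symmetric]) (use E in simp)
      also have "\<dots> = measure (distr M count_path_space Y) E"
        using E sets.sets_into_space[OF E] by (simp add: Int_absorb2)
      finally show ?thesis ..
    qed
    show ?thesis
      unfolding ind[OF G_m] ind[OF increments_measurable]
    proof (rule integral_dominated_convergence[where w = "\<lambda>_. 1"])
      show "AE w in M. (\<lambda>g. indicator E (G j g w) :: real) \<longlonglongrightarrow> indicator E (increments j w)"
        using eventually_grid_count_AE
      proof (rule AE_mp, intro AE_I2 impI tendsto_eventually)
        fix w assume *: "\<forall>i a b. a \<le> b \<longrightarrow> eventually (\<lambda>g. int (grid_count (\<lambda>t. X t w) i g a b) = h (real b) w i - h (real a) w i) sequentially"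
        \<comment> \<open>Finiteness of \<open>J\<close> lets one mesh be fine enough for all
          coordinates of the event.\<close>
        have "eventually (\<lambda>g. \<forall>k\<in>J. int (G j g w k) = h (real (Suc (k + j))) w 0 - h (real (k + j)) w 0) sequentially"
        proof (rule eventually_ball_finite[OF J(1)])
          show "\<forall>k\<in>J. eventually (\<lambda>g. int (G j g w k) = h (real (Suc (k + j))) w 0 - h (real (k + j)) w 0) sequentially"
            unfolding G_def using *[rule_format, of _ _ 0] by (meson le_SucI order_refl)
        qed
        then show "eventually (\<lambda>g. (indicator E (G j g w) :: real) = indicator E (increments j w)) sequentially"
        proof eventually_elim
          case (elim g)
          then have "\<forall>k\<in>J. G j g w k = increments j w k"
            unfolding increments_def by (metis nat_int)
          then have "G j g w \<in> E \<longleftrightarrow> increments j w \<in> E"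
            unfolding E_iff by auto
          then show ?case by (simp add: indicator_def)
        qed
      qed
      show "(\<lambda>w. indicator E (G j g w) :: real) \<in> borel_measurable M" for g
        by (rule measurable_compose[OF G_m]) (use E in simp)
      show "(\<lambda>w. indicator E (increments j w) :: real) \<in> borel_measurable M"
        by (rule measurable_compose[OF increments_measurable]) (use E in simp)
    qed (auto simp: indicator_def)
  qed
  have "measure (distr M count_path_space (increments j)) E = measure (distr M count_path_space (increments 0)) E"
    by (rule LIMSEQ_unique[OF lim[of j, unfolded G_law[of j]] lim[of 0]])
  moreover have "finite_measure (distr M count_path_space (increments j))" for j
    by (intro finite_measure_distr increments_measurable)
  ultimately show "emeasure (distr M count_path_space (increments j)) (prod_emb UNIV (\<lambda>_. count_space UNIV) J (Pi\<^sub>E J A)) =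
    emeasure (distr M count_path_space (increments 0)) (prod_emb UNIV (\<lambda>_. count_space UNIV) J (Pi\<^sub>E J A))"
    unfolding E_def[symmetric] by (simp add: finite_measure.emeasure_eq_measure)
qed simp_all

lemma sum_increments:
  assumes "heights_of (\<lambda>t. X t w) (\<lambda>t. h t w)"
  shows "(\<Sum>k<m. real (increments 0 w k)) = current 0 m w"
proof (induction m)
  case 0
  then show ?case by (simp add: current_def)
next
  case (Suc m)
  have "h (real m) w 0 \<le> h (real (Suc m)) w 0"
    by (rule heights_mono[OF assms]) simp_all
  then have "real (increments 0 w m) = of_int (h (real (Suc m)) w 0 - h (real m) w 0)"
    unfolding increments_def by simp
  then show ?case
    using Suc by (simp add: current_def)
qed

text \<open>The ergodic argument is run for the shift on sequences under the law of the increments,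
  where stationarity is a measure-preserving map; the conclusion is then pulled back to
  \<open>M\<close>.\<close>

theorem current_AE_tendsto:
  "AE w in M. (\<lambda>n. current 0 n w / real n) \<longlonglongrightarrow> flux"
proof -
  define N where "N = distr M count_path_space (increments 0)"
  define sh where "sh y = (\<lambda>k. y (Suc k) :: nat)" for y :: "nat \<Rightarrow> nat"
  have sN: "sets N = sets count_path_space"
    unfolding N_def by simp
  have sh_m: "sh \<in> count_path_space \<rightarrow>\<^sub>M count_path_space"
    unfolding sh_def by (rule measurable_PiM_single') (auto intro: measurable_component_singleton)
  have sh_N: "sh \<in> N \<rightarrow>\<^sub>M N"
    using sh_m sN by (simp cong: measurable_cong_sets)
  interpret N: prob_space N
    unfolding N_def by (rule prob_space_distr[OF increments_measurable])
  have "distr N N sh = distr N count_path_space sh"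
    by (rule distr_cong) (auto simp: sN)
  also have "\<dots> = distr M count_path_space (sh \<circ> increments 0)"
    unfolding N_def by (rule distr_distr[OF sh_m increments_measurable])
  also have "sh \<circ> increments 0 = increments 1"
    by (simp add: fun_eq_iff sh_def increments_def)
  also have "distr M count_path_space (increments 1) = N"
    unfolding N_def by (rule increments_stationary)
  finally interpret N: measure_preserving_map N sh
    by unfold_locales (rule sh_N)
  have pow: "(sh ^^ k) y = (\<lambda>l. y (l + k))" for k y
    by (induction k arbitrary: y) (simp_all add: sh_def funpow_swap1 fun_eq_iff)
  define f where "f y = real (y 0)" for y :: "nat \<Rightarrow> nat"
  have f_m: "(\<lambda>y. real (y k)) \<in> borel_measurable count_path_space" for k
    by (rule measurable_compose[OF measurable_component_singleton[OF UNIV_I]]) simp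
  have S_m: "(\<lambda>y. \<Sum>k<m. real (y k)) \<in> borel_measurable count_path_space" for m
    by (intro borel_measurable_sum f_m)
  have sums: "(\<Sum>k<m. f ((sh ^^ k) y)) = (\<Sum>k<m. real (y k))" for m y
    unfolding f_def pow by simp
  have "AE y in N. (\<lambda>n. (\<Sum>k<n. f ((sh ^^ k) y)) / real n) \<longlonglongrightarrow> flux"
  proof (rule N.ergodic_averages_AE_tendsto)
    have "integrable M (\<lambda>w. \<Sum>k<1. real (increments 0 w k))"
      using current_integrable[of 1]
    proof (rule Bochner_Integration.integrable_cong_AE_imp)
      show "(\<lambda>w. \<Sum>k<1. real (increments 0 w k)) \<in> borel_measurable M"
        by (rule measurable_compose[OF increments_measurable S_m])
      show "AE w in M. current 0 1 w = (\<Sum>k<1. real (increments 0 w k))"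
        using heights by (rule AE_mp) (intro AE_I2 impI, rule sum_increments[symmetric])
    qed
    then show "integrable N f"
      unfolding N_def f_def using f_m by (subst integrable_distr_eq[OF increments_measurable]) auto
    show "0 \<le> f y" for y
      unfolding f_def by simp
    have "(\<integral>y. \<bar>(\<Sum>k<m. f ((sh ^^ k) y)) - flux * real m\<bar> \<partial>N) = expectation (\<lambda>w. \<bar>current 0 m w - flux * real m\<bar>)" for m
    proof -
      have m1: "(\<lambda>y. \<bar>(\<Sum>k<m. real (y k)) - flux * real m\<bar>) \<in> borel_measurable count_path_space"
        using S_m by measurable
      have "(\<integral>y. \<bar>(\<Sum>k<m. f ((sh ^^ k) y)) - flux * real m\<bar> \<partial>N) = expectation (\<lambda>w. \<bar>(\<Sum>k<m. real (increments 0 w k)) - flux * real m\<bar>)"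
        unfolding N_def sums by (rule integral_distr[OF increments_measurable m1])
      also have "\<dots> = expectation (\<lambda>w. \<bar>current 0 m w - flux * real m\<bar>)"
      proof (rule integral_cong_AE)
        show "(\<lambda>w. \<bar>(\<Sum>k<m. real (increments 0 w k)) - flux * real m\<bar>) \<in> borel_measurable M"
          by (rule measurable_compose[OF increments_measurable m1])
        show "(\<lambda>w. \<bar>current 0 m w - flux * real m\<bar>) \<in> borel_measurable M"
          using current_measurable by measurable
        show "AE w in M. \<bar>(\<Sum>k<m. real (increments 0 w k)) - flux * real m\<bar> = \<bar>current 0 m w - flux * real m\<bar>"
          using heights by (rule AE_mp) (intro AE_I2 impI, simp only: sum_increments)
      qed
      finally show ?thesis .
    qed
    then show "(\<lambda>m. \<integral>y. \<bar>(\<Sum>k<m. f ((sh ^^ k) y)) - flux * real m\<bar> \<partial>N) \<in> o(\<lambda>m. real m)"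
      using current_L1_limit by simp
  qed
  then have "AE w in M. (\<lambda>n. (\<Sum>k<n. real (increments 0 w k)) / real n) \<longlonglongrightarrow> flux"
    unfolding N_def sums by (rule AE_distrD[OF increments_measurable])
  then show ?thesis
    using heights
  proof (elim AE_mp, intro AE_I2 impI)
    fix w assume "heights_of (\<lambda>t. X t w) (\<lambda>t. h t w)" "(\<lambda>n. (\<Sum>k<n. real (increments 0 w k)) / real n) \<longlonglongrightarrow> flux"
    then show "(\<lambda>n. current 0 n w / real n) \<longlonglongrightarrow> flux"
      by (simp only: sum_increments)
  qed
qed

end

section \<open>Heights along a ray\<close>

text \<open>The sum of the squares has finite mean, so it converges almost everywhere and its terms
  tend to \<open>0\<close>.\<close>

lemma summable_L2_imp_AE_tendsto_0:
  fixes Y :: "nat \<Rightarrow> 'a \<Rightarrow> real"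
  assumes int: "\<And>n. integrable M (\<lambda>x. (Y n x)\<^sup>2)" and sum: "summable (\<lambda>n. \<integral>x. (Y n x)\<^sup>2 \<partial>M)"
  shows "AE x in M. (\<lambda>n. Y n x) \<longlonglongrightarrow> 0"
proof -
  have [measurable]: "(\<lambda>x. ennreal ((Y n x)\<^sup>2)) \<in> borel_measurable M" for n
    using int[of n] by measurable
  have "(\<integral>\<^sup>+x. (\<Sum>n. ennreal ((Y n x)\<^sup>2)) \<partial>M) = (\<Sum>n. \<integral>\<^sup>+x. ennreal ((Y n x)\<^sup>2) \<partial>M)"
    by (rule nn_integral_suminf) measurable
  also have "\<dots> = (\<Sum>n. ennreal (\<integral>x. (Y n x)\<^sup>2 \<partial>M))"
    using int by (simp add: nn_integral_eq_integral)
  also have "\<dots> = ennreal (\<Sum>n. \<integral>x. (Y n x)\<^sup>2 \<partial>M)"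
    using sum by (intro suminf_ennreal2) (auto intro: integral_nonneg_AE)
  finally have "(\<integral>\<^sup>+x. (\<Sum>n. ennreal ((Y n x)\<^sup>2)) \<partial>M) \<noteq> \<infinity>"
    by simp
  then have "AE x in M. (\<Sum>n. ennreal ((Y n x)\<^sup>2)) \<noteq> \<infinity>"
    by (intro nn_integral_PInf_AE) measurable
  then show ?thesis
  proof (rule AE_mp, intro AE_I2 impI)
    fix x assume "(\<Sum>n. ennreal ((Y n x)\<^sup>2)) \<noteq> \<infinity>"
    then have "summable (\<lambda>n. (Y n x)\<^sup>2)"
      by (intro summable_suminf_not_top) auto
    then have "(\<lambda>n. (Y n x)\<^sup>2) \<longlonglongrightarrow> 0"
      by (rule summable_LIMSEQ_zero)
    then have "(\<lambda>n. sqrt ((Y n x)\<^sup>2)) \<longlonglongrightarrow> sqrt 0"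
      by (rule tendsto_real_sqrt)
    then have "(\<lambda>n. \<bar>Y n x\<bar>) \<longlonglongrightarrow> 0"
      by simp
    then show "(\<lambda>n. Y n x) \<longlonglongrightarrow> 0"
      by (rule tendsto_rabs_zero_cancel)
  qed
qed

section \<open>Interpolation between square times\<close>

definition root_floor :: "real \<Rightarrow> nat" where
  "root_floor t = nat \<lfloor>sqrt t\<rfloor>"

lemma root_floor_bounds:
  assumes "0 \<le> t"
  shows "(real (root_floor t))\<^sup>2 \<le> t" "t \<le> (real (Suc (root_floor t)))\<^sup>2"
proof -
  have a: "real (root_floor t) \<le> sqrt t" "sqrt t \<le> real (Suc (root_floor t))"
    unfolding root_floor_def using assms by (auto, linarith+)
  have "(real (root_floor t))\<^sup>2 \<le> (sqrt t)\<^sup>2" "(sqrt t)\<^sup>2 \<le> (real (Suc (root_floor t)))\<^sup>2"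
    using a assms by (auto intro!: power_mono simp del: of_nat_Suc real_sqrt_pow2)
  then show "(real (root_floor t))\<^sup>2 \<le> t" "t \<le> (real (Suc (root_floor t)))\<^sup>2"
    using assms by simp_all
qed

lemma root_floor_at_top: "filterlim root_floor sequentially at_top"
  unfolding root_floor_def
  by (rule filterlim_compose[OF filterlim_nat_sequentially filterlim_compose[OF filterlim_floor_sequentially sqrt_at_top]])

text \<open>Because both neighbouring squares are asymptotic to \<open>t\<close>, a monotone
  quantity known at the squares has the same linear growth at all times.\<close>

lemma root_floor_ratio:
  "((\<lambda>t. (real (root_floor t))\<^sup>2 / t) \<longlongrightarrow> 1) at_top"
  "((\<lambda>t. (real (Suc (root_floor t)))\<^sup>2 / t) \<longlongrightarrow> 1) at_top"
proof -
  have l1: "((\<lambda>t. (real (root_floor t) / real (Suc (root_floor t)))\<^sup>2) \<longlongrightarrow> 1\<^sup>2) at_top"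
    by (intro tendsto_power filterlim_compose[OF LIMSEQ_n_over_Suc_n root_floor_at_top])
  have l2: "((\<lambda>t. (real (Suc (root_floor t)) / real (root_floor t))\<^sup>2) \<longlongrightarrow> 1\<^sup>2) at_top"
    by (intro tendsto_power filterlim_compose[OF LIMSEQ_Suc_n_over_n root_floor_at_top])
  have ev: "eventually (\<lambda>t::real. 1 \<le> t \<and> 1 \<le> root_floor t) at_top"
    using filterlim_at_top[THEN iffD1, OF root_floor_at_top, rule_format, of 1]
    by (intro eventually_conj eventually_ge_at_top)
  show "((\<lambda>t. (real (root_floor t))\<^sup>2 / t) \<longlongrightarrow> 1) at_top"
  proof (rule tendsto_sandwich[OF _ _ l1[simplified] tendsto_const])
    show "eventually (\<lambda>t. (real (root_floor t) / (1 + real (root_floor t)))\<^sup>2 \<le> (real (root_floor t))\<^sup>2 / t) at_top"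
      using ev
    proof eventually_elim
      case (elim t)
      then show ?case
        using root_floor_bounds(2)[of t] unfolding power_divide
        by (intro divide_left_mono mult_pos_pos) auto
    qed
    show "eventually (\<lambda>t. (real (root_floor t))\<^sup>2 / t \<le> 1) at_top"
      using ev by eventually_elim (use root_floor_bounds(1) in \<open>auto simp: divide_le_eq\<close>)
  qed
  show "((\<lambda>t. (real (Suc (root_floor t)))\<^sup>2 / t) \<longlongrightarrow> 1) at_top"
  proof (rule tendsto_sandwich[OF _ _ tendsto_const l2[simplified]])
    show "eventually (\<lambda>t. (real (Suc (root_floor t)))\<^sup>2 / t \<le> ((1 + real (root_floor t)) / real (root_floor t))\<^sup>2) at_top"
      using ev
    proof eventually_elim
      case (elim t)
      then show ?case
        using root_floor_bounds(1)[of t] unfolding power_divide of_nat_Suc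
        by (intro divide_left_mono mult_pos_pos) (auto simp: add.commute)
    qed
    show "eventually (\<lambda>t. 1 \<le> (real (Suc (root_floor t)))\<^sup>2 / t) at_top"
      using ev by eventually_elim (use root_floor_bounds(2) in \<open>auto simp: le_divide_eq\<close>)
  qed
qed

context stationary_deposition
begin

text \<open>For \<open>a \<ge> 0\<close> this is minus the sum of the centred spins on the sites
  \<open>1\<close> to \<open>a\<close>; for negative \<open>a\<close> it is their sum on
  \<open>a + 1\<close> to \<open>0\<close>.\<close>

definition centered_height :: "real \<Rightarrow> 'w \<Rightarrow> int \<Rightarrow> real" where
  "centered_height t w a = of_int (h t w a - h t w 0) + mean_spin * of_int a"

lemma centered_height_diff:
  assumes "heights_of (\<lambda>t. X t w) (\<lambda>t. h t w)" "0 \<le> t" "a \<le> b"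
  shows "centered_height t w a - centered_height t w b = (\<Sum>i\<in>{a + 1..b}. of_int (X t w i) - mean_spin)"
proof -
  have b: "b = a + int (nat (b - a))" using assms(3) by simp
  have "h t w a - h t w b = (\<Sum>i\<in>{a + 1..b}. X t w i)"
    using height_difference[OF assms(1,2), of a "nat (b - a)"] b by simp
  then have "(of_int (h t w a - h t w b) :: real) = (\<Sum>i\<in>{a + 1..b}. of_int (X t w i))"
    by (simp only: of_int_sum)
  moreover have "of_int (b - a) = real (card {a + 1..b})"
    using assms(3) by simp
  moreover have "centered_height t w a - centered_height t w b = of_int (h t w a - h t w b) - of_int (b - a) * mean_spin"
    unfolding centered_height_def of_int_diff by (simp only: algebra_simps)
  ultimately show ?thesis
    by (simp only: sum_subtractf sum_constant)
qed

text \<open>A bound for the centred heights at all sites within \<open>l\<close> of \<open>a\<close>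
  at once: the centred sum up to the reference site \<open>a\<close>, where cancellation matters,
  plus a crude sum of absolute values over the window.\<close>

definition height_fluctuation :: "real \<Rightarrow> int \<Rightarrow> int \<Rightarrow> 'w \<Rightarrow> real" where
  "height_fluctuation t a l w = \<bar>\<Sum>i\<in>{min 0 a + 1..max 0 a}. of_int (X t w i) - mean_spin\<bar> +
    (\<Sum>i\<in>{a - l..a + l}. \<bar>of_int (X t w i) - mean_spin\<bar>)"

lemma abs_centered_height_le:
  assumes hw: "heights_of (\<lambda>t. X t w) (\<lambda>t. h t w)" "0 \<le> t" and k: "\<bar>k - a\<bar> \<le> l"
  shows "\<bar>centered_height t w k\<bar> \<le> height_fluctuation t a l w"
proof -
  have "centered_height t w 0 = 0"
    unfolding centered_height_def by simp
  then have "\<bar>centered_height t w a\<bar> = \<bar>\<Sum>i\<in>{min 0 a + 1..max 0 a}. of_int (X t w i) - mean_spin\<bar>"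
    using centered_height_diff[OF hw, of 0 a] centered_height_diff[OF hw, of a 0] by (cases "0 \<le> a") (auto simp: min_def max_def)
  moreover have "\<bar>centered_height t w k - centered_height t w a\<bar> \<le> (\<Sum>i\<in>{a - l..a + l}. \<bar>of_int (X t w i) - mean_spin\<bar>)"
  proof -
    have "\<bar>centered_height t w k - centered_height t w a\<bar> = \<bar>\<Sum>i\<in>{min k a + 1..max k a}. of_int (X t w i) - mean_spin\<bar>"
      using centered_height_diff[OF hw, of k a] centered_height_diff[OF hw, of a k] by (cases "k \<le> a") (auto simp: min_def max_def abs_minus_commute)
    also have "\<dots> \<le> (\<Sum>i\<in>{min k a + 1..max k a}. \<bar>of_int (X t w i) - mean_spin\<bar>)"
      by (rule sum_abs)
    also have "\<dots> \<le> (\<Sum>i\<in>{a - l..a + l}. \<bar>of_int (X t w i) - mean_spin\<bar>)"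
      using k by (intro sum_mono2) auto
    finally show ?thesis .
  qed
  ultimately show ?thesis
    unfolding height_fluctuation_def by linarith
qed

text \<open>Independence gives the linear term in \<open>a\<close>; Cauchy-Schwarz on the window
  gives the square of its length. The latter is affordable since the window grows like the square
  root of time.\<close>

lemma height_fluctuation_second_moment:
  "\<exists>C\<ge>0. \<forall>t\<ge>0. \<forall>a l. 0 \<le> l \<longrightarrow> integrable M (\<lambda>w. (height_fluctuation t a l w)\<^sup>2) \<and>
    expectation (\<lambda>w. (height_fluctuation t a l w)\<^sup>2) \<le> C * (\<bar>of_int a\<bar> + (2 * of_int l + 1)\<^sup>2)"
proof -
  obtain C where C: "0 < C" "\<And>t A. 0 \<le> t \<Longrightarrow> finite A \<Longrightarrow> integrable M (\<lambda>w. (\<Sum>i\<in>A. of_int (X t w i) - mean_spin)\<^sup>2) \<and>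
    expectation (\<lambda>w. (\<Sum>i\<in>A. of_int (X t w i) - mean_spin)\<^sup>2) \<le> C * real (card A)"
    using centered_sum_second_moment by blast
  have "integrable M (\<lambda>w. (height_fluctuation t a l w)\<^sup>2) \<and>
    expectation (\<lambda>w. (height_fluctuation t a l w)\<^sup>2) \<le> (2 * C) * (\<bar>of_int a\<bar> + (2 * of_int l + 1)\<^sup>2)"
    if t: "0 \<le> t" and l: "0 \<le> l" for t a l
  proof -
    let ?A = "{min 0 a + 1..max 0 a}" and ?L = "{a - l..a + l}"
    define u where "u w = (\<Sum>i\<in>?A. of_int (X t w i) - mean_spin)" for w
    define y where "y i w = (of_int (X t w i) - mean_spin :: real)" for i w
    have u: "integrable M (\<lambda>w. (u w)\<^sup>2)" "expectation (\<lambda>w. (u w)\<^sup>2) \<le> C * real (card ?A)"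
      unfolding u_def using C(2)[OF t, of ?A] by auto
    have y: "integrable M (\<lambda>w. (y i w)\<^sup>2)" "expectation (\<lambda>w. (y i w)\<^sup>2) \<le> C" for i
      unfolding y_def using C(2)[OF t, of "{i}"] by auto
    have [measurable]: "y i \<in> borel_measurable M" for i
      unfolding y_def using X_integrable[OF t, of i] by auto
    have [measurable]: "u \<in> borel_measurable M"
      unfolding u_def using X_integrable[OF t] by auto
    have cL: "real (card ?L) = 2 * of_int l + 1" and cA: "real (card ?A) = \<bar>of_int a\<bar>"
      using l by (auto simp: min_def max_def)
    let ?dom = "\<lambda>w. 2 * (u w)\<^sup>2 + 2 * ((\<Sum>i\<in>?L. (y i w)\<^sup>2) * real (card ?L))"
    have hf: "height_fluctuation t a l w = \<bar>u w\<bar> + (\<Sum>i\<in>?L. \<bar>y i w\<bar>)" for w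
      unfolding height_fluctuation_def u_def y_def ..
    have le: "(height_fluctuation t a l w)\<^sup>2 \<le> ?dom w" for w
    proof -
      have "(height_fluctuation t a l w)\<^sup>2 \<le> 2 * (u w)\<^sup>2 + 2 * (\<Sum>i\<in>?L. \<bar>y i w\<bar>)\<^sup>2"
        unfolding hf using sum_squares_bound[of "\<bar>u w\<bar>" "\<Sum>i\<in>?L. \<bar>y i w\<bar>"] by (simp add: power2_sum)
      moreover have "(\<Sum>i\<in>?L. \<bar>y i w\<bar>)\<^sup>2 \<le> (\<Sum>i\<in>?L. (y i w)\<^sup>2) * real (card ?L)"
        using sum_squared_le_sum_of_squares[of "\<lambda>i. \<bar>y i w\<bar>" ?L] by simp
      ultimately show ?thesis by linarith
    qed
    have dom: "integrable M ?dom"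
      using u(1) y(1) by (intro Bochner_Integration.integrable_add integrable_mult_right integrable_mult_left Bochner_Integration.integrable_sum) auto
    have int: "integrable M (\<lambda>w. (height_fluctuation t a l w)\<^sup>2)"
    proof (rule Bochner_Integration.integrable_bound[OF dom])
      show "(\<lambda>w. (height_fluctuation t a l w)\<^sup>2) \<in> borel_measurable M"
        unfolding hf by measurable
      show "AE w in M. norm ((height_fluctuation t a l w)\<^sup>2) \<le> norm (?dom w)"
        using order_trans[OF le abs_ge_self] by (intro AE_I2) simp
    qed
    have "expectation (\<lambda>w. (height_fluctuation t a l w)\<^sup>2) \<le> expectation ?dom"
      by (rule integral_mono[OF int dom le])
    also have "\<dots> = 2 * expectation (\<lambda>w. (u w)\<^sup>2) + 2 * ((\<Sum>i\<in>?L. expectation (\<lambda>w. (y i w)\<^sup>2)) * real (card ?L))"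
      using u(1) y(1) by (simp add: Bochner_Integration.integral_sum)
    also have "\<dots> \<le> 2 * (C * real (card ?A)) + 2 * ((\<Sum>i\<in>?L. C) * real (card ?L))"
      using u(2) y(2) by (intro add_mono mult_left_mono mult_right_mono sum_mono) auto
    also have "\<dots> = (2 * C) * (real (card ?A) + (real (card ?L))\<^sup>2)"
      by (simp add: power2_eq_square algebra_simps)
    finally show ?thesis
      using int unfolding cA cL by simp
  qed
  then show ?thesis
    using C(1) by (intro exI[of _ "2 * C"]) auto
qed

text \<open>Times near \<open>n\<^sup>2\<close> up to the adjacent squares differ from it by at most
  \<open>2 * n + 1\<close>, so the ray moves by at most \<open>\<bar>V\<bar>\<close> times that; the
  \<open>2\<close> covers the rounding of the ray and of the reference site.\<close>

definition window_radius :: "real \<Rightarrow> nat \<Rightarrow> int" where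
  "window_radius V n = \<lceil>\<bar>V\<bar>\<rceil> * (2 * int n + 1) + 2"

definition square_fluctuation :: "real \<Rightarrow> nat \<Rightarrow> 'w \<Rightarrow> real" where
  "square_fluctuation V n = height_fluctuation ((real n)\<^sup>2) \<lfloor>V * (real n)\<^sup>2\<rfloor> (window_radius V n)"

text \<open>The second moment of the fluctuation is of order \<open>n\<^sup>2\<close>, hence of
  order \<open>1 / n\<^sup>2\<close> after normalisation, which is summable. The divisor uses
  \<open>Suc n\<close> to be nonzero at \<open>n = 0\<close>.\<close>

lemma square_fluctuation_AE:
  "AE w in M. (\<lambda>n. square_fluctuation V n w / (real (Suc n))\<^sup>2) \<longlonglongrightarrow> 0"
proof (rule summable_L2_imp_AE_tendsto_0)
  obtain C where C: "0 \<le> C" "\<And>t a l. 0 \<le> t \<Longrightarrow> 0 \<le> l \<Longrightarrow> integrable M (\<lambda>w. (height_fluctuation t a l w)\<^sup>2) \<and>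
    expectation (\<lambda>w. (height_fluctuation t a l w)\<^sup>2) \<le> C * (\<bar>of_int a\<bar> + (2 * of_int l + 1)\<^sup>2)"
    using height_fluctuation_second_moment by blast
  define c where "c = real_of_int \<lceil>\<bar>V\<bar>\<rceil>"
  have c: "0 \<le> c" "\<bar>V\<bar> \<le> c"
    unfolding c_def by (auto simp: order_trans[OF abs_ge_zero le_of_int_ceiling])
  have wr: "0 \<le> window_radius V n" for n
    unfolding window_radius_def by (intro add_nonneg_nonneg mult_nonneg_nonneg) (auto simp: ceiling_def)
  \<comment> \<open>The reference site is at most \<open>(c + 1) * (Suc n)\<^sup>2\<close> in
    absolute value, and the window has at most \<open>(4 * c + 5) * Suc n\<close> sites.\<close>
  define B where "B = C * (c + 1 + (4 * c + 5)\<^sup>2)"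
  have sq: "integrable M (\<lambda>w. (square_fluctuation V n w)\<^sup>2)" "expectation (\<lambda>w. (square_fluctuation V n w)\<^sup>2) \<le> B * (real (Suc n))\<^sup>2" for n
  proof -
    let ?a = "\<lfloor>V * (real n)\<^sup>2\<rfloor>"
    note * = C(2)[of "(real n)\<^sup>2" "window_radius V n" ?a, OF zero_le_power2 wr]
    show "integrable M (\<lambda>w. (square_fluctuation V n w)\<^sup>2)"
      unfolding square_fluctuation_def using * by simp
    have n1: "1 \<le> real (Suc n)" "1 \<le> (real (Suc n))\<^sup>2" "(real n)\<^sup>2 \<le> (real (Suc n))\<^sup>2"
      by (auto intro!: power_mono one_le_power)
    have a: "\<bar>of_int ?a\<bar> \<le> (c + 1) * (real (Suc n))\<^sup>2"
    proof -
      have "\<bar>of_int ?a\<bar> \<le> \<bar>V * (real n)\<^sup>2\<bar> + 1"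
        by linarith
      also have "\<bar>V * (real n)\<^sup>2\<bar> \<le> c * (real (Suc n))\<^sup>2"
        unfolding abs_mult using c n1 by (intro mult_mono) auto
      finally show ?thesis
        using n1(2) by (simp only: distrib_right) linarith
    qed
    have "2 * of_int (window_radius V n) + 1 = 2 * c * (2 * real n + 1) + 5"
      unfolding window_radius_def c_def by simp
    also have "\<dots> \<le> (4 * c + 5) * real (Suc n)"
      using c by (simp add: algebra_simps)
    finally have "(2 * of_int (window_radius V n) + 1)\<^sup>2 \<le> ((4 * c + 5) * real (Suc n))\<^sup>2"
      using wr[of n] by (intro power_mono) auto
    also have "\<dots> = (4 * c + 5)\<^sup>2 * (real (Suc n))\<^sup>2"
      by (rule power_mult_distrib)
    finally have "C * (\<bar>of_int ?a\<bar> + (2 * of_int (window_radius V n) + 1)\<^sup>2) \<le> C * ((c + 1) * (real (Suc n))\<^sup>2 + (4 * c + 5)\<^sup>2 * (real (Suc n))\<^sup>2)"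
      using a C(1) by (intro mult_left_mono add_mono) auto
    also have "\<dots> = B * (real (Suc n))\<^sup>2"
      unfolding B_def by (simp only: distrib_right mult.assoc)
    finally show "expectation (\<lambda>w. (square_fluctuation V n w)\<^sup>2) \<le> B * (real (Suc n))\<^sup>2"
      unfolding square_fluctuation_def using * by linarith
  qed
  have quot: "(square_fluctuation V n w / (real (Suc n))\<^sup>2)\<^sup>2 = (square_fluctuation V n w)\<^sup>2 / ((real (Suc n))\<^sup>2)\<^sup>2" for n w
    by (rule power_divide)
  show "integrable M (\<lambda>w. (square_fluctuation V n w / (real (Suc n))\<^sup>2)\<^sup>2)" for n
    unfolding quot using sq(1)[of n] by (rule integrable_divide)
  show "summable (\<lambda>n. expectation (\<lambda>w. (square_fluctuation V n w / (real (Suc n))\<^sup>2)\<^sup>2))"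
  proof (rule summable_comparison_test')
    show "summable (\<lambda>n. B * (1 / (real (Suc n))\<^sup>2))"
      using inverse_squares_sums by (intro summable_mult) (auto simp: sums_iff add.commute)
    fix n
    have "expectation (\<lambda>w. (square_fluctuation V n w / (real (Suc n))\<^sup>2)\<^sup>2) = expectation (\<lambda>w. (square_fluctuation V n w)\<^sup>2) / ((real (Suc n))\<^sup>2)\<^sup>2"
      unfolding quot by simp
    also have "\<dots> \<le> B * (real (Suc n))\<^sup>2 / ((real (Suc n))\<^sup>2)\<^sup>2"
      by (intro divide_right_mono sq(2)) auto
    also have "\<dots> = B * (1 / (real (Suc n))\<^sup>2)"
      by (simp add: power2_eq_square del: of_nat_Suc)
    finally show "norm (expectation (\<lambda>w. (square_fluctuation V n w / (real (Suc n))\<^sup>2)\<^sup>2)) \<le> B * (1 / (real (Suc n))\<^sup>2)"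
      by (simp add: integral_nonneg_AE)
  qed
qed

end

context stationary_deposition
begin

lemma abs_centered_height_le_square_fluctuation:
  assumes hw: "heights_of (\<lambda>t. X t w) (\<lambda>t. h t w)"
    and k: "\<bar>of_int k - V * t\<bar> \<le> 1" and t: "\<bar>t - (real n)\<^sup>2\<bar> \<le> 2 * real n + 1"
  shows "\<bar>centered_height ((real n)\<^sup>2) w k\<bar> \<le> square_fluctuation V n w"
  unfolding square_fluctuation_def
proof (rule abs_centered_height_le[OF hw zero_le_power2])
  let ?a = "\<lfloor>V * (real n)\<^sup>2\<rfloor>"
  have "\<bar>V * t - V * (real n)\<^sup>2\<bar> = \<bar>V\<bar> * \<bar>t - (real n)\<^sup>2\<bar>"
    by (simp only: abs_mult[symmetric] right_diff_distrib)
  also have "\<dots> \<le> of_int \<lceil>\<bar>V\<bar>\<rceil> * (2 * real n + 1)"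
    using t by (intro mult_mono) (auto simp: order_trans[OF abs_ge_zero le_of_int_ceiling])
  finally have "\<bar>of_int k - of_int ?a\<bar> \<le> of_int \<lceil>\<bar>V\<bar>\<rceil> * (2 * real n + 1) + (2 :: real)"
    using k by linarith
  then have "(of_int \<bar>k - ?a\<bar> :: real) \<le> of_int (window_radius V n)"
    unfolding window_radius_def by simp
  then show "\<bar>k - ?a\<bar> \<le> window_radius V n"
    by (simp only: of_int_le_iff)
qed

text \<open>The site \<open>k t\<close> is kept fixed while the time is moved to the neighbouring
  squares, where monotonicity of the height applies. Allowing any \<open>k\<close> within
  \<open>1\<close> of the ray covers both roundings and the constant site \<open>0\<close>.\<close>

theorem height_along_ray_AE_tendsto:
  assumes k: "\<And>t. 0 \<le> t \<Longrightarrow> \<bar>of_int (k t) - V * t\<bar> \<le> 1"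
  shows "AE w in M. ((\<lambda>t. of_int (h t w (k t) - h 0 w 0) / t) \<longlongrightarrow> flux - V * mean_spin) at_top"
  using heights current_AE_tendsto square_fluctuation_AE[of V]
proof (elim AE_mp, intro AE_I2 impI)
  fix w assume hw: "heights_of (\<lambda>t. X t w) (\<lambda>t. h t w)"
    and cur: "(\<lambda>n. current 0 n w / real n) \<longlonglongrightarrow> flux"
    and fluct: "(\<lambda>n. square_fluctuation V n w / (real (Suc n))\<^sup>2) \<longlonglongrightarrow> 0"
  let ?n = root_floor
  \<comment> \<open>The height at a square time equals the current through bond \<open>0\<close>,
    minus the mean spin times the site, plus a centred height; \<open>lo\<close> and
    \<open>up\<close> replace the last by its bound.\<close>
  define lo where "lo t = (current 0 ((?n t)\<^sup>2) w - mean_spin * of_int (k t) - square_fluctuation V (?n t) w) / t" for t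
  define up where "up t = (current 0 ((Suc (?n t))\<^sup>2) w - mean_spin * of_int (k t) + square_fluctuation V (Suc (?n t)) w) / t" for t
  have ev: "eventually (\<lambda>t::real. 1 \<le> t \<and> 1 \<le> ?n t) at_top"
    using filterlim_at_top[THEN iffD1, OF root_floor_at_top, rule_format, of 1]
    by (intro eventually_conj eventually_ge_at_top)
  have Suc_at_top: "filterlim (\<lambda>t. Suc (?n t)) sequentially at_top"
    by (rule filterlim_compose[OF filterlim_Suc root_floor_at_top])
  have sq_at_top: "filterlim (\<lambda>t. (g t)\<^sup>2) sequentially at_top" if "filterlim g sequentially at_top" for g :: "real \<Rightarrow> nat"
  proof (rule filterlim_at_top_mono[OF that])
    have "x \<le> x\<^sup>2" for x :: nat
      by (cases x) (auto simp: power2_eq_square)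
    then show "eventually (\<lambda>t. g t \<le> (g t)\<^sup>2) at_top"
      by simp
  qed
  have kt: "((\<lambda>t. of_int (k t) / t) \<longlongrightarrow> V) at_top"
  proof (rule tendsto_sandwich)
    show "eventually (\<lambda>t. V - 1 / t \<le> of_int (k t) / t) at_top"
      using ev
    proof eventually_elim
      case (elim t)
      have "(V * t - 1) / t \<le> of_int (k t) / t"
        using k[of t] elim by (intro divide_right_mono) auto
      then show ?case
        using elim by (simp add: diff_divide_distrib)
    qed
    show "eventually (\<lambda>t. of_int (k t) / t \<le> V + 1 / t) at_top"
      using ev
    proof eventually_elim
      case (elim t)
      have "of_int (k t) / t \<le> (V * t + 1) / t"
        using k[of t] elim by (intro divide_right_mono) auto
      then show ?case
        using elim by (simp add: add_divide_distrib)
    qed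
    have inv: "((\<lambda>t::real. 1 / t) \<longlongrightarrow> 0) at_top"
      using tendsto_inverse_0_at_top[OF filterlim_ident] by (simp add: inverse_eq_divide)
    show "((\<lambda>t. V - 1 / t) \<longlongrightarrow> V) at_top" "((\<lambda>t. V + 1 / t) \<longlongrightarrow> V) at_top"
      using tendsto_diff[OF tendsto_const inv, of V] tendsto_add[OF tendsto_const inv, of V] by simp_all
  qed
  have cur_sq: "((\<lambda>t. current 0 ((g t)\<^sup>2) w / real ((g t)\<^sup>2)) \<longlongrightarrow> flux) at_top" if "filterlim g sequentially at_top" for g :: "real \<Rightarrow> nat"
    by (rule filterlim_compose[OF cur sq_at_top[OF that]])
  have "((\<lambda>t. current 0 ((?n t)\<^sup>2) w / real ((?n t)\<^sup>2) * ((real (?n t))\<^sup>2 / t) - mean_spin * (of_int (k t) / t)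
      - square_fluctuation V (?n t) w / (real (Suc (?n t)))\<^sup>2 * ((real (Suc (?n t)))\<^sup>2 / t)) \<longlongrightarrow> flux * 1 - mean_spin * V - 0 * 1) at_top"
    by (intro tendsto_diff tendsto_mult tendsto_const cur_sq root_floor_at_top root_floor_ratio kt filterlim_compose[OF fluct root_floor_at_top])
  then have lo_lim: "(lo \<longlongrightarrow> flux * 1 - mean_spin * V - 0 * 1) at_top"
  proof (rule Lim_transform_eventually)
    show "eventually (\<lambda>t. current 0 ((?n t)\<^sup>2) w / real ((?n t)\<^sup>2) * ((real (?n t))\<^sup>2 / t) - mean_spin * (of_int (k t) / t)
      - square_fluctuation V (?n t) w / (real (Suc (?n t)))\<^sup>2 * ((real (Suc (?n t)))\<^sup>2 / t) = lo t) at_top"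
      using ev
    proof eventually_elim
      case (elim t)
      then have "real (?n t) \<noteq> 0" "t \<noteq> 0" "real (Suc (?n t)) \<noteq> 0" by auto
      then show ?case
        unfolding lo_def by (simp add: diff_divide_distrib del: of_nat_Suc)
    qed
  qed
  \<comment> \<open>At the upper square the index is \<open>Suc (root_floor t)\<close>, so the
    fluctuation is normalised by the square after that, and one more ratio of consecutive squares
    appears.\<close>
  have "((\<lambda>t. current 0 ((Suc (?n t))\<^sup>2) w / real ((Suc (?n t))\<^sup>2) * ((real (Suc (?n t)))\<^sup>2 / t) - mean_spin * (of_int (k t) / t)
      + square_fluctuation V (Suc (?n t)) w / (real (Suc (Suc (?n t))))\<^sup>2 *
        ((real (Suc (Suc (?n t))) / real (Suc (?n t)))\<^sup>2 * ((real (Suc (?n t)))\<^sup>2 / t))) \<longlongrightarrow> flux * 1 - mean_spin * V + 0 * (1\<^sup>2 * 1)) at_top"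
    by (intro tendsto_diff tendsto_add tendsto_mult tendsto_const tendsto_power cur_sq Suc_at_top root_floor_ratio kt
        filterlim_compose[OF fluct Suc_at_top] filterlim_compose[OF LIMSEQ_Suc_n_over_n Suc_at_top])
  then have up_lim: "(up \<longlongrightarrow> flux * 1 - mean_spin * V + 0 * (1\<^sup>2 * 1)) at_top"
  proof (rule Lim_transform_eventually)
    show "eventually (\<lambda>t. current 0 ((Suc (?n t))\<^sup>2) w / real ((Suc (?n t))\<^sup>2) * ((real (Suc (?n t)))\<^sup>2 / t) - mean_spin * (of_int (k t) / t)
      + square_fluctuation V (Suc (?n t)) w / (real (Suc (Suc (?n t))))\<^sup>2 *
        ((real (Suc (Suc (?n t))) / real (Suc (?n t)))\<^sup>2 * ((real (Suc (?n t)))\<^sup>2 / t)) = up t) at_top"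
      using ev
    proof eventually_elim
      case (elim t)
      then have "t \<noteq> 0" "real (Suc (?n t)) \<noteq> 0" "real (Suc (Suc (?n t))) \<noteq> 0" by auto
      then show ?case
        unfolding up_def by (simp add: diff_divide_distrib add_divide_distrib power_divide del: of_nat_Suc)
    qed
  qed
  have height: "(of_int (h ((real n)\<^sup>2) w a - h 0 w 0) :: real) = current 0 (n\<^sup>2) w + centered_height ((real n)\<^sup>2) w a - mean_spin * of_int a" for n a
    unfolding current_def centered_height_def by simp
  have both: "eventually (\<lambda>t. lo t \<le> of_int (h t w (k t) - h 0 w 0) / t \<and> of_int (h t w (k t) - h 0 w 0) / t \<le> up t) at_top"
    using ev
  proof eventually_elim
    case (elim t)
    then have t: "0 < t" "0 \<le> t" by auto
    note b = root_floor_bounds[OF t(2)]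
    have expand: "(real (Suc (?n t)))\<^sup>2 = (real (?n t))\<^sup>2 + 2 * real (?n t) + 1"
      by (simp add: power2_eq_square algebra_simps)
    have "\<bar>centered_height ((real (?n t))\<^sup>2) w (k t)\<bar> \<le> square_fluctuation V (?n t) w"
      by (rule abs_centered_height_le_square_fluctuation[OF hw k[OF t(2)]]) (use b expand in linarith)
    moreover have "h ((real (?n t))\<^sup>2) w (k t) \<le> h t w (k t)"
      by (rule heights_mono[OF hw zero_le_power2 b(1)])
    then have "(of_int (h ((real (?n t))\<^sup>2) w (k t) - h 0 w 0) :: real) \<le> of_int (h t w (k t) - h 0 w 0)"
      by (simp only: of_int_le_iff diff_right_mono)
    ultimately have low: "current 0 ((?n t)\<^sup>2) w - mean_spin * of_int (k t) - square_fluctuation V (?n t) w \<le> of_int (h t w (k t) - h 0 w 0)"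
      unfolding height by linarith
    have "\<bar>centered_height ((real (Suc (?n t)))\<^sup>2) w (k t)\<bar> \<le> square_fluctuation V (Suc (?n t)) w"
      by (rule abs_centered_height_le_square_fluctuation[OF hw k[OF t(2)]]) (use b expand in \<open>simp add: abs_le_iff\<close>)
    moreover have "h t w (k t) \<le> h ((real (Suc (?n t)))\<^sup>2) w (k t)"
      by (rule heights_mono[OF hw t(2) b(2)])
    then have "(of_int (h t w (k t) - h 0 w 0) :: real) \<le> of_int (h ((real (Suc (?n t)))\<^sup>2) w (k t) - h 0 w 0)"
      by (simp only: of_int_le_iff diff_right_mono)
    ultimately have "of_int (h t w (k t) - h 0 w 0) \<le> current 0 ((Suc (?n t))\<^sup>2) w - mean_spin * of_int (k t) + square_fluctuation V (Suc (?n t)) w"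
      unfolding height by linarith
    with low show ?case
      unfolding lo_def up_def using t by (intro conjI divide_right_mono) auto
  qed
  show "((\<lambda>t. of_int (h t w (k t) - h 0 w 0) / t) \<longlongrightarrow> flux - V * mean_spin) at_top"
  proof (rule tendsto_sandwich)
    show "eventually (\<lambda>t. lo t \<le> of_int (h t w (k t) - h 0 w 0) / t) at_top" "eventually (\<lambda>t. of_int (h t w (k t) - h 0 w 0) / t \<le> up t) at_top"
      using both by (auto elim: eventually_mono)
    show "(lo \<longlongrightarrow> flux - V * mean_spin) at_top" "(up \<longlongrightarrow> flux - V * mean_spin) at_top"
      using lo_lim up_lim by (simp_all add: mult.commute)
  qed
qed

end

theorem mainTheorem1:
  fixes wmin wmax :: "int extended"
    and r :: "int \<Rightarrow> int \<Rightarrow> real"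
    and f1 \<theta> V :: real
    and T :: "config set"
    and K :: "real \<Rightarrow> config \<Rightarrow> config measure"
    and M :: "'w measure"
    and X :: "real \<Rightarrow> 'w \<Rightarrow> config"
    and h :: "real \<Rightarrow> 'w \<Rightarrow> int \<Rightarrow> int"
  assumes "wmin \<le> Fin 0" and "Fin 1 \<le> wmax"
    and "deposition_rates wmin wmax r"
    and "0 < f1"
    and "theta_lower wmin r f1 < theta_upper wmax r f1"
    and "tempered_dynamics wmin wmax r f1 T K"
    and "theta_lower wmin r f1 < ereal \<theta>" and "ereal \<theta> < theta_upper wmax r f1"
    and "markov_process T K M X"
    and "distr M (tempered_space T) (X 0) = restrict_space (product_law wmin wmax r f1 \<theta>) T"
    and "\<And>t i. 0 \<le> t \<Longrightarrow> (\<lambda>w. h t w i) \<in> M \<rightarrow>\<^sub>M count_space UNIV"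
    and "AE w in M. heights_of (\<lambda>t. X t w) (\<lambda>t. h t w)"
  shows "AE w in M.
    ((\<lambda>t. of_int (growth V (\<lambda>s. h s w) t) / t) \<longlongrightarrow>
      prob_space.expectation M (\<lambda>w. r (X 0 w 0) (X 0 w 1))
        - V * prob_space.expectation M (\<lambda>w. of_int (X 0 w 0))) at_top"
proof -
  interpret stationary_deposition wmin wmax r f1 \<theta> T K M X h
    by unfold_locales (use assms in auto)
  \<comment> \<open>A single site function for the three cases of \<open>growth\<close>, within
    \<open>1\<close> of the ray in each.\<close>
  define k where "k t = (if 0 < V then \<lfloor>V * t\<rfloor> else if V < 0 then \<lceil>V * t\<rceil> else 0)" for t
  have k: "\<bar>of_int (k t) - V * t\<bar> \<le> 1" for t
    by (cases V "0 :: real" rule: linorder_cases) (simp_all add: k_def, linarith+)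
  have growth: "growth V (\<lambda>s. h s w) t = h t w (k t) - h 0 w 0" for w t
    unfolding growth_def k_def by simp
  show ?thesis
    using height_along_ray_AE_tendsto[of k V, OF k] unfolding growth flux_def mean_spin_def .
qed

end
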